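(* Let $P^{\rm c}_{\rm s}, P^{\rm c}_{\rm w}, P^{\rm c}_{\rm r}, P_{\rm s}, P_{\rm w}, P_{\rm r}\subset[1,\infty]$ be sets satisfying: (i) each of them is of the form $\{\infty\}$, $[p_0,\infty]$ or $(p_0,\infty]$ for some $p_0\in[1,\infty)$; (ii) $P_{\rm s}\subset P^{\rm c}_{\rm s}$, $P_{\rm w}\subset P^{\rm c}_{\rm w}$, $P_{\rm r}\subset P^{\rm c}_{\rm r}$, $P^{\rm c}_{\rm s}\subset P^{\rm c}_{\rm w}\subset P^{\rm c}_{\rm r}\subset \overline{P^{\rm c}_{\rm s}}$ and $P_{\rm s}\subset P_{\rm w}\subset P_{\rm r}\subset\overline{P_{\rm s}}$, where $\overline{E}$ is the closure of $E$ in the usual topology of $\mathbb{R}\cup\{\infty\}$; (iii) if $P^{\rm c}_{\rm r}=[1,\infty]$ then $P^{\rm c}_{\rm w}=[1,\infty]$, and if $P_{\rm r}=[1,\infty]$ then $P_{\rm w}=[1,\infty]$. Then there exists a nondoubling metric measure space $\mathfrak{Z}$ such that: $\mathcal{M}^{\rm c}_{\mathfrak Z}$ is of strong (respectively weak, restricted weak) type $(p,p)$ if and only if $p\in P^{\rm c}_{\rm s}$ (respectively $p\in P^{\rm c}_{\rm w}$, $p\in P^{\rm c}_{\rm r}$), and $\mathcal{M}_{\mathfrak Z}$ is of strong (respectively weak, restricted weak) type $(p,p)$ if and only if $p\in P_{\rm s}$ (respectively $p\in P_{\rm w}$, $p\in P_{\rm r}$).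
   Context: A metric measure space $\mathfrak X=(X,\rho,\mu)$ consists of a nonempty set $X$, a metric $\rho$ and a nonnegative Borel measure $\mu$; it is assumed that every open ball $B(x,s)=\{y:\rho(x,y)<s\}$ has finite strictly positive measure. $\mathfrak X$ is doubling if there is $C$ with $\mu(B(x,2s))\le C\mu(B(x,s))$ for all $x\in X$, $s>0$. For $f$ integrable on every ball, the centered and noncentered Hardy–Littlewood maximal operators are $\mathcal M^{\rm c}_{\mathfrak X}f(x)=\sup_{s>0}\frac1{\mu(B(x,s))}\int_{B(x,s)}|f|\,d\mu$ and $\mathcal M_{\mathfrak X}f(x)=\sup_{B\ni x}\frac1{\mu(B)}\int_B|f|\,d\mu$ (sup over open balls containing $x$). An operator $T$ is of strong type $(p,p)$, $p\in[1,\infty]$, if $\|Tf\|_p\lesssim\|f\|_p$ on $L^p$; of weak type $(p,p)$, $p<\infty$, if $\lambda\,\mu(\{|Tf|>\lambda\})^{1/p}\lesssim\|f\|_p$ uniformly in $f\in L^p$, $\lambda>0$ (weak type $(\infty,\infty)$ means strong type $(\infty,\infty)$); of restricted weak type $(p,p)$, for $p\in(1,\infty)$, if $\lambda\,\mu(\{|T\mathbf 1_E|>\lambda\})^{1/p}\lesssim \mu(E)^{1/p}$ uniformly in measurable $E$ with $\mu(E)<\infty$ and $\lambda>0$; restricted weak type $(1,1)$ means weak type $(1,1)$, and restricted weak type $(\infty,\infty)$ means boundedness on $L^\infty$. *)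

theory Defs
  imports "HOL-Analysis.Analysis" "HOL-Probability.Essential_Supremum"
begin

definition mborel_sets :: "'a set \<Rightarrow> ('a \<Rightarrow> 'a \<Rightarrow> real) \<Rightarrow> 'a set set" where
  "mborel_sets X \<rho> = sigma_sets X {U. openin (Metric_space.mtopology X \<rho>) U}"

definition mms :: "'a set \<Rightarrow> ('a \<Rightarrow> 'a \<Rightarrow> real) \<Rightarrow> 'a measure \<Rightarrow> bool" where
  "mms X \<rho> M \<longleftrightarrow> X \<noteq> {} \<and> Metric_space X \<rho> \<and> space M = X \<and> sets M = mborel_sets X \<rho> \<and>
     (\<forall>x\<in>X. \<forall>s>0. 0 < emeasure M (Metric_space.mball X \<rho> x s) \<and>
                   emeasure M (Metric_space.mball X \<rho> x s) < \<infinity>)"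

definition doubling :: "'a set \<Rightarrow> ('a \<Rightarrow> 'a \<Rightarrow> real) \<Rightarrow> 'a measure \<Rightarrow> bool" where
  "doubling X \<rho> M \<longleftrightarrow> (\<exists>(C::real).  \<forall>x\<in>X. \<forall>s>0.
      emeasure M (Metric_space.mball X \<rho> x (2 * s)) \<le> ennreal C * emeasure M (Metric_space.mball X \<rho> x s))"

definition avg :: "'a measure \<Rightarrow> ('a \<Rightarrow> real) \<Rightarrow> 'a set \<Rightarrow> ennreal" where
  "avg M f B = (\<integral>\<^sup>+y\<in>B. ennreal \<bar>f y\<bar> \<partial>M) / emeasure M B"

definition maxc :: "'a set \<Rightarrow> ('a \<Rightarrow> 'a \<Rightarrow> real) \<Rightarrow> 'a measure \<Rightarrow> ('a \<Rightarrow> real) \<Rightarrow> 'a \<Rightarrow> ennreal" where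
  "maxc X \<rho> M f x = (SUP s\<in>{0<..}. avg M f (Metric_space.mball X \<rho> x s))"

definition maxnc :: "'a set \<Rightarrow> ('a \<Rightarrow> 'a \<Rightarrow> real) \<Rightarrow> 'a measure \<Rightarrow> ('a \<Rightarrow> real) \<Rightarrow> 'a \<Rightarrow> ennreal" where
  "maxnc X \<rho> M f x = (SUP B\<in>{B. \<exists>z\<in>X. \<exists>s>0. B = Metric_space.mball X \<rho> z s \<and> x \<in> B}. avg M f B)"

definition epow :: "ennreal \<Rightarrow> real \<Rightarrow> ennreal" where
  "epow a p = (if a = \<infinity> then \<infinity> else ennreal (enn2real a powr p))"

definition Lp_pow :: "'a measure \<Rightarrow> real \<Rightarrow> ('a \<Rightarrow> real) \<Rightarrow> ennreal" where
  "Lp_pow M p f = (\<integral>\<^sup>+x. ennreal (\<bar>f x\<bar> powr p) \<partial>M)"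

definition Linf_norm :: "'a measure \<Rightarrow> ('a \<Rightarrow> real) \<Rightarrow> ennreal" where
  "Linf_norm M f = esssup M (\<lambda>x. ennreal \<bar>f x\<bar>)"

definition in_Lp :: "'a measure \<Rightarrow> ereal \<Rightarrow> ('a \<Rightarrow> real) \<Rightarrow> bool" where
  "in_Lp M p f \<longleftrightarrow> f \<in> borel_measurable M \<and>
     (if p = \<infinity> then Linf_norm M f < \<infinity> else Lp_pow M (real_of_ereal p) f < \<infinity>)"

definition bounded_Linf :: "'a measure \<Rightarrow> (('a \<Rightarrow> real) \<Rightarrow> 'a \<Rightarrow> ennreal) \<Rightarrow> bool" where
  "bounded_Linf M T \<longleftrightarrow> (\<exists>(C::real).  \<forall>f. in_Lp M \<infinity> f \<longrightarrow>
      outer_measure_of M {x\<in>space M. T f x > ennreal C * Linf_norm M f} = 0)"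

definition strong_type :: "'a measure \<Rightarrow> (('a \<Rightarrow> real) \<Rightarrow> 'a \<Rightarrow> ennreal) \<Rightarrow> ereal \<Rightarrow> bool" where
  "strong_type M T p \<longleftrightarrow>
     (if p = \<infinity> then bounded_Linf M T
      else (\<exists>(C::real).  \<forall>f. in_Lp M p f \<longrightarrow>
              (\<integral>\<^sup>+x. epow (T f x) (real_of_ereal p) \<partial>M) \<le> ennreal C * Lp_pow M (real_of_ereal p) f))"

definition weak_type :: "'a measure \<Rightarrow> (('a \<Rightarrow> real) \<Rightarrow> 'a \<Rightarrow> ennreal) \<Rightarrow> ereal \<Rightarrow> bool" where
  "weak_type M T p \<longleftrightarrow>
     (if p = \<infinity> then bounded_Linf M T
      else (\<exists>(C::real).  \<forall>f t::real. in_Lp M p f \<longrightarrow> t > 0 \<longrightarrow>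
              ennreal (t powr real_of_ereal p) * outer_measure_of M {x\<in>space M. T f x > ennreal t}
                \<le> ennreal C * Lp_pow M (real_of_ereal p) f))"

definition restricted_weak_type :: "'a measure \<Rightarrow> (('a \<Rightarrow> real) \<Rightarrow> 'a \<Rightarrow> ennreal) \<Rightarrow> ereal \<Rightarrow> bool" where
  "restricted_weak_type M T p \<longleftrightarrow>
     (if p = \<infinity> then bounded_Linf M T
      else if p = 1 then weak_type M T 1
      else (\<exists>(C::real).  \<forall>E t::real. E \<in> sets M \<longrightarrow> emeasure M E < \<infinity> \<longrightarrow> t > 0 \<longrightarrow>
              ennreal (t powr real_of_ereal p) *
                outer_measure_of M {x\<in>space M. T (indicator E) x > ennreal t}
                \<le> ennreal C * emeasure M E))"

definition exp_set :: "ereal set \<Rightarrow> bool" where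
  "exp_set P \<longleftrightarrow> P = {\<infinity>} \<or>
     (\<exists>p0::real. 1 \<le> p0 \<and> (P = {ereal p0..\<infinity>} \<or> P = {ereal p0<..\<infinity>}))"

end

theory Submission
  imports Defs "HOL-Real_Asymp.Real_Asymp"
begin

text \<open>
  A countable set carries a graph metric with values in \<open>{0, 1, 2}\<close>, so every ball is a point, the
  closed neighbourhood of a point, or the whole space. A heavy hub adjacent to all base points makes
  the averages over the neighbourhoods of the hub and of the base points comparable to the average
  over the whole space, hence harmless on every \<open>L\<^sup>p\<close>. The remaining balls consist of a target \<open>u\<close>,
  its centre \<open>c u\<close> of tiny mass, and a finite set \<open>A u\<close> of base points; they are centred at \<open>c u\<close>. The
  noncentred maximal operator therefore behaves like \<open>T f u = (\<Sum>b\<in>A u. w b * \<bar>f b\<bar>) / w u\<close>. The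
  centred one sees \<open>T\<close> only on the components where \<open>u\<close> is itself adjacent to \<open>A u\<close>, because
  elsewhere the ball is used only at the point \<open>c u\<close>.

  All mapping properties are thus uniform bounds for \<open>T\<close> over a sequence of finite bipartite graphs,
  and a union of two sequences, one with and one without these extra edges, prescribes both operators.
  Stars (one base point of mass 1) with \<open>N i\<close> targets of mass \<open>2 ^ i\<close> have strong constant
  \<open>\<Sum>i. N i * 2 powr (i * (1 - p))\<close>, and their weak and restricted weak constants agree. Trees
  separate restricted weak from weak type: each target sees one base point on every dyadic level, with
  level masses dual to weak \<open>L\<^sup>p\<close>.
\<close>

section \<open>Averaging operators of finite bipartite graphs\<close>

text \<open>A single finite graph satisfies each of the three inequalities with some constant, so
  only uniformity along a sequence carries information. Multiplying all masses of a graph by one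
  factor leaves \<open>T\<close> unchanged and multiplies both sides of each inequality by that
  factor. Hence the n-th graph may be shrunk to total mass at most \<open>(1 / 2) ^ n\<close>. The
  whole space then has finite mass, so that averages over sets through the hub are bounded by a
  global norm; and it is nondoubling, since arbitrarily light points lie within distance 2 of
  everything.

  The obstacle is to let the noncentred operator use a ball that the centred one cannot exploit. The
  centred operator still uses the ball about \<open>c u\<close> at the point \<open>c u\<close>, and
  this is negligible because the ratios of the masses of \<open>c u\<close> and \<open>u\<close> are
  summable over all targets.

  The noncentred operator sees both sequences and is therefore bounded for the exponents in an
  intersection. The inclusions of the noncentred exponent sets in the centred ones reduce this
  intersection to the noncentred set, so the two sequences can be chosen independently.\<close>

record ('b, 'u) bigraph =
  base :: "'b set"
  targets :: "'u set"
  link :: "'u \<Rightarrow> 'b set"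
  bwt :: "'b \<Rightarrow> real"
  twt :: "'u \<Rightarrow> real"

text \<open>The bound with \<open>K\<close> makes the mass of a target together with its linked base
  points comparable to \<open>twt G u\<close> alone. This is why \<open>fan_avg\<close> may divide
  by the mass of the target instead of that of the ball.\<close>

definition fan_graph :: "real \<Rightarrow> ('b, 'u) bigraph \<Rightarrow> bool" where
  "fan_graph K G \<longleftrightarrow> finite (base G) \<and> finite (targets G) \<and> base G \<noteq> {} \<and>
     (\<forall>b\<in>base G. 0 < bwt G b) \<and>
     (\<forall>u\<in>targets G. link G u \<subseteq> base G \<and> 0 < twt G u \<and> sum (bwt G) (link G u) \<le> K * twt G u)"

definition fan_avg :: "('b, 'u) bigraph \<Rightarrow> ('b \<Rightarrow> real) \<Rightarrow> 'u \<Rightarrow> real" where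
  "fan_avg G f u = (\<Sum>b\<in>link G u. bwt G b * f b) / twt G u"

text \<open>The constant is an explicit argument so that uniformity over a sequence of graphs can be
  expressed. Nonnegative \<open>f\<close> suffice because the maximal operators only see the
  absolute value.\<close>

definition fan_strong :: "('b, 'u) bigraph \<Rightarrow> real \<Rightarrow> real \<Rightarrow> bool" where
  "fan_strong G p C \<longleftrightarrow> (\<forall>f. (\<forall>b. 0 \<le> f b) \<longrightarrow>
     (\<Sum>u\<in>targets G. twt G u * fan_avg G f u powr p) \<le> C * (\<Sum>b\<in>base G. bwt G b * f b powr p))"

definition fan_weak :: "('b, 'u) bigraph \<Rightarrow> real \<Rightarrow> real \<Rightarrow> bool" where
  "fan_weak G p C \<longleftrightarrow> (\<forall>f t. (\<forall>b. 0 \<le> f b) \<longrightarrow> 0 < t \<longrightarrow>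
     t powr p * (\<Sum>u | u \<in> targets G \<and> t < fan_avg G f u. twt G u)
       \<le> C * (\<Sum>b\<in>base G. bwt G b * f b powr p))"

definition fan_restricted :: "('b, 'u) bigraph \<Rightarrow> real \<Rightarrow> real \<Rightarrow> bool" where
  "fan_restricted G p C \<longleftrightarrow> (\<forall>E t. E \<subseteq> base G \<longrightarrow> 0 < t \<longrightarrow>
     t powr p * (\<Sum>u | u \<in> targets G \<and> t < fan_avg G (indicator E) u. twt G u)
       \<le> C * sum (bwt G) E)"

lemma fan_strong_imp_weak:
  assumes "fan_graph K G" "0 < p" "fan_strong G p C"
  shows "fan_weak G p C"
  unfolding fan_weak_def
proof (intro allI impI)
  fix f :: "'a \<Rightarrow> real" and t :: real
  assume f: "\<forall>b. 0 \<le> f b" and t: "0 < t"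
  let ?S = "{u. u \<in> targets G \<and> t < fan_avg G f u}"
  have fin: "finite (targets G)" and pos: "\<And>u. u \<in> targets G \<Longrightarrow> 0 < twt G u"
    using assms(1) by (auto simp: fan_graph_def)
  have "t powr p * (\<Sum>u\<in>?S. twt G u) = (\<Sum>u\<in>?S. twt G u * t powr p)"
    by (simp add: sum_distrib_left mult.commute)
  also have "\<dots> \<le> (\<Sum>u\<in>?S. twt G u * fan_avg G f u powr p)"
    using t assms(2) pos by (intro sum_mono mult_left_mono powr_mono2) (auto intro: less_imp_le)
  also have "\<dots> \<le> (\<Sum>u\<in>targets G. twt G u * fan_avg G f u powr p)"
    using fin pos by (intro sum_mono2) (simp_all add: less_imp_le)
  also have "\<dots> \<le> C * (\<Sum>b\<in>base G. bwt G b * f b powr p)"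
    using assms(3) f by (auto simp: fan_strong_def)
  finally show "t powr p * sum (twt G) ?S \<le> C * (\<Sum>b\<in>base G. bwt G b * f b powr p)" .
qed

lemma fan_weak_imp_restricted:
  assumes "fan_graph K G" "0 < p" "fan_weak G p C"
  shows "fan_restricted G p C"
  unfolding fan_restricted_def
proof (intro allI impI)
  fix E t assume E: "E \<subseteq> base G" and t: "0 < (t::real)"
  have fin: "finite (base G)"
    using assms(1) by (auto simp: fan_graph_def)
  have "(\<Sum>b\<in>base G. bwt G b * indicator E b powr p) = (\<Sum>b\<in>E. bwt G b)"
    using fin E by (intro sum.mono_neutral_cong_right) (auto simp: indicator_def)
  then show "t powr p * (\<Sum>u | u \<in> targets G \<and> t < fan_avg G (indicator E) u. twt G u) \<le> C * sum (bwt G) E"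
    using assms(3)[unfolded fan_weak_def, rule_format, of "indicator E" t] t by auto
qed

lemma fan_graph_mono:
  assumes "fan_graph K G" "K \<le> K'"
  shows "fan_graph K' G"
proof -
  have "K * twt G u \<le> K' * twt G u" if "u \<in> targets G" for u
    using that assms by (intro mult_right_mono) (auto simp: fan_graph_def less_imp_le)
  then show ?thesis using assms(1) unfolding fan_graph_def by (meson order_trans)
qed

text \<open>Monotonicity in the constant is what allows two interleaved sequences of graphs to share
  one constant.\<close>

lemma fan_strong_mono:
  assumes "fan_graph K G" "C \<le> C'" "fan_strong G p C"
  shows "fan_strong G p C'"
  unfolding fan_strong_def
proof (intro allI impI)
  fix f :: "'a \<Rightarrow> real" assume f: "\<forall>b. 0 \<le> f b"
  have "0 \<le> (\<Sum>b\<in>base G. bwt G b * f b powr p)"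
    using assms(1) by (intro sum_nonneg) (auto simp: fan_graph_def less_imp_le)
  then have "C * (\<Sum>b\<in>base G. bwt G b * f b powr p) \<le> C' * (\<Sum>b\<in>base G. bwt G b * f b powr p)"
    using assms(2) by (rule mult_right_mono[rotated])
  then show "(\<Sum>u\<in>targets G. twt G u * fan_avg G f u powr p) \<le> C' * (\<Sum>b\<in>base G. bwt G b * f b powr p)"
    using assms(3) f unfolding fan_strong_def by (meson order_trans)
qed

lemma fan_weak_mono:
  assumes "fan_graph K G" "C \<le> C'" "fan_weak G p C"
  shows "fan_weak G p C'"
  unfolding fan_weak_def
proof (intro allI impI)
  fix f :: "'a \<Rightarrow> real" and t :: real assume f: "\<forall>b. 0 \<le> f b" and t: "0 < t"
  have "0 \<le> (\<Sum>b\<in>base G. bwt G b * f b powr p)"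
    using assms(1) by (intro sum_nonneg) (auto simp: fan_graph_def less_imp_le)
  then have "C * (\<Sum>b\<in>base G. bwt G b * f b powr p) \<le> C' * (\<Sum>b\<in>base G. bwt G b * f b powr p)"
    using assms(2) by (rule mult_right_mono[rotated])
  then show "t powr p * (\<Sum>u | u \<in> targets G \<and> t < fan_avg G f u. twt G u) \<le> C' * (\<Sum>b\<in>base G. bwt G b * f b powr p)"
    using assms(3) f t unfolding fan_weak_def by (meson order_trans)
qed

lemma fan_restricted_mono:
  assumes "fan_graph K G" "C \<le> C'" "fan_restricted G p C"
  shows "fan_restricted G p C'"
  unfolding fan_restricted_def
proof (intro allI impI)
  fix E t assume E: "E \<subseteq> base G" and t: "0 < (t :: real)"
  have "0 \<le> sum (bwt G) E"
    using assms(1) E by (intro sum_nonneg) (auto simp: fan_graph_def less_imp_le)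
  then have "C * sum (bwt G) E \<le> C' * sum (bwt G) E"
    using assms(2) by (rule mult_right_mono[rotated])
  then show "t powr p * (\<Sum>u | u \<in> targets G \<and> t < fan_avg G (indicator E) u. twt G u) \<le> C' * sum (bwt G) E"
    using assms(3) E t unfolding fan_restricted_def by (meson order_trans)
qed

section \<open>Stars\<close>

text \<open>No target is lighter than the base point, which gives \<open>K = 1\<close>. Indices are
  pairs so that stars and trees have the same type and can be glued together.\<close>

definition star :: "(nat \<Rightarrow> nat) \<Rightarrow> nat \<Rightarrow> (nat \<times> nat, nat \<times> nat) bigraph" where
  "star N n = \<lparr>base = {(0, 0)}, targets = (SIGMA i:{..n}. {..<N i}), link = (\<lambda>_. {(0, 0)}),
     bwt = (\<lambda>_. 1), twt = (\<lambda>u. 2 ^ fst u)\<rparr>"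

lemma sum_Sigma_lessThan:
  fixes g :: "nat \<Rightarrow> real"
  assumes "finite I"
  shows "(\<Sum>u\<in>(SIGMA i:I. {..<N i}). g (fst u)) = (\<Sum>i\<in>I. real (N i) * g i)"
proof -
  have "(\<Sum>u\<in>(SIGMA i:I. {..<N i}). g (fst u)) = (\<Sum>i\<in>I. \<Sum>r<N i. g i)"
    using assms by (subst sum.Sigma) (auto simp: case_prod_unfold)
  then show ?thesis by simp
qed

lemma fan_avg_star: "fan_avg (star N n) f u = f (0, 0) / 2 ^ fst u"
  by (simp add: fan_avg_def star_def)

lemma fan_graph_star: "fan_graph 1 (star N n)"
  by (auto simp: fan_graph_def star_def)

text \<open>With one base point both sides are multiples of \<open>f (0, 0) powr p\<close>, so
  \<open>f = 1\<close> is extremal.\<close>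

lemma fan_strong_star:
  assumes "1 \<le> p"
  shows "fan_strong (star N n) p C \<longleftrightarrow> (\<Sum>i\<le>n. real (N i) * 2 powr (real i * (1 - p))) \<le> C"
proof -
  let ?S = "\<Sum>i\<le>n. real (N i) * 2 powr (real i * (1 - p))"
  have eq: "(\<Sum>u\<in>targets (star N n). twt (star N n) u * fan_avg (star N n) f u powr p) = ?S * f (0, 0) powr p"
    if "\<forall>b. 0 \<le> f b" for f
  proof -
    have *: "2 ^ i * (f (0, 0) / 2 ^ i) powr p = 2 powr (real i * (1 - p)) * f (0, 0) powr p" for i
      using that by (simp add: powr_divide powr_realpow[symmetric] powr_powr algebra_simps powr_diff)
    show ?thesis
      using sum_Sigma_lessThan[of "{..n}" "\<lambda>i. 2 ^ i * (f (0, 0) / 2 ^ i) powr p" N]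
      by (simp add: fan_avg_star) (simp add: star_def * sum_distrib_right mult.assoc)
  qed
  show ?thesis
    unfolding fan_strong_def
  proof safe
    assume "\<forall>f. (\<forall>b. 0 \<le> f b) \<longrightarrow>
     (\<Sum>u\<in>targets (star N n). twt (star N n) u * fan_avg (star N n) f u powr p) \<le> C * (\<Sum>b\<in>base (star N n). bwt (star N n) b * f b powr p)"
    from this[rule_format, of "\<lambda>_. 1"] show "?S \<le> C"
      by (simp add: eq) (simp add: star_def)
  next
    fix f :: "nat \<times> nat \<Rightarrow> real" assume "?S \<le> C" "\<forall>b. 0 \<le> f b"
    then show "(\<Sum>u\<in>targets (star N n). twt (star N n) u * fan_avg (star N n) f u powr p) \<le> C * (\<Sum>b\<in>base (star N n). bwt (star N n) b * f b powr p)"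
      by (subst eq) (auto simp: star_def intro!: mult_right_mono)
  qed
qed

lemma sum_targets_star:
  assumes "0 < t"
  shows "(\<Sum>u | u \<in> targets (star N n) \<and> t < fan_avg (star N n) f u. twt (star N n) u)
    = (\<Sum>i | i \<le> n \<and> 2 ^ i < f (0, 0) / t. real (N i) * 2 ^ i)"
proof -
  have "{u. u \<in> targets (star N n) \<and> t < fan_avg (star N n) f u}
      = (SIGMA i:{i. i \<le> n \<and> 2 ^ i < f (0, 0) / t}. {..<N i})"
    using assms unfolding fan_avg_star by (auto simp: star_def field_simps)
  then show ?thesis
    using sum_Sigma_lessThan[of "{i. i \<le> n \<and> 2 ^ i < f (0, 0) / t}" "\<lambda>i. 2 ^ i" N]
    by (simp add: star_def)
qed

text \<open>The only nonempty test set is the base point. With \<open>s = 1 / t\<close> the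
  inequality bounds the growth of the mass of the targets lighter than \<open>s\<close>.\<close>

lemma fan_restricted_star:
  "fan_restricted (star N n) p C \<longleftrightarrow>
     (\<forall>s>0. (\<Sum>i | i \<le> n \<and> 2 ^ i < s. real (N i) * 2 ^ i) \<le> C * s powr p)" (is "_ \<longleftrightarrow> ?R")
proof safe
  fix s :: real assume r: "fan_restricted (star N n) p C" and s: "0 < s"
  have "(1 / s) powr p * (\<Sum>i | i \<le> n \<and> 2 ^ i < s. real (N i) * 2 ^ i) \<le> C"
    using r[unfolded fan_restricted_def, rule_format, of "{(0,0)}" "1/s"] s sum_targets_star[of "1/s" N n "indicator {(0,0)}"]
    by (simp add: star_def)
  then show "(\<Sum>i | i \<le> n \<and> 2 ^ i < s. real (N i) * 2 ^ i) \<le> C * s powr p"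
    using s by (simp add: powr_divide field_simps)
next
  assume R: ?R
  show "fan_restricted (star N n) p C"
    unfolding fan_restricted_def
  proof (intro allI impI)
    fix E :: "(nat \<times> nat) set" and t :: real
    assume E: "E \<subseteq> base (star N n)" and t: "0 < t"
    then consider "E = {}" | "E = {(0,0)}" by (auto simp: star_def)
    then show "t powr p * (\<Sum>u | u \<in> targets (star N n) \<and> t < fan_avg (star N n) (indicator E) u. twt (star N n) u)
       \<le> C * sum (bwt (star N n)) E"
    proof cases
      case 1 then show ?thesis using t by (simp add: fan_avg_star)
    next
      case 2
      have "(\<Sum>i | i \<le> n \<and> 2 ^ i < 1/t. real (N i) * 2 ^ i) \<le> C * (1/t) powr p"
        using R t by auto
      then show ?thesis using t unfolding sum_targets_star[OF t]
        by (simp add: 2 star_def powr_divide field_simps)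
    qed
  qed
qed

text \<open>A nonnegative function on one point is a multiple of an indicator, and the multiple can
  be moved into the threshold \<open>t\<close>.\<close>

lemma fan_weak_star:
  "fan_weak (star N n) p C \<longleftrightarrow> fan_restricted (star N n) p C"
proof
  assume r: "fan_weak (star N n) p C"
  show "fan_restricted (star N n) p C"
    unfolding fan_restricted_star
  proof safe
    fix s :: real assume "0 < s"
    then show "(\<Sum>i | i \<le> n \<and> 2 ^ i < s. real (N i) * 2 ^ i) \<le> C * s powr p"
      using r[unfolded fan_weak_def, rule_format, of "\<lambda>_. s" 1] sum_targets_star[of 1 N n "\<lambda>_. s"]
      by (simp add: star_def)
  qed
next
  assume "fan_restricted (star N n) p C"
  then have R: "\<And>s. s > 0 \<Longrightarrow> (\<Sum>i | i \<le> n \<and> 2 ^ i < s. real (N i) * 2 ^ i) \<le> C * s powr p"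
    by (auto simp: fan_restricted_star)
  show "fan_weak (star N n) p C"
    unfolding fan_weak_def
  proof (intro allI impI)
    fix f :: "nat \<times> nat \<Rightarrow> real" and t :: real
    assume f: "\<forall>b. 0 \<le> f b" and t: "0 < t"
    show "t powr p * (\<Sum>u | u \<in> targets (star N n) \<and> t < fan_avg (star N n) f u. twt (star N n) u)
       \<le> C * (\<Sum>b\<in>base (star N n). bwt (star N n) b * f b powr p)"
    proof (cases "f (0,0) = 0")
      case True
      then show ?thesis using t unfolding fan_avg_star by (simp add: star_def)
    next
      case False
      then have "f (0,0) > 0" using f by (simp add: order_less_le)
      then show ?thesis using R[of "f (0,0) / t"] t unfolding sum_targets_star[OF t]
        by (simp add: star_def powr_divide field_simps)
    qed
  qed
qed

text \<open>If all targets have the same mass, the average is constant on them, so the weak and the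
  strong constants differ at most by the factor \<open>2 powr p\<close>.\<close>

lemma single_level_star:
  fixes k :: "nat \<Rightarrow> nat"
  assumes p: "1 \<le> p"
  defines "G \<equiv> \<lambda>n. star (\<lambda>i. if i = n then k n else 0) n"
  shows "(\<exists>C. \<forall>n. fan_strong (G n) p C) \<longleftrightarrow> (\<exists>C. \<forall>n. real (k n) * 2 powr (real n * (1 - p)) \<le> C)" (is "?S = ?B")
    and "(\<exists>C. \<forall>n. fan_weak (G n) p C) \<longleftrightarrow> (\<exists>C. \<forall>n. real (k n) * 2 powr (real n * (1 - p)) \<le> C)" (is "?W = ?B")
    and "(\<exists>C. \<forall>n. fan_restricted (G n) p C) \<longleftrightarrow> (\<exists>C. \<forall>n. real (k n) * 2 powr (real n * (1 - p)) \<le> C)" (is "?R = ?B")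
proof -
  have "(\<Sum>i\<le>n. real (if i = n then k n else 0) * 2 powr (real i * (1 - p))) = real (k n) * 2 powr (real n * (1 - p))" for n
    by (simp add: if_distrib if_distribR sum.delta cong: if_cong)
  then show S: "?S = ?B"
    unfolding G_def by (simp add: fan_strong_star[OF p])
  show RW: "?W = ?B"
  proof
    assume ?B then have ?S using S by simp
    then show ?W using fan_strong_imp_weak[of 1 "G _" p] p fan_graph_star unfolding G_def
      by (metis less_le_trans zero_less_one)
  next
    assume ?W
    then obtain C where C: "\<And>n. fan_weak (G n) p C" by auto
    \<comment> \<open>Level \<open>n\<close> satisfies the strict condition \<open>2 ^ i < s\<close>
      only for \<open>s\<close> above \<open>2 ^ n\<close>. Testing at \<open>s = 2 ^ Suc n\<close>
      costs the factor \<open>2 powr p\<close>.\<close>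
    have "real (k n) * 2 powr (real n * (1 - p)) \<le> C * 2 powr p" for n
    proof -
      have "(\<Sum>i | i \<le> n \<and> 2 ^ i < (2::real) ^ Suc n. real (if i = n then k n else 0) * 2 ^ i) \<le> C * (2 ^ Suc n) powr p"
        using C[of n, unfolded G_def fan_weak_star fan_restricted_star, rule_format, of "2 ^ Suc n"]
        by (simp del: power_Suc)
      moreover have "(\<Sum>i | i \<le> n \<and> 2 ^ i < (2::real) ^ Suc n. real (if i = n then k n else 0) * 2 ^ i) = (\<Sum>i\<in>{n}. real (k n) * 2 ^ i)"
        by (rule sum.mono_neutral_cong_right) auto
      ultimately have *: "real (k n) * 2 ^ n \<le> C * (2 ^ Suc n) powr p" by simp
      have "real (k n) * 2 powr (real n * (1 - p)) = real (k n) * 2 ^ n * 2 powr (- (real n * p))"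
        by (simp add: powr_realpow[symmetric] powr_add[symmetric] algebra_simps)
      also have "\<dots> \<le> C * (2 ^ Suc n) powr p * 2 powr (- (real n * p))"
        by (rule mult_right_mono[OF *]) auto
      also have "\<dots> = C * 2 powr p"
        by (simp add: powr_realpow[symmetric] powr_powr powr_mult powr_minus field_simps)
      finally show ?thesis .
    qed
    then show ?B by blast
  qed
  show "?R = ?B"
    using RW unfolding G_def fan_weak_star .
qed

text \<open>Only finite exponents are constrained: every maximal operator considered here is bounded
  at infinity. Restricted weak type at 1 means weak type by definition, so that endpoint is later
  read off from \<open>W\<close>.\<close>

definition fan_family :: "(nat \<Rightarrow> ('b, 'u) bigraph) \<Rightarrow> ereal set \<Rightarrow> ereal set \<Rightarrow> ereal set \<Rightarrow> bool" where
  "fan_family G S W R \<longleftrightarrow> (\<exists>K. \<forall>n. fan_graph K (G n)) \<and> (\<forall>p\<ge>1.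
     ((\<exists>C. \<forall>n. fan_strong (G n) p C) \<longleftrightarrow> ereal p \<in> S) \<and>
     ((\<exists>C. \<forall>n. fan_weak (G n) p C) \<longleftrightarrow> ereal p \<in> W) \<and>
     ((\<exists>C. \<forall>n. fan_restricted (G n) p C) \<longleftrightarrow> ereal p \<in> R))"

lemma not_bounded_of_at_top:
  fixes f g :: "nat \<Rightarrow> real"
  assumes "filterlim f at_top sequentially" "\<And>n. f n \<le> g n"
  shows "\<not> (\<exists>C. \<forall>n. g n \<le> C)"
proof
  assume "\<exists>C. \<forall>n. g n \<le> C"
  then obtain C where "\<And>n. g n \<le> C" by auto
  then have "\<forall>n. f n \<le> C" using assms(2) order_trans by blast
  moreover have "eventually (\<lambda>n. f n > C) sequentially"
    using assms(1) by (simp add: filterlim_at_top_dense)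
  ultimately show False
    by (metis (mono_tags, lifting) eventually_sequentially linorder_not_le order_refl)
qed

lemma bounded_of_null:
  fixes f g :: "nat \<Rightarrow> real"
  assumes "f \<longlonglongrightarrow> 0" "\<And>n. g n \<le> f n"
  shows "\<exists>C. \<forall>n. g n \<le> C"
proof -
  have "Bseq f" using assms(1) by (auto intro: convergent_imp_Bseq convergentI)
  then obtain C where "\<And>n. norm (f n) \<le> C" by (auto simp: Bseq_def)
  then have "g n \<le> C" for n using assms(2)[of n] by (auto simp: abs_le_iff intro: order_trans)
  then show ?thesis by blast
qed

lemma pow2_mono: "a \<le> b \<Longrightarrow> 2 powr (real n * a) \<le> 2 powr (real n * b)"
  by (simp add: mult_left_mono)

text \<open>Calibrated so that \<open>level_count p0 n\<close> targets of mass \<open>2 ^ n\<close>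
  have constant about \<open>2 powr (n * (p0 - p))\<close>, which is critical exactly at
  \<open>p = p0\<close>.\<close>

definition level_count :: "real \<Rightarrow> nat \<Rightarrow> nat" where
  "level_count p0 n = nat \<lceil>2 powr (real n * (p0 - 1))\<rceil>"

text \<open>Since \<open>1 \<le> p0\<close>, the rounded power is at least 1, and rounding up costs
  at most a factor 2.\<close>

lemma level_count_bounds:
  assumes "1 \<le> p0"
  shows "2 powr (real n * (p0 - p)) \<le> real (level_count p0 n) * 2 powr (real n * (1 - p))"
    and "real (level_count p0 n) * 2 powr (real n * (1 - p)) \<le> 2 * 2 powr (real n * (p0 - p))"
proof -
  let ?x = "2 powr (real n * (p0 - 1))"
  have x: "1 \<le> ?x" using assms by (intro ge_one_powr_ge_zero) auto
  have c: "?x \<le> real (level_count p0 n)" "real (level_count p0 n) \<le> 2 * ?x"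
    using x by (auto simp: level_count_def) linarith+
  have e: "?x * 2 powr (real n * (1 - p)) = 2 powr (real n * (p0 - p))"
    by (simp add: powr_add[symmetric] algebra_simps)
  show "2 powr (real n * (p0 - p)) \<le> real (level_count p0 n) * 2 powr (real n * (1 - p))"
    using mult_right_mono[OF c(1), of "2 powr (real n * (1 - p))"] e by simp
  show "real (level_count p0 n) * 2 powr (real n * (1 - p)) \<le> 2 * 2 powr (real n * (p0 - p))"
    using mult_right_mono[OF c(2), of "2 powr (real n * (1 - p))"] e by (simp add: mult.assoc)
qed

lemma fan_family_single_level:
  assumes "\<And>p. 1 \<le> p \<Longrightarrow> (\<exists>C. \<forall>n. real (k n) * 2 powr (real n * (1 - p)) \<le> C) \<longleftrightarrow> ereal p \<in> S"
  shows "fan_family (\<lambda>n. star (\<lambda>i. if i = n then k n else 0) n) S S S"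
  unfolding fan_family_def
proof (intro conjI allI impI)
  show "\<exists>K. \<forall>n. fan_graph K (star (\<lambda>i. if i = n then k n else 0) n)"
    using fan_graph_star by blast
qed (simp_all only: single_level_star assms)

text \<open>The exponent \<open>n\<^sup>2\<close> in the number of targets beats the linear loss
  \<open>n * (p - 1)\<close> for every finite \<open>p\<close>.\<close>

lemma fan_family_infinity:
  "fan_family (\<lambda>n. star (\<lambda>i. if i = n then 2 ^ n\<^sup>2 else 0) n) {\<infinity>} {\<infinity>} {\<infinity>}"
proof -
  have "\<not> (\<exists>C. \<forall>n. real (2 ^ n\<^sup>2) * 2 powr (real n * (1 - p)) \<le> C)" if "1 \<le> p" for p :: real
  proof (rule not_bounded_of_at_top)
    show "filterlim (\<lambda>n. 2 powr ((real n)\<^sup>2 + real n * (1 - p))) at_top sequentially"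
      by real_asymp
    show "2 powr ((real n)\<^sup>2 + real n * (1 - p)) \<le> real (2 ^ n\<^sup>2) * 2 powr (real n * (1 - p))" for n
      by (simp add: powr_add powr_realpow[symmetric])
  qed
  then show ?thesis
    by (intro fan_family_single_level) (simp del: of_nat_power)
qed

lemma fan_family_closed:
  assumes "1 \<le> p0"
  shows "fan_family (\<lambda>n. star (\<lambda>i. if i = n then level_count p0 n else 0) n) {ereal p0..\<infinity>} {ereal p0..\<infinity>} {ereal p0..\<infinity>}"
proof -
  have "(\<exists>C. \<forall>n. real (level_count p0 n) * 2 powr (real n * (1 - p)) \<le> C) \<longleftrightarrow> p0 \<le> p" for p :: real
  proof (cases "p0 \<le> p")
    case True
    have "real (level_count p0 n) * 2 powr (real n * (1 - p)) \<le> 2" for n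
    proof -
      have "2 powr (real n * (p0 - p)) \<le> 2 powr (real n * 0)" using True by (intro pow2_mono) auto
      then show ?thesis using level_count_bounds(2)[OF assms, of n p] by simp
    qed
    then show ?thesis using True by blast
  next
    case False
    then have "0 < p0 - p" by simp
    then have "filterlim (\<lambda>n. 2 powr (real n * (p0 - p))) at_top sequentially" by real_asymp
    from not_bounded_of_at_top[OF this level_count_bounds(1)[OF assms]] show ?thesis using False by simp
  qed
  then show ?thesis
    by (intro fan_family_single_level) simp
qed

text \<open>The extra factor \<open>Suc n\<close> destroys the bound at \<open>p0\<close> itself and
  is absorbed by exponential decay for larger exponents.\<close>

lemma fan_family_open:
  assumes "1 \<le> p0"
  shows "fan_family (\<lambda>n. star (\<lambda>i. if i = n then Suc n * level_count p0 n else 0) n) {ereal p0<..\<infinity>} {ereal p0<..\<infinity>} {ereal p0<..\<infinity>}"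
proof -
  have "(\<exists>C. \<forall>n. real (Suc n * level_count p0 n) * 2 powr (real n * (1 - p)) \<le> C) \<longleftrightarrow> p0 < p" for p :: real
  proof (cases "p0 < p")
    case True
    define d where "d = p - p0"
    have "0 < d" using True by (simp add: d_def)
    then have "(\<lambda>n. (real n + 1) * (2 * 2 powr (- (d * real n)))) \<longlonglongrightarrow> 0" by real_asymp
    then have "(\<lambda>n. (real n + 1) * (2 * 2 powr (real n * (p0 - p)))) \<longlonglongrightarrow> 0"
      by (simp add: d_def algebra_simps)
    moreover have "real (Suc n * level_count p0 n) * 2 powr (real n * (1 - p)) \<le> (real n + 1) * (2 * 2 powr (real n * (p0 - p)))" for n
      using mult_left_mono[OF level_count_bounds(2)[OF assms, of n p], of "real n + 1"] by (simp add: algebra_simps)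
    ultimately have "\<exists>C. \<forall>n. real (Suc n * level_count p0 n) * 2 powr (real n * (1 - p)) \<le> C"
      by (rule bounded_of_null)
    then show ?thesis using True by simp
  next
    case False
    have "real n + 1 \<le> real (Suc n * level_count p0 n) * 2 powr (real n * (1 - p))" for n
    proof -
      have "2 powr (real n * 0) \<le> 2 powr (real n * (p0 - p))" using False by (intro pow2_mono) auto
      then have "1 \<le> real (level_count p0 n) * 2 powr (real n * (1 - p))"
        using level_count_bounds(1)[OF assms, of n p] by simp
      from mult_left_mono[OF this, of "real n + 1"] show ?thesis by (simp add: algebra_simps)
    qed
    moreover have "filterlim (\<lambda>n. real n + 1) at_top sequentially" by real_asymp
    ultimately have "\<not> (\<exists>C. \<forall>n. real (Suc n * level_count p0 n) * 2 powr (real n * (1 - p)) \<le> C)"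
      by (intro not_bounded_of_at_top)
    then show ?thesis using False by simp
  qed
  then show ?thesis
    by (intro fan_family_single_level) simp
qed

lemma sum_power_le:
  fixes R :: real
  assumes "2 \<le> R"
  shows "(\<Sum>i\<le>j. R ^ i) \<le> 2 * R ^ j"
proof (induction j)
  case (Suc j)
  have "2 * R ^ j \<le> R * R ^ j" using assms by (intro mult_right_mono) auto
  then show ?case using Suc by simp
qed simp

text \<open>All levels are now present at once. At \<open>p0\<close> each of them adds at least 1 to
  the strong constant, whereas a level set collects masses that grow geometrically and is dominated
  by its top level.\<close>

lemma fan_family_open_strong:
  assumes p0: "1 \<le> p0"
  shows "fan_family (star (level_count p0)) {ereal p0<..\<infinity>} {ereal p0..\<infinity>} {ereal p0..\<infinity>}"
proof -
  have S1: "\<exists>C. \<forall>n. fan_strong (star (level_count p0) n) p C" if "p0 < p" for p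
  proof -
    define r where "r = 2 powr (p0 - p)"
    have r: "0 < r" "r < 1" using that powr_less_mono[of "p0 - p" 0 2] by (auto simp: r_def)
    have "fan_strong (star (level_count p0) n) p (2 * (1 / (1 - r)))" for n
    proof -
      have "(\<Sum>i\<le>n. real (level_count p0 i) * 2 powr (real i * (1 - p))) \<le> (\<Sum>i\<le>n. 2 * r ^ i)"
        using level_count_bounds(2)[OF p0] by (intro sum_mono) (simp add: r_def powr_realpow[symmetric] powr_powr mult.commute)
      also have "\<dots> = 2 * (\<Sum>i\<le>n. r ^ i)" by (simp add: sum_distrib_left)
      also have "(\<Sum>i\<le>n. r ^ i) \<le> (\<Sum>i. r ^ i)"
        using r by (intro sum_le_suminf) (auto simp: summable_geometric)
      also have "\<dots> = 1 / (1 - r)" using r by (intro suminf_geometric) auto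
      finally show ?thesis using that p0 by (subst fan_strong_star) auto
    qed
    then show ?thesis by blast
  qed
  have S2: "\<not> (\<exists>C. \<forall>n. fan_strong (star (level_count p0) n) p C)" if "p \<le> p0" "1 \<le> p" for p
  proof -
    have "real n + 1 \<le> (\<Sum>i\<le>n. real (level_count p0 i) * 2 powr (real i * (1 - p)))" for n
    proof -
      have "(\<Sum>i\<le>n. 2 powr (real i * 0)) \<le> (\<Sum>i\<le>n. real (level_count p0 i) * 2 powr (real i * (1 - p)))"
        using that pow2_mono[of 0 "p0 - p"] level_count_bounds(1)[OF p0, of _ p]
        by (intro sum_mono) (meson diff_ge_0_iff_ge order_trans)
      then show ?thesis by (simp add: add.commute)
    qed
    moreover have "filterlim (\<lambda>n. real n + 1) at_top sequentially" by real_asymp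
    ultimately have "\<not> (\<exists>C. \<forall>n. (\<Sum>i\<le>n. real (level_count p0 i) * 2 powr (real i * (1 - p))) \<le> C)"
      by (intro not_bounded_of_at_top)
    then show ?thesis by (simp add: fan_strong_star[OF that(2)])
  qed
  \<comment> \<open>The constant is 2 from rounding the counts times 2 from a geometric sum with
    ratio \<open>2 powr p0\<close>, which is at least 2.\<close>
  have W0: "fan_weak (star (level_count p0) n) p0 4" for n
    unfolding fan_weak_star fan_restricted_star
  proof (intro allI impI)
    fix s :: real assume s: "0 < s"
    let ?I = "{i. i \<le> n \<and> 2 ^ i < s}" and ?R = "2 powr p0"
    have R: "2 \<le> ?R" using powr_mono[of 1 p0 2] p0 by simp
    show "(\<Sum>i\<in>?I. real (level_count p0 i) * 2 ^ i) \<le> 4 * s powr p0"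
    proof (cases "?I = {}")
      case True
      then show ?thesis by (simp only: sum.empty) simp
    next
      case False
      define j where "j = Max ?I"
      have "finite ?I" by simp
      with False have j: "j \<in> ?I" unfolding j_def by (rule Max_in[rotated])
      have sub: "?I \<subseteq> {..j}" using \<open>finite ?I\<close> unfolding j_def by (auto intro: Max_ge)
      have "(\<Sum>i\<in>?I. real (level_count p0 i) * 2 ^ i) \<le> (\<Sum>i\<in>?I. 2 * ?R ^ i)"
        using level_count_bounds(2)[OF p0, of _ 0] by (intro sum_mono) (simp add: powr_realpow[symmetric] powr_powr mult.commute)
      also have "\<dots> \<le> (\<Sum>i\<le>j. 2 * ?R ^ i)" using sub by (intro sum_mono2) auto
      also have "\<dots> = 2 * (\<Sum>i\<le>j. ?R ^ i)" by (simp add: sum_distrib_left)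
      also have "\<dots> \<le> 4 * ?R ^ j" using sum_power_le[OF R, of j] by simp
      also have "?R ^ j = (2 ^ j) powr p0"
        by (simp add: powr_realpow[symmetric] powr_powr mult.commute)
      also have "\<dots> \<le> s powr p0" using j p0 by (intro powr_mono2) auto
      finally show ?thesis by simp
    qed
  qed
  have R2: "\<not> (\<exists>C. \<forall>n. fan_restricted (star (level_count p0) n) p C)" if "p < p0" "1 \<le> p" for p
  proof
    assume "\<exists>C. \<forall>n. fan_restricted (star (level_count p0) n) p C"
    then obtain C where C: "\<And>n. fan_restricted (star (level_count p0) n) p C" by auto
    have "2 powr (real n * (p0 - p)) \<le> C * 2 powr p" for n
    proof -
      let ?I = "{i. i \<le> n \<and> 2 ^ i < (2::real) ^ Suc n}"
      have "(\<Sum>i\<in>{n}. real (level_count p0 i) * 2 ^ i) \<le> (\<Sum>i\<in>?I. real (level_count p0 i) * 2 ^ i)"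
        by (intro sum_mono2) auto
      also have "\<dots> \<le> C * (2 ^ Suc n) powr p"
        using C[of n, unfolded fan_restricted_star, rule_format, of "2 ^ Suc n"] by (simp del: power_Suc)
      finally have *: "real (level_count p0 n) * 2 ^ n \<le> C * (2 ^ Suc n) powr p" by simp
      have "2 powr (real n * (p0 - p)) \<le> real (level_count p0 n) * 2 powr (real n * (1 - p))"
        by (rule level_count_bounds(1)[OF p0])
      also have "\<dots> = real (level_count p0 n) * 2 ^ n * 2 powr (- (real n * p))"
        by (simp add: powr_realpow[symmetric] powr_add[symmetric] algebra_simps)
      also have "\<dots> \<le> C * (2 ^ Suc n) powr p * 2 powr (- (real n * p))"
        by (rule mult_right_mono[OF *]) auto
      also have "\<dots> = C * 2 powr p"
        by (simp add: powr_realpow[symmetric] powr_powr powr_mult powr_minus field_simps)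
      finally show ?thesis .
    qed
    moreover have "0 < p0 - p" using that by simp
    then have "filterlim (\<lambda>n. 2 powr (real n * (p0 - p))) at_top sequentially" by real_asymp
    ultimately show False using not_bounded_of_at_top[of "\<lambda>n. 2 powr (real n * (p0 - p))" "\<lambda>n. 2 powr (real n * (p0 - p))"]
      by blast
  qed
  have W1: "\<exists>C. \<forall>n. fan_weak (star (level_count p0) n) p C" if "p0 \<le> p" for p
  proof (cases "p = p0")
    case False
    with that S1 obtain C where "\<And>n. fan_strong (star (level_count p0) n) p C" by force
    then show ?thesis using fan_strong_imp_weak[OF fan_graph_star] that p0 by (metis less_le_trans zero_less_one)
  qed (use W0 in blast)
  have "(\<exists>C. \<forall>n. fan_restricted (star (level_count p0) n) p C) \<longleftrightarrow> p0 \<le> p" if "1 \<le> p" for p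
    using W1[of p] R2[of p] that by (force simp: fan_weak_star)
  moreover have "(\<exists>C. \<forall>n. fan_strong (star (level_count p0) n) p C) \<longleftrightarrow> p0 < p" if "1 \<le> p" for p
    using S1[of p] S2[of p] that by force
  ultimately show ?thesis
    unfolding fan_family_def fan_weak_star by (auto intro: exI[of _ 1] fan_graph_star)
qed

section \<open>Trees\<close>

text \<open>A target is a number below \<open>2 ^ n\<^sup>2\<close>, and its residues modulo
  \<open>2 ^ j\<close> describe a path in the binary tree, read from the lowest bit. Only the last
  \<open>n\<close> bits matter for the links; the others create multiplicity.\<close>

definition tree :: "real \<Rightarrow> nat \<Rightarrow> (nat \<times> nat, nat \<times> nat) bigraph" where
  "tree q n = \<lparr>base = (SIGMA j:{..n}. {..<2 ^ j}), targets = {0} \<times> {..<2 ^ n\<^sup>2},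
     link = (\<lambda>u. (\<lambda>j. (j, snd u mod 2 ^ j)) ` {..n}), bwt = (\<lambda>b. q ^ fst b), twt = (\<lambda>_. q ^ n\<^sup>2)\<rparr>"

lemma sum_mod:
  fixes g :: "nat \<Rightarrow> real"
  shows "(\<Sum>r<M * d. g (r mod d)) = real M * (\<Sum>k<d. g k)"
proof -
  have *: "(\<Sum>k<d. g k) = (\<Sum>r\<in>{m * d..<m * d + d}. g (r mod d))" for m
    by (rule sum.reindex_bij_witness[of _ "\<lambda>r. r - m * d" "\<lambda>k. m * d + k"]) auto
  have "(\<Sum>m<M. \<Sum>r\<in>{m * d..<m * d + d}. g (r mod d)) = real M * (\<Sum>k<d. g k)"
    unfolding *[symmetric] by simp
  then show ?thesis by (simp only: sum.nat_group)
qed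

lemma sum_link_tree: "(\<Sum>b\<in>link (tree q n) u. g b) = (\<Sum>j\<le>n. g (j, snd u mod 2 ^ j))"
  unfolding tree_def by (simp, subst sum.reindex) (auto simp: inj_on_def)

lemma fan_avg_tree:
  "fan_avg (tree q n) f u = (\<Sum>j\<le>n. q ^ j * f (j, snd u mod 2 ^ j)) / q ^ n\<^sup>2"
  unfolding fan_avg_def sum_link_tree by (simp add: tree_def)

text \<open>Double counting: a base point on level \<open>j\<close> is linked to the share
  \<open>1 / 2 ^ j\<close> of the targets, exactly because \<open>2 ^ j\<close> divides their number
  when \<open>j \<le> n\<close>.\<close>

lemma sum_targets_tree:
  fixes \<phi> :: "nat \<times> nat \<Rightarrow> real"
  shows "(\<Sum>u\<in>targets (tree q n). \<Sum>j\<le>n. \<phi> (j, snd u mod 2 ^ j))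
    = 2 ^ n\<^sup>2 * (\<Sum>b\<in>base (tree q n). \<phi> b / 2 ^ fst b)"
proof -
  have "(\<Sum>r<2 ^ n\<^sup>2. \<phi> (j, r mod 2 ^ j)) = 2 ^ n\<^sup>2 * (\<Sum>k<2 ^ j. \<phi> (j, k) / 2 ^ j)" if "j \<le> n" for j
  proof -
    have "j \<le> n\<^sup>2" using that by (metis le_square order_trans power2_eq_square)
    then have "(2::nat) ^ n\<^sup>2 = 2 ^ (n\<^sup>2 - j) * 2 ^ j" "(2::real) ^ n\<^sup>2 / 2 ^ j = 2 ^ (n\<^sup>2 - j)"
      by (metis le_add_diff_inverse2 power_add) (use \<open>j \<le> n\<^sup>2\<close> in \<open>simp add: power_diff\<close>)
    moreover have "2 ^ n\<^sup>2 * (\<Sum>k<2 ^ j. \<phi> (j, k) / 2 ^ j) = 2 ^ n\<^sup>2 / 2 ^ j * (\<Sum>k<2 ^ j. \<phi> (j, k))"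
      by (simp add: sum_divide_distrib[symmetric])
    ultimately show ?thesis
      using sum_mod[where g = "\<lambda>k. \<phi> (j, k)" and M = "2 ^ (n\<^sup>2 - j)" and d = "2 ^ j"] by simp
  qed
  then have "(\<Sum>j\<le>n. \<Sum>r<2 ^ n\<^sup>2. \<phi> (j, r mod 2 ^ j)) = (\<Sum>j\<le>n. 2 ^ n\<^sup>2 * (\<Sum>k<2 ^ j. \<phi> (j, k) / 2 ^ j))"
    by simp
  also have "\<dots> = 2 ^ n\<^sup>2 * (\<Sum>b\<in>base (tree q n). \<phi> b / 2 ^ fst b)"
    by (simp add: tree_def sum.Sigma sum_distrib_left case_prod_unfold)
  finally have *: "(\<Sum>j\<le>n. \<Sum>r<2 ^ n\<^sup>2. \<phi> (j, r mod 2 ^ j)) = 2 ^ n\<^sup>2 * (\<Sum>b\<in>base (tree q n). \<phi> b / 2 ^ fst b)" .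
  have "(\<Sum>u\<in>targets (tree q n). \<Sum>j\<le>n. \<phi> (j, snd u mod 2 ^ j)) = (\<Sum>r<2 ^ n\<^sup>2. \<Sum>j\<le>n. \<phi> (j, r mod 2 ^ j))"
    by (rule sum.reindex_bij_witness[of _ "\<lambda>r. (0, r)" snd]) (auto simp: tree_def)
  then show ?thesis using * by (simp add: sum.swap[of _ "{..n}"])
qed

text \<open>Each term is bounded by the largest. The lost power of the number of terms is polynomial
  in \<open>n\<close> below, hence affordable away from the critical exponent.\<close>

lemma sum_powr_le:
  fixes x :: "'a \<Rightarrow> real"
  assumes "finite J" "\<And>j. j \<in> J \<Longrightarrow> 0 \<le> x j" "0 < p"
  shows "(\<Sum>j\<in>J. x j) powr p \<le> real (card J) powr p * (\<Sum>j\<in>J. x j powr p)"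
proof (cases "J = {}")
  case False
  define M where "M = Max (x ` J)"
  have M: "\<And>j. j \<in> J \<Longrightarrow> x j \<le> M" using assms(1) by (auto simp: M_def)
  have "M \<in> x ` J" using assms(1) False unfolding M_def by (intro Max_in) auto
  then obtain i where i: "i \<in> J" "M = x i" by auto
  have "(\<Sum>j\<in>J. x j) \<le> real (card J) * M" using sum_bounded_above[of J x M] M by auto
  then have "(\<Sum>j\<in>J. x j) powr p \<le> (real (card J) * M) powr p"
    using assms by (intro powr_mono2) (auto intro: sum_nonneg)
  also have "\<dots> = real (card J) powr p * x i powr p"
    using i assms(2) by (simp add: powr_mult)
  also have "x i powr p \<le> (\<Sum>j\<in>J. x j powr p)"
    using i assms(1) by (intro member_le_sum) auto
  finally show ?thesis by (simp add: mult_left_mono)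
qed (use assms in auto)

lemma geometric_sum_le:
  fixes q :: real
  assumes "1 < q" "J \<subseteq> {..n}"
  shows "(\<Sum>j\<in>J. q ^ j) \<le> q / (q - 1) * q ^ n"
proof -
  have "(\<Sum>j\<in>J. q ^ j) \<le> (\<Sum>j\<le>n. q ^ j)"
    using assms by (intro sum_mono2) auto
  also have "\<dots> = (q ^ Suc n - 1) / (q - 1)"
    using assms by (subst lessThan_Suc_atMost[symmetric], subst geometric_sum) auto
  also have "\<dots> \<le> q / (q - 1) * q ^ n"
    using assms by (simp add: divide_right_mono)
  finally show ?thesis .
qed

text \<open>The sum is comparable to its largest term, so nothing is lost in the number of terms.\<close>

lemma geometric_sum_powr_le:
  fixes q :: real
  assumes "1 < q" "finite J" "0 < p"
  shows "(\<Sum>j\<in>J. q ^ j) powr p \<le> (q / (q - 1)) powr p * (\<Sum>j\<in>J. (q ^ j) powr p)"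
proof (cases "J = {}")
  case False
  define i where "i = Max J"
  have i: "i \<in> J" "J \<subseteq> {..i}" using assms False by (auto simp: i_def)
  have "(\<Sum>j\<in>J. q ^ j) powr p \<le> (q / (q - 1) * q ^ i) powr p"
    using assms geometric_sum_le[OF assms(1) i(2)] by (intro powr_mono2) (auto intro: sum_nonneg)
  also have "\<dots> = (q / (q - 1)) powr p * (q ^ i) powr p"
    using assms by (subst powr_mult) auto
  also have "\<dots> \<le> (q / (q - 1)) powr p * (\<Sum>j\<in>J. (q ^ j) powr p)"
    using i assms by (intro mult_left_mono member_le_sum) auto
  finally show ?thesis .
qed (use assms in auto)

text \<open>The choice of \<open>q\<close> gives \<open>N * m powr (1 - p0) = 1\<close> for the \<open>N = 2 ^ n\<^sup>2\<close> targets of mass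
  \<open>m = q ^ n\<^sup>2\<close>. Because of the square, \<open>N * m powr (1 - p)\<close> with \<open>p \<noteq> p0\<close> outweighs the
  contributions of the base, whose masses are at most \<open>q ^ n\<close>.\<close>

locale tree_family =
  fixes p0 q :: real
  assumes p0: "1 < p0" and q: "1 < q" and q_powr: "q powr (p0 - 1) = 2"
begin

lemma mass_powr: "2 ^ n\<^sup>2 * (q ^ n\<^sup>2 * (1 / q ^ n\<^sup>2) powr p) = q powr (real (n\<^sup>2) * (p0 - p))"
proof -
  have "(2::real) ^ n\<^sup>2 = q powr (real (n\<^sup>2) * (p0 - 1))"
    using q_powr by (simp flip: powr_realpow add: powr_powr[symmetric] mult.commute[of "real (n\<^sup>2)"] del: of_nat_power)
  then show ?thesis
    using q by (simp flip: powr_realpow powr_add add: powr_divide powr_powr powr_minus_divide[symmetric]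
        algebra_simps del: of_nat_power)
qed

text \<open>The left side is the weight with which a base point on level \<open>j\<close> enters
  after double counting. At \<open>p = p0\<close> it equals the mass \<open>q ^ j\<close>, so no
  level is preferred.\<close>

lemma level_powr: "(q ^ j) powr p / 2 ^ j = q ^ j * q powr (real j * (p - p0))"
proof -
  have "(2::real) ^ j = q powr (real j * (p0 - 1))"
    using q_powr by (simp flip: powr_realpow add: powr_powr[symmetric] mult.commute[of "real j"])
  then show ?thesis
    using q by (simp flip: powr_realpow powr_add powr_diff add: powr_powr algebra_simps)
qed

lemma fan_graph_tree: "fan_graph (q / (q - 1)) (tree q n)"
proof -
  have "sum (bwt (tree q n)) (link (tree q n) u) \<le> q / (q - 1) * q ^ n\<^sup>2" for u
  proof -
    have "sum (bwt (tree q n)) (link (tree q n) u) = (\<Sum>j\<le>n. q ^ j)"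
      by (simp only: sum_link_tree) (simp add: tree_def)
    also have "\<dots> \<le> q / (q - 1) * q ^ n" using geometric_sum_le[OF q] by blast
    also have "\<dots> \<le> q / (q - 1) * q ^ n\<^sup>2"
      using q by (intro mult_left_mono power_increasing) (auto simp: power2_eq_square)
    finally show ?thesis .
  qed
  moreover have "base (tree q n) \<noteq> {}" using lessThan_iff by (fastforce simp: tree_def)
  ultimately show ?thesis using q by (auto simp: fan_graph_def tree_def)
qed

text \<open>For an indicator the average is a sum of \<open>q ^ j\<close> over some levels, so its
  power \<open>p0\<close> may be taken termwise with a constant independent of \<open>n\<close>.
  Double counting then returns exactly the mass of \<open>E\<close>, by \<open>mass_powr\<close> and
  \<open>level_powr\<close> at the critical exponent.\<close>

lemma tree_restricted: "fan_restricted (tree q n) p0 ((q / (q - 1)) powr p0)"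
  unfolding fan_restricted_def
proof (intro allI impI)
  fix E :: "(nat \<times> nat) set" and t :: real
  assume E: "E \<subseteq> base (tree q n)" and t: "0 < t"
  define c where "c = (q / (q - 1)) powr p0"
  define m where "m = q ^ n\<^sup>2"
  define \<phi> where "\<phi> = (\<lambda>b. indicator E b * (q ^ fst b) powr p0)"
  have m: "0 < m" and c: "0 \<le> c" using q by (auto simp: m_def c_def)
  let ?S = "{u \<in> targets (tree q n). t < fan_avg (tree q n) (indicator E) u}"
  have fin: "finite (targets (tree q n))" "finite (base (tree q n))" by (auto simp: tree_def)
  have F: "fan_avg (tree q n) (indicator E) u powr p0 \<le> (1 / m) powr p0 * (c * (\<Sum>j\<le>n. \<phi> (j, snd u mod 2 ^ j)))" for u
  proof -
    let ?J = "{j. j \<le> n \<and> (j, snd u mod 2 ^ j) \<in> E}"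
    have "(\<Sum>j\<le>n. q ^ j * indicator E (j, snd u mod 2 ^ j)) = (\<Sum>j\<in>?J. q ^ j)"
      by (rule sum.mono_neutral_cong_right) (auto simp: indicator_def)
    moreover have "(\<Sum>j\<le>n. \<phi> (j, snd u mod 2 ^ j)) = (\<Sum>j\<in>?J. (q ^ j) powr p0)"
      unfolding \<phi>_def by (rule sum.mono_neutral_cong_right) (auto simp: indicator_def)
    moreover have "(\<Sum>j\<in>?J. q ^ j) powr p0 \<le> c * (\<Sum>j\<in>?J. (q ^ j) powr p0)"
      using geometric_sum_powr_le[OF q, of ?J p0] p0 by (auto simp: c_def)
    ultimately show ?thesis
      using q m by (simp add: fan_avg_tree powr_divide sum_nonneg divide_right_mono flip: m_def)
  qed
  have "t powr p0 * (\<Sum>u\<in>?S. twt (tree q n) u) = (\<Sum>u\<in>?S. m * t powr p0)"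
    by (simp add: tree_def m_def)
  also have "\<dots> \<le> (\<Sum>u\<in>?S. m * fan_avg (tree q n) (indicator E) u powr p0)"
    using t p0 q by (intro sum_mono mult_left_mono powr_mono2) (auto simp: m_def)
  also have "\<dots> \<le> (\<Sum>u\<in>targets (tree q n). m * fan_avg (tree q n) (indicator E) u powr p0)"
    using fin m by (intro sum_mono2) auto
  also have "\<dots> \<le> (\<Sum>u\<in>targets (tree q n). m * ((1 / m) powr p0 * (c * (\<Sum>j\<le>n. \<phi> (j, snd u mod 2 ^ j)))))"
    using F m by (intro sum_mono mult_left_mono) auto
  also have "\<dots> = m * (1 / m) powr p0 * c * (\<Sum>u\<in>targets (tree q n). \<Sum>j\<le>n. \<phi> (j, snd u mod 2 ^ j))"
    by (simp only: sum_distrib_left mult.assoc)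
  also have "\<dots> = (2 ^ n\<^sup>2 * (m * (1 / m) powr p0)) * (c * (\<Sum>b\<in>base (tree q n). \<phi> b / 2 ^ fst b))"
    unfolding sum_targets_tree by (simp only: ac_simps)
  also have "\<dots> = c * (\<Sum>b\<in>base (tree q n). \<phi> b / 2 ^ fst b)"
    unfolding m_def mass_powr using q by simp
  also have "(\<Sum>b\<in>base (tree q n). \<phi> b / 2 ^ fst b) = sum (bwt (tree q n)) E"
    using fin E level_powr[of _ p0] q by (intro sum.mono_neutral_cong_right) (auto simp: indicator_def tree_def \<phi>_def)
  finally show "t powr p0 * sum (twt (tree q n)) ?S \<le> (q / (q - 1)) powr p0 * sum (bwt (tree q n)) E"
    by (simp only: c_def)
qed

text \<open>A general \<open>f\<close> can balance the levels, so the power is taken termwise with a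
  polynomial loss. The targets gain \<open>q\<close> to a power quadratic in \<open>n\<close>, while
  the levels lose only a power linear in \<open>n\<close>.\<close>

lemma tree_strong:
  assumes "p0 < p"
  shows "fan_strong (tree q n) p ((real n + 1) powr p * (q powr (real (n\<^sup>2) * (p0 - p)) * q powr (real n * (p - p0))))"
  unfolding fan_strong_def
proof (intro allI impI)
  fix f :: "nat \<times> nat \<Rightarrow> real"
  assume f: "\<forall>b. 0 \<le> f b"
  define c where "c = (real n + 1) powr p"
  define m where "m = q ^ n\<^sup>2"
  define \<phi> where "\<phi> = (\<lambda>b. (q ^ fst b * f b) powr p)"
  have m: "0 < m" and c: "0 \<le> c" using q by (auto simp: m_def c_def)
  have "fan_avg (tree q n) f u powr p \<le> (1 / m) powr p * (c * (\<Sum>j\<le>n. \<phi> (j, snd u mod 2 ^ j)))" for u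
  proof -
    have "(\<Sum>j\<le>n. q ^ j * f (j, snd u mod 2 ^ j)) powr p \<le> c * (\<Sum>j\<le>n. \<phi> (j, snd u mod 2 ^ j))"
      using sum_powr_le[of "{..n}" "\<lambda>j. q ^ j * f (j, snd u mod 2 ^ j)" p] f q p0 assms by (simp add: add.commute c_def \<phi>_def)
    then show ?thesis
      using q f m by (simp add: fan_avg_tree powr_divide sum_nonneg divide_right_mono flip: m_def)
  qed
  then have "(\<Sum>u\<in>targets (tree q n). twt (tree q n) u * fan_avg (tree q n) f u powr p)
      \<le> (\<Sum>u\<in>targets (tree q n). m * ((1 / m) powr p * (c * (\<Sum>j\<le>n. \<phi> (j, snd u mod 2 ^ j)))))"
    using m by (intro sum_mono mult_mono) (auto simp: tree_def m_def)
  also have "\<dots> = m * (1 / m) powr p * c * (\<Sum>u\<in>targets (tree q n). \<Sum>j\<le>n. \<phi> (j, snd u mod 2 ^ j))"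
    by (simp only: sum_distrib_left mult.assoc)
  also have "\<dots> = (2 ^ n\<^sup>2 * (m * (1 / m) powr p)) * (c * (\<Sum>b\<in>base (tree q n). \<phi> b / 2 ^ fst b))"
    unfolding sum_targets_tree by (simp only: ac_simps)
  also have "\<dots> \<le> q powr (real (n\<^sup>2) * (p0 - p)) * (c * (\<Sum>b\<in>base (tree q n). q powr (real n * (p - p0)) * (bwt (tree q n) b * f b powr p)))"
    unfolding m_def mass_powr
  proof (intro mult_left_mono sum_mono)
    fix b assume "b \<in> base (tree q n)"
    then have "fst b \<le> n" by (auto simp: tree_def)
    then have le: "q powr (real (fst b) * (p - p0)) \<le> q powr (real n * (p - p0))"
      using q assms by (simp add: mult_right_mono)
    have "\<phi> b / 2 ^ fst b = ((q ^ fst b) powr p / 2 ^ fst b) * f b powr p"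
      using q f by (simp add: powr_mult \<phi>_def)
    also have "\<dots> = q powr (real (fst b) * (p - p0)) * (q ^ fst b * f b powr p)"
      unfolding level_powr by simp
    also have "\<dots> \<le> q powr (real n * (p - p0)) * (q ^ fst b * f b powr p)"
      using le q by (intro mult_right_mono) auto
    finally show "\<phi> b / 2 ^ fst b \<le> q powr (real n * (p - p0)) * (bwt (tree q n) b * f b powr p)"
      by (simp add: tree_def)
  qed (use c in auto)
  also have "\<dots> = c * (q powr (real (n\<^sup>2) * (p0 - p)) * q powr (real n * (p - p0))) * (\<Sum>b\<in>base (tree q n). bwt (tree q n) b * f b powr p)"
    by (simp only: sum_distrib_left[symmetric]) (simp only: ac_simps)
  finally show "(\<Sum>u\<in>targets (tree q n). twt (tree q n) u * fan_avg (tree q n) f u powr p)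
      \<le> (real n + 1) powr p * (q powr (real (n\<^sup>2) * (p0 - p)) * q powr (real n * (p - p0))) * (\<Sum>b\<in>base (tree q n). bwt (tree q n) b * f b powr p)"
    by (simp only: c_def)
qed

text \<open>The function \<open>1 / q ^ j\<close> makes every level contribute 1 to each average and
  1 to the norm. The inequality thus compares \<open>(n + 1) powr p0\<close> with
  \<open>n + 1\<close>, which fails for large \<open>n\<close> as \<open>p0 > 1\<close>.\<close>

lemma tree_weak_lower:
  assumes "fan_weak (tree q n) p0 C"
  shows "(real n + 1) powr (p0 - 1) \<le> C * 2 powr p0"
proof -
  let ?m = "q ^ n\<^sup>2" and ?f = "\<lambda>b. 1 / q ^ fst b"
  \<comment> \<open>Half of the common value of the averages, so that every target passes the strict
    inequality; this produces the factor \<open>2 powr p0\<close>.\<close>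
  define t where "t = (real n + 1) / 2 * (1 / ?m)"
  have t: "0 < t" using q by (simp add: t_def)
  have avg: "fan_avg (tree q n) ?f u = (real n + 1) / ?m" for u
    using q by (simp add: fan_avg_tree add.commute)
  define a where "a = (real n + 1) / ?m"
  have "0 < a" "t = a / 2" using q by (auto simp: a_def t_def)
  then have "t < (real n + 1) / ?m" by (simp flip: a_def)
  then have "{u. u \<in> targets (tree q n) \<and> t < fan_avg (tree q n) ?f u} = targets (tree q n)"
    by (auto simp: avg)
  then have sel: "(\<Sum>u | u \<in> targets (tree q n) \<and> t < fan_avg (tree q n) ?f u. twt (tree q n) u) = 2 ^ n\<^sup>2 * ?m"
    by (simp add: tree_def)
  have "(\<Sum>b\<in>base (tree q n). bwt (tree q n) b * ?f b powr p0) = (\<Sum>j\<le>n. \<Sum>k<(2::nat) ^ j. q ^ j * (1 / q ^ j) powr p0)"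
    by (simp add: tree_def sum.Sigma case_prod_unfold del: sum_constant)
  also have "\<dots> = (\<Sum>j\<le>n. 1)"
  proof (rule sum.cong)
    fix j assume "j \<in> {..n}"
    have "(q ^ j) powr p0 = q ^ j * 2 ^ j"
      using level_powr[of j p0] q by (simp add: field_simps)
    then show "(\<Sum>k<(2::nat) ^ j. q ^ j * (1 / q ^ j) powr p0) = 1"
      using q by (simp add: powr_divide)
  qed simp
  finally have rhs: "(\<Sum>b\<in>base (tree q n). bwt (tree q n) b * ?f b powr p0) = real n + 1" by simp
  have "t powr p0 * (2 ^ n\<^sup>2 * ?m) \<le> C * (real n + 1)"
    using assms[unfolded fan_weak_def, rule_format, of ?f t] t q unfolding sel rhs by simp
  moreover have "t powr p0 * (2 ^ n\<^sup>2 * ?m) = ((real n + 1) / 2) powr p0 * (2 ^ n\<^sup>2 * (?m * (1 / ?m) powr p0))"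
    unfolding t_def using q by (subst powr_mult) (auto simp: ac_simps)
  ultimately have "((real n + 1) / 2) powr p0 \<le> C * (real n + 1)"
    unfolding mass_powr using q by simp
  then have "(real n + 1) powr p0 / (real n + 1) \<le> C * 2 powr p0"
    by (simp add: powr_divide field_simps)
  then show ?thesis by (simp add: powr_diff)
qed

text \<open>The root alone is a test set: it has mass 1 and is linked to every target.\<close>

lemma tree_restricted_lower:
  assumes "fan_restricted (tree q n) p C"
  shows "q powr (real (n\<^sup>2) * (p0 - p)) \<le> C * 2 powr p"
proof -
  let ?m = "q ^ n\<^sup>2" and ?E = "{(0, 0)} :: (nat \<times> nat) set"
  define t where "t = 1 / 2 * (1 / ?m)"
  have t: "0 < t" using q by (simp add: t_def)
  have avg: "1 / ?m \<le> fan_avg (tree q n) (indicator ?E) u" for u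
  proof -
    have "(\<Sum>j\<in>{0}. q ^ j * indicator ?E (j, snd u mod 2 ^ j)) \<le> (\<Sum>j\<le>n. q ^ j * indicator ?E (j, snd u mod 2 ^ j))"
      using q by (intro sum_mono2) auto
    then show ?thesis using q by (simp add: fan_avg_tree divide_right_mono)
  qed
  have "t < 1 / ?m" using q by (simp add: t_def field_simps)
  then have "{u. u \<in> targets (tree q n) \<and> t < fan_avg (tree q n) (indicator ?E) u} = targets (tree q n)"
    using avg less_le_trans by blast
  then have sel: "(\<Sum>u | u \<in> targets (tree q n) \<and> t < fan_avg (tree q n) (indicator ?E) u. twt (tree q n) u) = 2 ^ n\<^sup>2 * ?m"
    by (simp add: tree_def)
  have "?E \<subseteq> base (tree q n)" by (auto simp: tree_def)
  then have "t powr p * (2 ^ n\<^sup>2 * ?m) \<le> C"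
    using assms[unfolded fan_restricted_def, rule_format, of ?E t] t unfolding sel by (simp add: tree_def)
  moreover have "t powr p * (2 ^ n\<^sup>2 * ?m) = (1 / 2) powr p * (2 ^ n\<^sup>2 * (?m * (1 / ?m) powr p))"
    unfolding t_def using q by (subst powr_mult) (auto simp: ac_simps)
  ultimately have "(1 / 2) powr p * q powr (real (n\<^sup>2) * (p0 - p)) \<le> C"
    unfolding mass_powr by linarith
  moreover have "0 < (2::real) powr p" by simp
  ultimately show ?thesis
    by (simp only: powr_divide powr_one_eq_one) (simp only: times_divide_eq_left mult_1 pos_divide_le_eq)
qed

text \<open>The strong bound above \<open>p0\<close> and the restricted bound at \<open>p0\<close>
  give the positive answers. Failure of restricted type below \<open>p0\<close> and of weak type at
  \<open>p0\<close> passes on to the stronger types.\<close>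

lemma fan_family_tree: "fan_family (tree q) {ereal p0<..\<infinity>} {ereal p0<..\<infinity>} {ereal p0..\<infinity>}"
proof -
  have S1: "\<exists>C. \<forall>n. fan_strong (tree q n) p C" if "p0 < p" for p
  proof -
    let ?C = "\<lambda>n. (real n + 1) powr p * (q powr (real (n\<^sup>2) * (p0 - p)) * q powr (real n * (p - p0)))"
    \<comment> \<open>The constant becomes
      \<open>(n + 1) powr p * exp (L * (n - n\<^sup>2))\<close>, which tends to 0 and is therefore
      bounded.\<close>
    define L where "L = ln q * (p - p0)"
    have "0 < L" using q that by (simp add: L_def)
    then have lim: "(\<lambda>n. (real n + 1) powr p * exp (L * (real n - (real n)\<^sup>2))) \<longlonglongrightarrow> 0" by real_asymp
    have "?C n = (real n + 1) powr p * exp (L * (real n - (real n)\<^sup>2))" for n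
      using q by (simp add: powr_def exp_add[symmetric] L_def algebra_simps)
    then obtain C where "\<And>n. ?C n \<le> C"
      using bounded_of_null[OF lim, of ?C] by auto
    moreover have "0 \<le> (\<Sum>b\<in>base (tree q n). bwt (tree q n) b * f b powr p)" for n f
      using q by (intro sum_nonneg) (auto simp: tree_def)
    ultimately have "fan_strong (tree q n) p C" for n
      using tree_strong[OF that, of n] unfolding fan_strong_def
      by (meson mult_right_mono order_trans)
    then show ?thesis by blast
  qed
  have imp: "\<exists>C. \<forall>n. fan_weak (tree q n) p C" if "\<exists>C. \<forall>n. fan_strong (tree q n) p C" "1 \<le> p" for p
    using that fan_strong_imp_weak[OF fan_graph_tree] by (metis less_le_trans zero_less_one)
  have imp': "\<exists>C. \<forall>n. fan_restricted (tree q n) p C" if "\<exists>C. \<forall>n. fan_weak (tree q n) p C" "1 \<le> p" for p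
    using that fan_weak_imp_restricted[OF fan_graph_tree] by (metis less_le_trans zero_less_one)
  have R: "\<not> (\<exists>C. \<forall>n. fan_restricted (tree q n) p C)" if "p < p0" for p
  proof
    assume "\<exists>C. \<forall>n. fan_restricted (tree q n) p C"
    then obtain C where "\<And>n. fan_restricted (tree q n) p C" by auto
    from tree_restricted_lower[OF this] have le: "\<And>n. q powr (real (n\<^sup>2) * (p0 - p)) \<le> C * 2 powr p" .
    define L where "L = ln q * (p0 - p)"
    have "0 < L" using q that by (simp add: L_def)
    then have "filterlim (\<lambda>n. exp (L * (real n)\<^sup>2)) at_top sequentially" by real_asymp
    moreover have "exp (L * (real n)\<^sup>2) \<le> q powr (real (n\<^sup>2) * (p0 - p))" for n
      using q by (simp add: powr_def L_def ac_simps)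
    ultimately have "\<not> (\<exists>C. \<forall>n. q powr (real (n\<^sup>2) * (p0 - p)) \<le> C)" by (rule not_bounded_of_at_top)
    with le show False by blast
  qed
  have W: "\<not> (\<exists>C. \<forall>n. fan_weak (tree q n) p0 C)"
  proof
    assume "\<exists>C. \<forall>n. fan_weak (tree q n) p0 C"
    then obtain C where "\<And>n. fan_weak (tree q n) p0 C" by auto
    from tree_weak_lower[OF this] have le: "\<And>n. (real n + 1) powr (p0 - 1) \<le> C * 2 powr p0" .
    define d where "d = p0 - 1"
    have "0 < d" using p0 by (simp add: d_def)
    then have "filterlim (\<lambda>n. (real n + 1) powr d) at_top sequentially" by real_asymp
    from not_bounded_of_at_top[OF this, of "\<lambda>n. (real n + 1) powr (p0 - 1)"] le show False
      unfolding d_def by blast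
  qed
  have R0: "\<exists>C. \<forall>n. fan_restricted (tree q n) p0 C" using tree_restricted by blast
  show ?thesis
    unfolding fan_family_def
  proof (intro conjI allI impI)
    fix p :: real assume p: "1 \<le> p"
    have W_iff: "(\<exists>C. \<forall>n. fan_weak (tree q n) p C) \<longleftrightarrow> p0 < p"
      using imp[OF S1 p] imp'[OF _ p] R[of p] W by (cases p p0 rule: linorder_cases) blast+
    show "(\<exists>C. \<forall>n. fan_strong (tree q n) p C) \<longleftrightarrow> ereal p \<in> {ereal p0<..\<infinity>}"
      using W_iff S1 imp[OF _ p] by auto
    show "(\<exists>C. \<forall>n. fan_weak (tree q n) p C) \<longleftrightarrow> ereal p \<in> {ereal p0<..\<infinity>}"
      using W_iff by simp
    have "(\<exists>C. \<forall>n. fan_restricted (tree q n) p C) \<longleftrightarrow> p0 \<le> p"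
    proof (cases p p0 rule: linorder_cases)
      case less then show ?thesis using R by simp
    next
      case equal then show ?thesis using R0 by simp
    next
      case greater then show ?thesis using imp'[OF _ p] W_iff by simp
    qed
    then show "(\<exists>C. \<forall>n. fan_restricted (tree q n) p C) \<longleftrightarrow> ereal p \<in> {ereal p0..\<infinity>}"
      by simp
  qed (use fan_graph_tree in blast)
qed

end

text \<open>The equation \<open>q powr (p0 - 1) = 2\<close> has a solution only for
  \<open>p0 > 1\<close>; hence the endpoint 1 is excluded.\<close>

lemma fan_family_open_weak:
  assumes "1 < p0"
  shows "\<exists>G :: nat \<Rightarrow> (nat \<times> nat, nat \<times> nat) bigraph. fan_family G {ereal p0<..\<infinity>} {ereal p0<..\<infinity>} {ereal p0..\<infinity>}"
proof -
  define q where "q = 2 powr (1 / (p0 - 1))"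
  have "1 < q" using assms by (simp add: q_def)
  moreover have "q powr (p0 - 1) = 2" using assms by (simp add: q_def powr_powr)
  ultimately interpret tree_family p0 q by unfold_locales (use assms in auto)
  show ?thesis using fan_family_tree by blast
qed

section \<open>Choice of a family for a given triple of exponent sets\<close>

lemma closure_greaterThanAtMost_ereal:
  "closure {ereal p0<..\<infinity>} \<subseteq> {ereal p0..\<infinity>}"
  by (rule closure_minimal) auto

text \<open>Taking the closure of \<open>S\<close> adds at most its left endpoint, so
  \<open>W\<close> and \<open>R\<close> are determined up to whether they contain it. The chain of
  inclusions leaves three combinations when \<open>S\<close> is open on the left and one
  otherwise.\<close>

lemma fan_family_exists:
  assumes S: "exp_set S" and W: "exp_set W" and R: "exp_set R"
    and sub: "S \<subseteq> W" "W \<subseteq> R" "R \<subseteq> closure S" and one: "R = {1..\<infinity>} \<Longrightarrow> W = {1..\<infinity>}"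
  shows "\<exists>G :: nat \<Rightarrow> (nat \<times> nat, nat \<times> nat) bigraph. fan_family G S W R"
proof -
  have between: "T = {ereal p0<..\<infinity>} \<or> T = {ereal p0..\<infinity>}"
    if "{ereal p0<..\<infinity>} \<subseteq> T" "T \<subseteq> {ereal p0..\<infinity>}" for T p0
  proof (cases "ereal p0 \<in> T")
    case True
    then have "{ereal p0..\<infinity>} \<subseteq> T" using that(1) by (auto simp: le_less)
    then show ?thesis using that(2) by auto
  next
    case False
    then have "T \<subseteq> {ereal p0<..\<infinity>}" using that(2) by (auto simp: le_less)
    then show ?thesis using that(1) by auto
  qed
  from S consider "S = {\<infinity>}" | p0 where "1 \<le> p0" "S = {ereal p0..\<infinity>}" | p0 where "1 \<le> p0" "S = {ereal p0<..\<infinity>}"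
    unfolding exp_set_def by blast
  then show ?thesis
  proof cases
    case 1
    then have "W = {\<infinity>}" "R = {\<infinity>}" using sub by auto
    then show ?thesis using 1 fan_family_infinity by blast
  next
    case 2
    then have "W = S" "R = S" using sub by auto
    then show ?thesis using 2 fan_family_closed by blast
  next
    case 3
    have "W = {ereal p0<..\<infinity>} \<or> W = {ereal p0..\<infinity>}" "R = {ereal p0<..\<infinity>} \<or> R = {ereal p0..\<infinity>}"
      using sub 3 closure_greaterThanAtMost_ereal[of p0] by (intro between; blast)+
    then consider "W = S" "R = S" | "W = S" "R = {ereal p0..\<infinity>}" | "W = {ereal p0..\<infinity>}" "R = {ereal p0..\<infinity>}"
      using 3 sub by blast
    then show ?thesis
    proof cases
      case 1
      then show ?thesis using 3 fan_family_open by blast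
    next
      case 2
      \<comment> \<open>Here condition (iii) enters: it forbids a restricted weak type set
        containing 1 next to a weak type set without it.\<close>
      have "p0 \<noteq> 1"
      proof
        assume "p0 = 1"
        with 2 one 3 have "{1<..\<infinity>} = {1::ereal..\<infinity>}" by (simp add: one_ereal_def)
        then have "(1::ereal) \<in> {1<..\<infinity>}" by simp
        then show False by simp
      qed
      then show ?thesis using 2 3 fan_family_open_weak[of p0] by simp
    next
      case 3
      then show ?thesis using \<open>1 \<le> p0\<close> \<open>S = {ereal p0<..\<infinity>}\<close> fan_family_open_strong by blast
    qed
  qed
qed

section \<open>Averages and powers in the extended nonnegative reals\<close>

lemma epow_ennreal [simp]: "0 \<le> r \<Longrightarrow> epow (ennreal r) p = ennreal (r powr p)"
  by (simp add: epow_def)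

lemma epow_top [simp]: "epow top p = top"
  by (simp add: epow_def)

lemma epow_mono: "a \<le> b \<Longrightarrow> 0 \<le> p \<Longrightarrow> epow a p \<le> epow b p"
  by (cases a; cases b) (auto intro!: powr_mono2 ennreal_leI simp: top_unique)

lemma epow_epow: "epow (epow a p) q = epow a (p * q)"
  by (cases a) (auto simp: powr_powr)

lemma epow_1 [simp]: "epow a 1 = a"
  by (cases a) auto

text \<open>A positive power is an order isomorphism. In this form it passes through
  suprema.\<close>

lemma epow_le_iff: "0 < p \<Longrightarrow> epow a p \<le> b \<longleftrightarrow> a \<le> epow b (1 / p)"
proof
  assume "0 < p" "epow a p \<le> b"
  then have "epow (epow a p) (1 / p) \<le> epow b (1 / p)" by (intro epow_mono) auto
  then show "a \<le> epow b (1 / p)" using \<open>0 < p\<close> by (simp add: epow_epow)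
next
  assume "0 < p" "a \<le> epow b (1 / p)"
  then have "epow a p \<le> epow (epow b (1 / p)) p" by (intro epow_mono) auto
  then show "epow a p \<le> b" using \<open>0 < p\<close> by (simp add: epow_epow)
qed

lemma epow_SUP_le:
  assumes "0 < p" "\<And>i. i \<in> I \<Longrightarrow> epow (a i) p \<le> b"
  shows "epow (SUP i\<in>I. a i) p \<le> b"
  using assms by (simp add: epow_le_iff SUP_le_iff)

lemma epow_mult: "0 < c \<Longrightarrow> epow (ennreal c * a) p = ennreal (c powr p) * epow a p"
  by (cases a) (auto simp: ennreal_mult_top powr_mult simp flip: ennreal_mult)

text \<open>The graph of \<open>x powr p\<close> lies above its tangent at \<open>a\<close>. It
  follows from Young's inequality with weights \<open>1 / p\<close> and
  \<open>(p - 1) / p\<close>.\<close>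

lemma powr_tangent_le:
  fixes a x p :: real
  assumes "1 \<le> p" "0 \<le> a" "0 \<le> x"
  shows "p * a powr (p - 1) * x \<le> x powr p + (p - 1) * a powr p"
proof (cases "a = 0 \<or> x = 0")
  case False
  then have "(x powr p) powr (1 / p) * (a powr p) powr ((p - 1) / p)
      \<le> 1 / p * x powr p + (p - 1) / p * a powr p"
    using assms by (intro Youngs_inequality_0) (auto simp: field_simps)
  moreover have "(a powr p) powr ((p - 1) / p) = a powr (p - 1)"
    using assms by (simp add: powr_powr)
  moreover have "(x powr p) powr (1 / p) = x"
    using assms False by (simp add: powr_powr)
  ultimately have "x * a powr (p - 1) \<le> 1 / p * x powr p + (p - 1) / p * a powr p" by simp
  then have "p * (x * a powr (p - 1)) \<le> p * (1 / p * x powr p + (p - 1) / p * a powr p)"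
    using assms by (intro mult_left_mono) auto
  also have "\<dots> = x powr p + (p - 1) * a powr p"
    using assms by (simp add: distrib_left)
  finally show ?thesis by (simp add: ac_simps)
qed (use assms in auto)

text \<open>Jensen's inequality for an average normalised by a number \<open>\<nu>\<close> that may
  exceed the mass of \<open>S\<close>. The excess is needed when only part of a ball is
  integrated.\<close>

lemma epow_set_nn_integral_le:
  fixes f :: "'a \<Rightarrow> real"
  assumes p: "1 \<le> p" and \<nu>: "0 < \<nu>" and [measurable]: "f \<in> borel_measurable M" "S \<in> sets M"
    and S: "emeasure M S \<le> ennreal \<nu>"
  shows "epow ((\<integral>\<^sup>+y\<in>S. ennreal \<bar>f y\<bar> \<partial>M) / ennreal \<nu>) p \<le> (\<integral>\<^sup>+y\<in>S. ennreal (\<bar>f y\<bar> powr p) \<partial>M) / ennreal \<nu>"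
proof -
  let ?I = "\<integral>\<^sup>+y\<in>S. ennreal \<bar>f y\<bar> \<partial>M" and ?J = "\<integral>\<^sup>+y\<in>S. ennreal (\<bar>f y\<bar> powr p) \<partial>M"
  \<comment> \<open>The integrated tangent inequality. The mass of \<open>S\<close> occurs only with
    the nonnegative factor \<open>(p - 1) * a powr p\<close>, so an upper bound for it
    suffices.\<close>
  have main: "ennreal (p * a powr (p - 1)) * ?I \<le> ?J + ennreal ((p - 1) * a powr p * \<nu>)" if "0 \<le> a" for a
  proof -
    have "ennreal (p * a powr (p - 1)) * ?I = (\<integral>\<^sup>+y\<in>S. ennreal (p * a powr (p - 1) * \<bar>f y\<bar>) \<partial>M)"
      using p by (simp add: nn_integral_cmult[symmetric] ennreal_mult mult.assoc)
    also have "\<dots> \<le> (\<integral>\<^sup>+y. ennreal (\<bar>f y\<bar> powr p) * indicator S y + ennreal ((p - 1) * a powr p) * indicator S y \<partial>M)"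
    proof (intro nn_integral_mono)
      fix y
      have "ennreal (p * a powr (p - 1) * \<bar>f y\<bar>) \<le> ennreal (\<bar>f y\<bar> powr p) + ennreal ((p - 1) * a powr p)"
        using powr_tangent_le[OF p that, of "\<bar>f y\<bar>"] p by (subst ennreal_plus[symmetric]) (auto intro: ennreal_leI simp del: ennreal_plus)
      then show "ennreal (p * a powr (p - 1) * \<bar>f y\<bar>) * indicator S y
          \<le> ennreal (\<bar>f y\<bar> powr p) * indicator S y + ennreal ((p - 1) * a powr p) * indicator S y"
        by (auto simp: indicator_def)
    qed
    also have "\<dots> = ?J + ennreal ((p - 1) * a powr p) * emeasure M S"
      by (subst nn_integral_add) (auto simp: nn_integral_cmult)
    also have "\<dots> \<le> ?J + ennreal ((p - 1) * a powr p) * ennreal \<nu>"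
      using S by (intro add_left_mono mult_left_mono) auto
    finally show ?thesis using p \<nu> by (simp add: ennreal_mult)
  qed
  show ?thesis
  proof (cases ?J)
    case top
    then show ?thesis using \<nu> by (simp add: ennreal_top_divide)
  next
    case (real j)
    have "?I \<noteq> top"
    proof
      assume "?I = top"
      with main[of 1] real p \<nu> show False
        by (simp add: ennreal_mult_top top_unique flip: ennreal_plus)
    qed
    then obtain i where i: "0 \<le> i" "?I = ennreal i" by (cases ?I) auto
    \<comment> \<open>The tangent at the average itself is the one that gives the sharp
      inequality.\<close>
    define a where "a = i / \<nu>"
    have a: "0 \<le> a" "i = a * \<nu>" using i \<nu> by (auto simp: a_def)
    have "p * a powr (p - 1) * i \<le> j + (p - 1) * a powr p * \<nu>"
      using main[OF a(1)] p \<nu> i(1) \<open>0 \<le> j\<close> unfolding real i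
      by (simp flip: ennreal_plus ennreal_mult)
    moreover have "a powr (p - 1) * a = a powr p"
      using a(1) by (cases "a = 0") (auto simp: powr_diff)
    then have "p * a powr (p - 1) * i = p * a powr p * \<nu>"
      unfolding a(2) by (metis mult.assoc)
    ultimately have "p * a powr p * \<nu> \<le> j + (p - 1) * a powr p * \<nu>" by (simp only:)
    then have "a powr p * \<nu> \<le> j" by (simp add: algebra_simps)
    then have "a powr p \<le> j / \<nu>" using \<nu> by (simp add: field_simps)
    then show ?thesis
      using i real \<nu> a(1) by (simp add: divide_ennreal ennreal_leI flip: a_def)
  qed
qed

lemma divide_mono_ennreal:
  assumes "b \<le> c"
  shows "a / c \<le> a / (b :: ennreal)"
proof (cases "b = 0 \<or> c = top")
  case False
  then obtain x y where "b = ennreal x" "c = ennreal y" "0 < x" "x \<le> y"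
    using assms by (cases b; cases c) (auto simp: top_unique less_le)
  then show ?thesis
    unfolding divide_ennreal_def by (auto intro!: mult_left_mono ennreal_leI le_imp_inverse_le simp: inverse_ennreal)
qed (auto simp: divide_ennreal_def ennreal_mult_top)

section \<open>Hub spaces\<close>

text \<open>The summability in \<open>w_summable\<close> keeps the total mass comparable to the hub
  mass 1. The two bounds in \<open>w_c\<close> make a centre negligible: it does not change the size
  of its ball, and averages sampled at the centres sum to a bounded multiple of the norm. The bound
  \<open>w_A\<close> is the \<open>fan_graph\<close> condition.\<close>

locale hub_space =
  fixes w :: "'a \<Rightarrow> real" and h :: 'a and BB UU :: "nat \<Rightarrow> 'a set" and c :: "'a \<Rightarrow> 'a"
    and A :: "'a \<Rightarrow> 'a set" and K :: real
  assumes finite_BB: "finite (BB n)" and finite_UU: "finite (UU n)" and BB_nonempty: "BB n \<noteq> {}"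
    and disj_BB: "disjoint_family BB" and disj_UU: "disjoint_family UU"
    and h_notin: "h \<notin> BB n" "h \<notin> UU n" "h \<notin> c ` UU n"
    and disj: "BB m \<inter> UU n = {}" "BB m \<inter> c ` UU n = {}" "UU m \<inter> c ` UU n = {}"
    and inj_c: "inj_on c (\<Union>n. UU n)"
    and A_sub: "u \<in> UU n \<Longrightarrow> A u \<subseteq> BB n"
    and w_h: "w h = 1"
    and w_pos: "b \<in> BB n \<Longrightarrow> 0 < w b" "u \<in> UU n \<Longrightarrow> 0 < w u" "u \<in> UU n \<Longrightarrow> 0 < w (c u)"
    and w_summable: "sum w (BB n) + sum w (UU n) \<le> (1 / 2) ^ n"
    and w_c: "u \<in> UU n \<Longrightarrow> w (c u) \<le> w u" "(\<Sum>u\<in>UU n. w (c u) / w u) \<le> (1 / 2) ^ n"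
    and w_A: "u \<in> UU n \<Longrightarrow> sum w (A u) \<le> K * w u"
    and K: "0 \<le> K"
begin

definition B where "B = (\<Union>n. BB n)"
definition U where "U = (\<Union>n. UU n)"
definition X where "X = {h} \<union> B \<union> U \<union> c ` U"
definition M where "M = point_measure X (\<lambda>x. ennreal (w x))"
text \<open>In the metric below, \<open>P u\<close> is the closed neighbourhood of \<open>u\<close>
  when the extra edges are absent, and \<open>Q u\<close> is that of \<open>c u\<close> in all
  cases.\<close>

definition P where "P u = {u, c u}"
definition Q where "Q u = {u, c u} \<union> A u"

section \<open>Masses and integrals in a hub space\<close>

lemma space_M [simp]: "space M = X" and sets_M [simp]: "sets M = Pow X"
  by (auto simp: M_def space_point_measure sets_point_measure)

lemma measurable_M [simp]: "f \<in> borel_measurable M"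
  by (simp add: M_def)

lemma w_X_pos: "x \<in> X \<Longrightarrow> 0 < w x"
  using w_pos w_h by (auto simp: X_def B_def U_def)

lemma countable_U: "countable U"
  using finite_UU by (auto simp: U_def intro: countable_finite)

lemma subsets_X: "BB n \<subseteq> X" "UU n \<subseteq> X" "u \<in> U \<Longrightarrow> P u \<subseteq> X" "u \<in> U \<Longrightarrow> Q u \<subseteq> X" "h \<in> X"
  using A_sub by (fastforce simp: X_def B_def U_def P_def Q_def)+

lemma finite_A: "u \<in> U \<Longrightarrow> finite (A u)"
  using A_sub finite_BB by (metis U_def UN_E finite_subset)

lemma A_disj: "u \<in> U \<Longrightarrow> v \<in> U \<Longrightarrow> v \<notin> A u \<and> c v \<notin> A u \<and> u \<noteq> c v"
  using A_sub disj by (fastforce simp: U_def)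

lemma emeasure_finite: "finite S \<Longrightarrow> S \<subseteq> X \<Longrightarrow> emeasure M S = ennreal (sum w S)"
  unfolding M_def using w_X_pos
  by (subst emeasure_point_measure_finite2) (auto intro!: sum_ennreal less_imp_le)

lemma nn_integral_M: "(\<integral>\<^sup>+x. F x \<partial>M) = (\<integral>\<^sup>+x. ennreal (w x) * F x \<partial>count_space X)"
  unfolding M_def point_measure_def by (subst nn_integral_density) auto

lemma set_nn_integral_finite:
  assumes "finite S" "S \<subseteq> X"
  shows "(\<integral>\<^sup>+x\<in>S. F x \<partial>M) = (\<Sum>x\<in>S. ennreal (w x) * F x)"
  unfolding nn_integral_M using assms
  by (subst nn_integral_count_space'[of S]) auto

lemma set_nn_integral_finite_real:
  assumes "finite S" "S \<subseteq> X" "\<And>x. 0 \<le> F x"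
  shows "(\<integral>\<^sup>+x\<in>S. ennreal (F x) \<partial>M) = ennreal (\<Sum>x\<in>S. w x * F x)"
proof -
  have "(\<Sum>x\<in>S. ennreal (w x) * ennreal (F x)) = (\<Sum>x\<in>S. ennreal (w x * F x))"
    using assms w_X_pos by (intro sum.cong) (auto simp: ennreal_mult less_imp_le)
  also have "\<dots> = ennreal (\<Sum>x\<in>S. w x * F x)"
    using assms w_X_pos by (intro sum_ennreal mult_nonneg_nonneg) (auto simp: less_imp_le subset_eq)
  finally show ?thesis using set_nn_integral_finite[OF assms(1,2)] by simp
qed

lemma emeasure_Q:
  assumes "u \<in> U"
  shows "ennreal (w u) \<le> emeasure M (Q u)" "emeasure M (Q u) \<le> ennreal ((K + 2) * w u)"
    "emeasure M (P u) \<le> ennreal (2 * w u)" "ennreal (w u) \<le> emeasure M (P u)"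
proof -
  obtain n where n: "u \<in> UU n" using assms by (auto simp: U_def)
  have *: "emeasure M (P u) = ennreal (w u + w (c u))"
    using assms A_disj[OF assms assms] subsets_X(3)[OF assms]
    by (subst emeasure_finite) (auto simp: P_def)
  have **: "emeasure M (Q u) = ennreal (w u + w (c u) + sum w (A u))"
    using assms A_disj[OF assms assms] subsets_X(4)[OF assms] finite_A[OF assms]
    by (subst emeasure_finite) (auto simp: Q_def add.assoc)
  have "0 \<le> sum w (A u)" using A_sub[OF n] w_pos(1) by (intro sum_nonneg) (auto simp: less_imp_le subset_eq)
  then show "ennreal (w u) \<le> emeasure M (Q u)" "emeasure M (Q u) \<le> ennreal ((K + 2) * w u)"
    "emeasure M (P u) \<le> ennreal (2 * w u)" "ennreal (w u) \<le> emeasure M (P u)"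
    unfolding * ** using w_A[OF n] w_c(1)[OF n] w_pos(3)[OF n] by (auto intro!: ennreal_leI simp: algebra_simps simp del: ennreal_plus)
qed

lemma nn_integral_targets:
  assumes "V \<subseteq> U"
  shows "(\<integral>\<^sup>+u. F u \<partial>count_space V) = (\<Sum>n. \<Sum>u\<in>UU n \<inter> V. F u)"
proof -
  have V: "V = (\<Union>n. UU n \<inter> V)" using assms by (auto simp: U_def)
  have "(\<integral>\<^sup>+u. F u \<partial>count_space V) = (\<integral>\<^sup>+u\<in>(\<Union>n. UU n \<inter> V). F u \<partial>count_space V)"
    by (subst V[symmetric], rule nn_integral_cong) auto
  also have "\<dots> = (\<Sum>n. \<integral>\<^sup>+u\<in>UU n \<inter> V. F u \<partial>count_space V)"
    using disj_UU by (intro nn_integral_disjoint_family) (auto simp: disjoint_family_on_def)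
  also have "\<dots> = (\<Sum>n. \<Sum>u\<in>UU n \<inter> V. F u)"
  proof (rule arg_cong[where f = suminf], rule ext)
    fix n
    show "(\<integral>\<^sup>+u\<in>UU n \<inter> V. F u \<partial>count_space V) = (\<Sum>u\<in>UU n \<inter> V. F u)"
      using finite_UU[of n] by (subst nn_integral_count_space'[of "UU n \<inter> V"]) auto
  qed
  finally show ?thesis .
qed

lemma sum_components_le:
  "(\<Sum>n. \<Sum>b\<in>BB n. ennreal (w b) * F b) \<le> (\<integral>\<^sup>+x. F x \<partial>M)"
proof -
  have "(\<Sum>n. \<Sum>b\<in>BB n. ennreal (w b) * F b) = (\<Sum>n. \<integral>\<^sup>+x\<in>BB n. F x \<partial>M)"
    using set_nn_integral_finite[OF finite_BB subsets_X(1)] by simp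
  also have "\<dots> = (\<integral>\<^sup>+x\<in>(\<Union>n. BB n). F x \<partial>M)"
    using disj_BB subsets_X by (intro nn_integral_disjoint_family[symmetric]) auto
  also have "\<dots> \<le> (\<integral>\<^sup>+x. F x \<partial>M)"
    by (intro nn_integral_mono) (auto simp: indicator_def)
  finally show ?thesis .
qed

lemma nn_integral_targets_swap:
  assumes "V \<subseteq> U" "\<And>u. u \<in> V \<Longrightarrow> D u \<subseteq> X"
  shows "(\<integral>\<^sup>+x. (\<integral>\<^sup>+u. F u * indicator (D u) x \<partial>count_space V) \<partial>M) = (\<integral>\<^sup>+u. F u * emeasure M (D u) \<partial>count_space V)"
proof -
  have "countable V" using assms countable_U countable_subset by blast
  then have "(\<integral>\<^sup>+x. (\<integral>\<^sup>+u. F u * indicator (D u) x \<partial>count_space V) \<partial>M) = (\<integral>\<^sup>+u. (\<integral>\<^sup>+x. F u * indicator (D u) x \<partial>M) \<partial>count_space V)"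
    by (rule nn_integral_count_space_nn_integral) auto
  also have "\<dots> = (\<integral>\<^sup>+u. F u * emeasure M (D u) \<partial>count_space V)"
    using assms(2) by (intro nn_integral_cong) (simp add: nn_integral_cmult)
  finally show ?thesis .
qed

text \<open>The sets \<open>P u\<close> are pairwise disjoint, unlike the sets \<open>Q u\<close>,
  which may share base points.\<close>

lemma nn_integral_P_le: "(\<integral>\<^sup>+u. (\<integral>\<^sup>+x\<in>P u. F x \<partial>M) \<partial>count_space U) \<le> (\<integral>\<^sup>+x. F x \<partial>M)"
proof -
  have "(\<integral>\<^sup>+u. (\<integral>\<^sup>+x. F x * indicator (P u) x \<partial>M) \<partial>count_space U) = (\<integral>\<^sup>+x. (\<integral>\<^sup>+u. F x * indicator (P u) x \<partial>count_space U) \<partial>M)"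
    using countable_U by (intro nn_integral_count_space_nn_integral[symmetric]) auto
  also have "\<dots> \<le> (\<integral>\<^sup>+x. F x \<partial>M)"
  proof (intro nn_integral_mono)
    fix x
    have uniq: "u = v" if "u \<in> U" "v \<in> U" "x \<in> P u" "x \<in> P v" for u v
      using that A_disj[of u v] A_disj[of v u] inj_onD[OF inj_c, of u v] by (auto simp: P_def U_def)
    show "(\<integral>\<^sup>+u. F x * indicator (P u) x \<partial>count_space U) \<le> F x"
    proof (cases "\<exists>v\<in>U. x \<in> P v")
      case True
      then obtain v where v: "v \<in> U" "x \<in> P v" by auto
      then have "(\<integral>\<^sup>+u. F x * indicator (P u) x \<partial>count_space U) = (\<Sum>u\<in>{v}. F x * indicator (P u) x)"
      proof (intro nn_integral_count_space')
        fix u assume "u \<in> U" "u \<notin> {v}"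
        then have "x \<notin> P u" using uniq[OF _ v(1) _ v(2)] by blast
        then show "F x * indicator (P u) x = 0" by simp
      qed (use v in auto)
      then show ?thesis using v by simp
    next
      case False
      then have "(\<integral>\<^sup>+u. F x * indicator (P u) x \<partial>count_space U) = (\<integral>\<^sup>+u. 0 \<partial>count_space U)"
        by (intro nn_integral_cong) (auto simp: indicator_def)
      then show ?thesis by simp
    qed
  qed
  finally show ?thesis .
qed

lemma suminf_half: "(\<Sum>n. ennreal ((1 / 2) ^ n)) = 2"
  by (subst suminf_ennreal2) (auto simp: suminf_geometric summable_geometric)

lemma nn_integral_center_le: "(\<integral>\<^sup>+u. ennreal (w (c u) / w u) \<partial>count_space U) \<le> 2"
proof -
  have "(\<Sum>u\<in>UU n \<inter> U. ennreal (w (c u) / w u)) \<le> ennreal ((1 / 2) ^ n)" for n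
  proof -
    have "UU n \<inter> U = UU n" by (auto simp: U_def)
    then show ?thesis using w_c(2)[of n] w_pos
      by (simp add: sum_ennreal less_imp_le ennreal_leI)
  qed
  then show ?thesis
    unfolding nn_integral_targets[OF subset_refl] suminf_half[symmetric] by (intro suminf_le) auto
qed

text \<open>The 5 is the hub mass 1 plus twice the geometric sum 2; the doubling pays for the
  centres, which are no heavier than their targets.\<close>

lemma emeasure_M_X: "1 \<le> emeasure M X" "emeasure M X \<le> 5"
proof -
  have "emeasure M {h} = 1" using subsets_X(5) w_h by (subst emeasure_finite) auto
  then show "1 \<le> emeasure M X" using subsets_X(5) emeasure_mono[of "{h}" X M] by auto
  define Z where "Z n = BB n \<union> UU n \<union> c ` UU n" for n
  have Zs: "Z n \<subseteq> X" for n by (auto simp: Z_def X_def B_def U_def)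
  have Z: "emeasure M (Z n) \<le> 2 * ennreal ((1 / 2) ^ n)" for n
  proof -
    have "inj_on c (UU n)" using inj_c by (rule inj_on_subset) auto
    then have "emeasure M (Z n) = ennreal (sum w (BB n) + sum w (UU n) + (\<Sum>u\<in>UU n. w (c u)))"
      using Zs[of n] finite_BB[of n] finite_UU[of n] disj[of n n]
      by (subst emeasure_finite) (auto simp: Z_def sum.union_disjoint sum.reindex Int_Un_distrib2)
    also have "(\<Sum>u\<in>UU n. w (c u)) \<le> sum w (UU n)" using w_c(1) by (intro sum_mono) auto
    also have "sum w (BB n) + sum w (UU n) + sum w (UU n) \<le> 2 * (1 / 2) ^ n"
      using w_summable[of n] w_pos(1)[of _ n] sum_nonneg[of "BB n" w] by (auto simp: less_imp_le)
    finally show ?thesis by (simp add: ennreal_leI ennreal_mult)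
  qed
  have "X = {h} \<union> (\<Union>n. Z n)" by (auto simp: X_def Z_def B_def U_def)
  then have "emeasure M X \<le> emeasure M {h} + emeasure M (\<Union>n. Z n)"
    using Zs subsets_X(5) by (metis emeasure_subadditive sets_M Pow_iff UN_least empty_subsetI insert_subset)
  also have "emeasure M (\<Union>n. Z n) \<le> (\<Sum>n. emeasure M (Z n))"
    using Zs by (intro emeasure_subadditive_countably) auto
  also have "\<dots> \<le> (\<Sum>n. 2 * ennreal ((1 / 2) ^ n))" using Z by (intro suminf_le) auto
  also have "\<dots> = 2 * 2" by (subst ennreal_suminf_cmult) (simp only: suminf_half)
  finally show "emeasure M X \<le> 5"
    using \<open>emeasure M {h} = 1\<close> by (simp add: add_left_mono)
qed

text \<open>Only the last kind of set is not harmless: there the average is controlled by \<open>T\<close>.\<close>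

definition admissible :: "'a set \<Rightarrow> 'a \<Rightarrow> 'a set \<Rightarrow> bool" where
  "admissible V x S \<longleftrightarrow> S = {x} \<or> h \<in> S \<and> S \<subseteq> X \<or> (\<exists>u\<in>U. x \<in> P u \<and> S = P u) \<or>
     (\<exists>u\<in>U. x = c u \<and> S = Q u) \<or> (\<exists>u\<in>V. x \<in> Q u \<and> S = Q u)"

definition T :: "('a \<Rightarrow> real) \<Rightarrow> 'a \<Rightarrow> real" where
  "T f u = (\<Sum>b\<in>A u. w b * \<bar>f b\<bar>) / w u"

text \<open>Dominates, by Jensen's inequality, the \<open>p\<close>-th powers of all averages that do not involve \<open>T\<close>.\<close>

definition majorant :: "('a \<Rightarrow> real) \<Rightarrow> real \<Rightarrow> 'a \<Rightarrow> ennreal" where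
  "majorant f p x = ennreal (\<bar>f x\<bar> powr p) + Lp_pow M p f +
     (\<integral>\<^sup>+u. (\<integral>\<^sup>+y\<in>Q u. ennreal (\<bar>f y\<bar> powr p) \<partial>M) / ennreal (w u) * indicator {c u} x \<partial>count_space U) +
     (\<integral>\<^sup>+u. (\<integral>\<^sup>+y\<in>P u. ennreal (\<bar>f y\<bar> powr p) \<partial>M) / ennreal (w u) * indicator (Q u) x \<partial>count_space U)"

lemma w_U_pos: "u \<in> U \<Longrightarrow> 0 < w u"
  using w_pos by (auto simp: U_def)

lemma T_nonneg: "u \<in> U \<Longrightarrow> 0 \<le> T f u"
  using subsets_X(4)[of u] w_X_pos unfolding T_def Q_def
  by (intro divide_nonneg_nonneg sum_nonneg mult_nonneg_nonneg) (auto intro: less_imp_le w_U_pos)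

lemma set_nn_integral_le_Lp: "(\<integral>\<^sup>+y\<in>S. ennreal (\<bar>f y\<bar> powr p) \<partial>M) \<le> Lp_pow M p f"
  unfolding Lp_pow_def by (intro nn_integral_mono) (auto simp: indicator_def)

text \<open>The constant adds up one contribution per term: 1 for \<open>f\<close> itself, 5 for the
  constant term by the total mass, 2 for the centres by summability of the mass ratios, and
  \<open>K + 2\<close> for averages over the disjoint sets \<open>P u\<close> spread over
  \<open>Q u\<close>.\<close>

lemma nn_integral_majorant: "(\<integral>\<^sup>+x. majorant f p x \<partial>M) \<le> ennreal (K + 10) * Lp_pow M p f"
proof -
  let ?L = "Lp_pow M p f"
  let ?I = "\<lambda>S. \<integral>\<^sup>+y\<in>S. ennreal (\<bar>f y\<bar> powr p) \<partial>M"
  let ?c = "\<lambda>x. \<integral>\<^sup>+u. ?I (Q u) / ennreal (w u) * indicator {c u} x \<partial>count_space U"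
  let ?q = "\<lambda>x. \<integral>\<^sup>+u. ?I (P u) / ennreal (w u) * indicator (Q u) x \<partial>count_space U"
  have "(\<integral>\<^sup>+x. ?c x \<partial>M) = (\<integral>\<^sup>+u. ?I (Q u) / ennreal (w u) * emeasure M {c u} \<partial>count_space U)"
    by (intro nn_integral_targets_swap) (auto simp: X_def)
  also have "\<dots> \<le> (\<integral>\<^sup>+u. ?L * ennreal (w (c u) / w u) \<partial>count_space U)"
  proof (intro nn_integral_mono)
    fix u assume "u \<in> space (count_space U)"
    then have u: "u \<in> U" by simp
    have wc: "0 < w (c u)" using u w_pos by (auto simp: U_def)
    have "emeasure M {c u} = ennreal (w (c u))" using u by (subst emeasure_finite) (auto simp: X_def)
    then have "?I (Q u) / ennreal (w u) * emeasure M {c u} = ?I (Q u) * ennreal (w (c u) / w u)"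
      using w_U_pos[OF u] wc by (simp add: ennreal_divide_times divide_ennreal)
    also have "\<dots> \<le> ?L * ennreal (w (c u) / w u)"
      by (intro mult_right_mono set_nn_integral_le_Lp) auto
    finally show "?I (Q u) / ennreal (w u) * emeasure M {c u} \<le> ?L * ennreal (w (c u) / w u)" .
  qed
  also have "\<dots> \<le> ?L * 2"
    by (subst nn_integral_cmult) (auto intro: mult_left_mono nn_integral_center_le)
  finally have c: "(\<integral>\<^sup>+x. ?c x \<partial>M) \<le> 2 * ?L" by (simp add: mult.commute)
  have "(\<integral>\<^sup>+x. ?q x \<partial>M) = (\<integral>\<^sup>+u. ?I (P u) / ennreal (w u) * emeasure M (Q u) \<partial>count_space U)"
    using subsets_X by (intro nn_integral_targets_swap) auto
  also have "\<dots> \<le> (\<integral>\<^sup>+u. ennreal (K + 2) * ?I (P u) \<partial>count_space U)"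
  proof (intro nn_integral_mono)
    fix u assume "u \<in> space (count_space U)"
    then have u: "u \<in> U" by simp
    have "?I (P u) / ennreal (w u) * emeasure M (Q u) \<le> ?I (P u) / ennreal (w u) * ennreal ((K + 2) * w u)"
      using emeasure_Q(2)[OF u] by (intro mult_left_mono) auto
    also have "\<dots> = ?I (P u) * ennreal (K + 2)"
      using w_U_pos[OF u] K by (simp add: ennreal_divide_times divide_ennreal)
    finally show "?I (P u) / ennreal (w u) * emeasure M (Q u) \<le> ennreal (K + 2) * ?I (P u)"
      by (simp add: mult.commute)
  qed
  also have "\<dots> \<le> ennreal (K + 2) * ?L"
    by (subst nn_integral_cmult) (auto intro: mult_left_mono nn_integral_P_le simp: Lp_pow_def)
  finally have q: "(\<integral>\<^sup>+x. ?q x \<partial>M) \<le> ennreal (K + 2) * ?L" .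
  have "(\<integral>\<^sup>+x. majorant f p x \<partial>M) = ?L + ?L * emeasure M X + (\<integral>\<^sup>+x. ?c x \<partial>M) + (\<integral>\<^sup>+x. ?q x \<partial>M)"
    unfolding majorant_def by (simp add: nn_integral_add) (simp add: Lp_pow_def)
  also have "\<dots> \<le> ?L + ?L * 5 + 2 * ?L + ennreal (K + 2) * ?L"
    using emeasure_M_X(2) by (intro add_mono c q order_refl mult_left_mono) auto
  also have "\<dots> = (1 + 5 + 2 + ennreal (K + 2)) * ?L"
    by (simp only: distrib_right mult_1 mult.commute[of ?L 5])
  also have "1 + 5 + 2 + ennreal (K + 2) = ennreal (K + 10)"
  proof -
    have "ennreal (K + 10) = ennreal 8 + ennreal (K + 2)" using K by (subst ennreal_plus[symmetric]) auto
    then show ?thesis by simp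
  qed
  finally show ?thesis .
qed

section \<open>Averages over admissible sets\<close>

lemma emeasure_pos_finite:
  assumes "S \<subseteq> X" "S \<noteq> {}"
  shows "0 < emeasure M S" "emeasure M S < \<infinity>"
proof -
  obtain x where x: "x \<in> S" using assms by auto
  then have "0 < ennreal (w x)" using assms w_X_pos by (auto simp: ennreal_less_zero_iff)
  also have "\<dots> = emeasure M {x}" using x assms by (subst emeasure_finite) auto
  also have "\<dots> \<le> emeasure M S" using x assms by (intro emeasure_mono) auto
  finally show "0 < emeasure M S" .
  have "emeasure M S \<le> emeasure M X" using assms by (intro emeasure_mono) auto
  also have "\<dots> < top" using emeasure_M_X(2) by (rule le_less_trans) auto
  finally show "emeasure M S < \<infinity>" by simp
qed

lemma epow_avg_le:
  assumes "1 \<le> p" "S \<subseteq> X" "S \<noteq> {}"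
  shows "epow (avg M f S) p \<le> (\<integral>\<^sup>+y\<in>S. ennreal (\<bar>f y\<bar> powr p) \<partial>M) / emeasure M S"
proof -
  obtain \<nu> where \<nu>: "emeasure M S = ennreal \<nu>" "0 < \<nu>"
    using emeasure_pos_finite[OF assms(2,3)] by (cases "emeasure M S") (auto simp: ennreal_less_zero_iff)
  show ?thesis
    unfolding avg_def \<nu>(1) using assms \<nu> by (intro epow_set_nn_integral_le) auto
qed

text \<open>The integral splits over \<open>P u\<close> and \<open>A u\<close>, and the larger part
  dominates up to a factor 2. A disjunction instead of a sum serves both the strong and the weak
  estimate.\<close>

lemma avg_Q_le:
  assumes p: "1 \<le> p" and u: "u \<in> U"
  shows "epow (avg M f (Q u)) p \<le> ennreal (2 powr p) * ((\<integral>\<^sup>+y\<in>P u. ennreal (\<bar>f y\<bar> powr p) \<partial>M) / ennreal (w u))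
    \<or> avg M f (Q u) \<le> 2 * ennreal (T f u)"
proof -
  let ?m = "emeasure M (Q u)"
  have fin: "finite (P u)" "finite (A u)" "P u \<inter> A u = {}" and Q: "Q u = P u \<union> A u"
    using finite_A[OF u] A_disj[OF u u] by (auto simp: P_def Q_def)
  have sub: "P u \<subseteq> X" "A u \<subseteq> X" using subsets_X(3,4)[OF u] by (auto simp: Q_def)
  have wu: "0 < w u" using w_U_pos[OF u] .
  have "?m \<noteq> top" using emeasure_Q(2)[OF u] by (metis ennreal_less_top leD top.not_eq_extremum)
  moreover have "?m \<noteq> 0" using emeasure_Q(1)[OF u] wu by (auto simp: ennreal_eq_0_iff)
  ultimately obtain \<nu> where \<nu>: "?m = ennreal \<nu>" "0 < \<nu>"
    by (cases ?m) (auto simp: less_le)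
  have w\<nu>: "w u \<le> \<nu>" using emeasure_Q(1)[OF u] \<nu> by simp
  \<comment> \<open>Only \<open>P u\<close> is integrated, but the normalisation is the mass of
    \<open>Q u\<close>; this is where Jensen's inequality is needed with a larger
    \<open>\<nu>\<close>.\<close>
  let ?a = "(\<integral>\<^sup>+y\<in>P u. ennreal \<bar>f y\<bar> \<partial>M) / ennreal \<nu>"
  have "(\<integral>\<^sup>+y\<in>Q u. ennreal \<bar>f y\<bar> \<partial>M) = (\<integral>\<^sup>+y\<in>P u. ennreal \<bar>f y\<bar> \<partial>M) + (\<integral>\<^sup>+y\<in>A u. ennreal \<bar>f y\<bar> \<partial>M)"
    unfolding Q using fin sub by (subst (1 2 3) set_nn_integral_finite) (auto intro: sum.union_disjoint)
  moreover have "(\<integral>\<^sup>+y\<in>A u. ennreal \<bar>f y\<bar> \<partial>M) = ennreal (w u * T f u)"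
    using fin sub wu by (subst set_nn_integral_finite_real) (auto simp: T_def)
  ultimately have "avg M f (Q u) = ?a + ennreal (w u * T f u) / ennreal \<nu>"
    by (simp add: avg_def \<nu> add_divide_distrib_ennreal)
  also have "ennreal (w u * T f u) / ennreal \<nu> \<le> ennreal (T f u)"
    using \<nu> w\<nu> wu T_nonneg[OF u, of f]
    by (subst divide_ennreal) (auto intro!: ennreal_leI mult_right_mono simp: divide_le_eq mult.commute[of "T f u"])
  finally have le: "avg M f (Q u) \<le> ?a + ennreal (T f u)" by (simp add: add_left_mono)
  show ?thesis
  proof (cases "?a \<le> ennreal (T f u)")
    case True
    then have "?a + ennreal (T f u) \<le> 2 * ennreal (T f u)" by (simp add: mult_2 add_right_mono)
    then show ?thesis using le by (auto intro: order_trans)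
  next
    case False
    then have "?a + ennreal (T f u) \<le> ennreal 2 * ?a" by (simp add: mult_2 add_left_mono less_imp_le)
    with le have "avg M f (Q u) \<le> ennreal 2 * ?a" by (rule order_trans)
    then have "epow (avg M f (Q u)) p \<le> epow (ennreal 2 * ?a) p" using p by (intro epow_mono) auto
    also have "\<dots> = ennreal (2 powr p) * epow ?a p" by (rule epow_mult) simp
    also have "epow ?a p \<le> (\<integral>\<^sup>+y\<in>P u. ennreal (\<bar>f y\<bar> powr p) \<partial>M) / ennreal \<nu>"
    proof (rule epow_set_nn_integral_le)
      show "emeasure M (P u) \<le> ennreal \<nu>"
        unfolding \<nu>(1)[symmetric] using subsets_X(4)[OF u] by (intro emeasure_mono) (auto simp: Q)
    qed (use p \<nu> sub in auto)
    also have "\<dots> \<le> (\<integral>\<^sup>+y\<in>P u. ennreal (\<bar>f y\<bar> powr p) \<partial>M) / ennreal (w u)"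
      using w\<nu> by (intro divide_mono_ennreal) (auto intro: ennreal_leI)
    finally show ?thesis by (simp add: mult_left_mono)
  qed
qed

text \<open>Each harmless kind of set is matched with one term of \<open>majorant\<close>; sets
  through the hub use that their mass is at least 1. Only a set \<open>Q u\<close> with
  \<open>u\<close> in \<open>V\<close> can lead to the second alternative.\<close>

lemma avg_admissible:
  assumes p: "1 \<le> p" and V: "V \<subseteq> U" and x: "x \<in> X" and S: "admissible V x S"
  shows "epow (avg M f S) p \<le> ennreal (2 powr p) * majorant f p x \<or>
    (\<exists>u\<in>V. x \<in> Q u \<and> avg M f S \<le> 2 * ennreal (T f u))"
proof -
  let ?I = "\<lambda>S. \<integral>\<^sup>+y\<in>S. ennreal (\<bar>f y\<bar> powr p) \<partial>M"
  have big: "a \<le> ennreal (2 powr p) * majorant f p x" if "a \<le> majorant f p x" for a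
  proof -
    have "1 \<le> ennreal (2 powr p)" using p by (simp add: ge_one_powr_ge_zero)
    then have "1 * majorant f p x \<le> ennreal (2 powr p) * majorant f p x" by (rule mult_right_mono) simp
    then show ?thesis using that by simp
  qed
  have IQ: "?I (P u) / ennreal (w u) \<le> majorant f p x" if "u \<in> U" "x \<in> Q u" for u
  proof -
    have "?I (P u) / ennreal (w u) = ?I (P u) / ennreal (w u) * indicator (Q u) x" using that by simp
    also have "\<dots> \<le> (\<integral>\<^sup>+u. ?I (P u) / ennreal (w u) * indicator (Q u) x \<partial>count_space U)"
      using that(1) by (rule nn_integral_ge_point)
    also have "\<dots> \<le> majorant f p x" unfolding majorant_def by simp
    finally show ?thesis .
  qed
  from S consider "S = {x}" | "h \<in> S" "S \<subseteq> X" | u where "u \<in> U" "x \<in> P u" "S = P u"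
    | u where "u \<in> U" "x = c u" "S = Q u" | u where "u \<in> V" "x \<in> Q u" "S = Q u"
    unfolding admissible_def by blast
  then show ?thesis
  proof cases
    case 1
    have "epow (avg M f S) p \<le> ?I {x} / emeasure M {x}" using epow_avg_le[OF p, of "{x}"] 1 x by simp
    also have "?I {x} = ennreal (w x * \<bar>f x\<bar> powr p)" using x by (subst set_nn_integral_finite_real) auto
    also have "\<dots> / emeasure M {x} = ennreal (\<bar>f x\<bar> powr p)"
      using x w_X_pos[OF x] by (subst emeasure_finite) (auto simp: divide_ennreal)
    also have "\<dots> \<le> majorant f p x" unfolding majorant_def by (simp add: add.assoc)
    finally show ?thesis using big by blast
  next
    case 2
    have "emeasure M {h} = 1" using subsets_X(5) w_h by (subst emeasure_finite) auto
    then have "1 \<le> emeasure M S" using emeasure_mono[of "{h}" S M] 2 by simp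
    have "epow (avg M f S) p \<le> ?I S / emeasure M S" using epow_avg_le[OF p 2(2)] 2(1) by auto
    also have "\<dots> \<le> ?I S / 1" using \<open>1 \<le> emeasure M S\<close> by (intro divide_mono_ennreal) auto
    also have "\<dots> \<le> Lp_pow M p f" by (simp add: divide_ennreal_def set_nn_integral_le_Lp)
    also have "\<dots> \<le> majorant f p x" unfolding majorant_def by (simp add: add.assoc add.left_commute)
    finally show ?thesis using big by blast
  next
    case 3
    have "epow (avg M f S) p \<le> ?I (P u) / emeasure M (P u)"
      using epow_avg_le[OF p subsets_X(3)[OF 3(1)]] 3 by (auto simp: P_def)
    also have "\<dots> \<le> ?I (P u) / ennreal (w u)" using emeasure_Q(4)[OF 3(1)] by (intro divide_mono_ennreal) auto
    also have "\<dots> \<le> majorant f p x" using 3 by (intro IQ) (auto simp: P_def Q_def)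
    finally show ?thesis using big by blast
  next
    case 4
    have "epow (avg M f S) p \<le> ?I (Q u) / emeasure M (Q u)"
      using epow_avg_le[OF p subsets_X(4)[OF 4(1)]] 4 by (auto simp: Q_def)
    also have "\<dots> \<le> ?I (Q u) / ennreal (w u)" using emeasure_Q(1)[OF 4(1)] by (intro divide_mono_ennreal) auto
    also have "\<dots> = ?I (Q u) / ennreal (w u) * indicator {c u} x" using 4 by simp
    also have "\<dots> \<le> (\<integral>\<^sup>+u. ?I (Q u) / ennreal (w u) * indicator {c u} x \<partial>count_space U)"
      using 4(1) by (rule nn_integral_ge_point)
    also have "\<dots> \<le> majorant f p x" unfolding majorant_def by simp
    finally show ?thesis using big by blast
  next
    case 5
    then have u: "u \<in> U" using V by auto
    from avg_Q_le[OF p u, of f] show ?thesis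
    proof
      assume "epow (avg M f (Q u)) p \<le> ennreal (2 powr p) * (?I (P u) / ennreal (w u))"
      also have "\<dots> \<le> ennreal (2 powr p) * majorant f p x"
        using IQ[OF u 5(2)] by (rule mult_left_mono) simp
      finally show ?thesis using 5 by blast
    qed (use 5 in blast)
  qed
qed

section \<open>Upper bounds for suprema of averages\<close>

lemma targets_le:
  assumes "V \<subseteq> U" "\<And>u. 0 \<le> F u" "\<And>b. 0 \<le> G b" "0 \<le> C"
    and le: "\<And>n. (\<Sum>u\<in>UU n \<inter> V. w u * F u) \<le> C * (\<Sum>b\<in>BB n. w b * G b)"
  shows "(\<integral>\<^sup>+u. ennreal (w u * F u) \<partial>count_space V) \<le> ennreal C * (\<integral>\<^sup>+x. ennreal (G x) \<partial>M)"
proof -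
  have "(\<Sum>u\<in>UU n \<inter> V. ennreal (w u * F u)) \<le> ennreal C * (\<Sum>b\<in>BB n. ennreal (w b) * ennreal (G b))" for n
  proof -
    have "(\<Sum>u\<in>UU n \<inter> V. ennreal (w u * F u)) = ennreal (\<Sum>u\<in>UU n \<inter> V. w u * F u)"
      using assms(2) w_pos(2) by (intro sum_ennreal) (auto simp: less_imp_le)
    also have "\<dots> \<le> ennreal (C * (\<Sum>b\<in>BB n. w b * G b))" by (intro ennreal_leI le)
    also have "\<dots> = ennreal C * ennreal (\<Sum>b\<in>BB n. w b * G b)"
      using assms w_pos(1) by (intro ennreal_mult) (auto intro!: sum_nonneg mult_nonneg_nonneg simp: less_imp_le)
    also have "ennreal (\<Sum>b\<in>BB n. w b * G b) = (\<Sum>b\<in>BB n. ennreal (w b * G b))"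
      using assms(3) w_pos(1) by (intro sum_ennreal[symmetric]) (auto simp: less_imp_le)
    also have "\<dots> = (\<Sum>b\<in>BB n. ennreal (w b) * ennreal (G b))"
      using assms(3) w_pos(1) by (intro sum.cong) (auto simp: ennreal_mult less_imp_le)
    finally show ?thesis .
  qed
  then have "(\<integral>\<^sup>+u. ennreal (w u * F u) \<partial>count_space V) \<le> (\<Sum>n. ennreal C * (\<Sum>b\<in>BB n. ennreal (w b) * ennreal (G b)))"
    unfolding nn_integral_targets[OF assms(1)] by (intro suminf_le) auto
  also have "\<dots> = ennreal C * (\<Sum>n. \<Sum>b\<in>BB n. ennreal (w b) * ennreal (G b))" by simp
  also have "\<dots> \<le> ennreal C * (\<integral>\<^sup>+x. ennreal (G x) \<partial>M)"
    by (intro mult_left_mono sum_components_le) auto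
  finally show ?thesis .
qed

text \<open>A base point may lie in many sets \<open>Q u\<close>, so the supremum is replaced by the
  sum over all targets. Integration costs only the mass of each \<open>Q u\<close>, at most
  \<open>(K + 2) * w u\<close>, and the componentwise bound for \<open>T\<close> applies.\<close>

lemma strong_upper:
  assumes p: "1 \<le> p" and V: "V \<subseteq> U" and SS: "\<And>x S. x \<in> X \<Longrightarrow> S \<in> SS x \<Longrightarrow> admissible V x S"
    and C: "0 \<le> C" "\<And>n. (\<Sum>u\<in>UU n \<inter> V. w u * T f u powr p) \<le> C * (\<Sum>b\<in>BB n. w b * \<bar>f b\<bar> powr p)"
  shows "(\<integral>\<^sup>+x. epow (SUP S\<in>SS x. avg M f S) p \<partial>M)
    \<le> ennreal (2 powr p * (K + 10) + 2 powr p * (K + 2) * C) * Lp_pow M p f"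
proof -
  let ?c = "ennreal (2 powr p)"
  let ?s = "\<lambda>x. \<integral>\<^sup>+u. ?c * ennreal (T f u powr p) * indicator (Q u) x \<partial>count_space V"
  have swap: "(\<integral>\<^sup>+x. ?s x \<partial>M) = (\<integral>\<^sup>+u. ?c * ennreal (T f u powr p) * emeasure M (Q u) \<partial>count_space V)"
    using V subsets_X(4) by (intro nn_integral_targets_swap) blast+
  have "epow (SUP S\<in>SS x. avg M f S) p \<le> ?c * majorant f p x + ?s x" if x: "x \<in> X" for x
  proof (rule epow_SUP_le)
    fix S assume "S \<in> SS x"
    from avg_admissible[OF p V x SS[OF x this], of f]
    show "epow (avg M f S) p \<le> ?c * majorant f p x + ?s x"
    proof
      assume "\<exists>u\<in>V. x \<in> Q u \<and> avg M f S \<le> 2 * ennreal (T f u)"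
      then obtain u where u: "u \<in> V" "x \<in> Q u" "avg M f S \<le> ennreal 2 * ennreal (T f u)" by auto
      have "epow (avg M f S) p \<le> epow (ennreal 2 * ennreal (T f u)) p" using u p by (intro epow_mono) auto
      also have "\<dots> = ?c * ennreal (T f u powr p) * indicator (Q u) x"
        using T_nonneg[of u f] u V by (subst epow_mult) auto
      also have "\<dots> \<le> ?s x" using u(1) by (rule nn_integral_ge_point)
      finally show ?thesis by (rule order_trans) simp
    qed (erule order_trans, simp)
  qed (use p in auto)
  then have "(\<integral>\<^sup>+x. epow (SUP S\<in>SS x. avg M f S) p \<partial>M) \<le> (\<integral>\<^sup>+x. ?c * majorant f p x + ?s x \<partial>M)"
    by (intro nn_integral_mono) auto
  also have "\<dots> = ?c * (\<integral>\<^sup>+x. majorant f p x \<partial>M) + (\<integral>\<^sup>+u. ?c * ennreal (T f u powr p) * emeasure M (Q u) \<partial>count_space V)"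
    unfolding swap[symmetric] by (simp add: nn_integral_add nn_integral_cmult)
  also have "(\<integral>\<^sup>+u. ?c * ennreal (T f u powr p) * emeasure M (Q u) \<partial>count_space V)
      \<le> (\<integral>\<^sup>+u. ennreal (2 powr p * (K + 2)) * ennreal (w u * T f u powr p) \<partial>count_space V)"
  proof (intro nn_integral_mono)
    fix u assume "u \<in> space (count_space V)"
    then have u: "u \<in> U" using V by auto
    have "?c * ennreal (T f u powr p) * emeasure M (Q u) \<le> ?c * ennreal (T f u powr p) * ennreal ((K + 2) * w u)"
      using emeasure_Q(2)[OF u] by (intro mult_left_mono) auto
    also have "\<dots> = ennreal (2 powr p * (K + 2)) * ennreal (w u * T f u powr p)"
      using K w_U_pos[OF u] by (simp flip: ennreal_mult add: ac_simps)
    finally show "?c * ennreal (T f u powr p) * emeasure M (Q u) \<le> ennreal (2 powr p * (K + 2)) * ennreal (w u * T f u powr p)" .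
  qed
  also have "\<dots> = ennreal (2 powr p * (K + 2)) * (\<integral>\<^sup>+u. ennreal (w u * T f u powr p) \<partial>count_space V)"
    by (rule nn_integral_cmult) auto
  also have "(\<integral>\<^sup>+u. ennreal (w u * T f u powr p) \<partial>count_space V) \<le> ennreal C * Lp_pow M p f"
    unfolding Lp_pow_def using V C by (intro targets_le) auto
  also have "(\<integral>\<^sup>+x. majorant f p x \<partial>M) \<le> ennreal (K + 10) * Lp_pow M p f" by (rule nn_integral_majorant)
  finally have "(\<integral>\<^sup>+x. epow (SUP S\<in>SS x. avg M f S) p \<partial>M)
      \<le> ?c * (ennreal (K + 10) * Lp_pow M p f) + ennreal (2 powr p * (K + 2)) * (ennreal C * Lp_pow M p f)"
    by (simp add: mult_left_mono add_mono)
  also have "\<dots> = ennreal (2 powr p * (K + 10) + 2 powr p * (K + 2) * C) * Lp_pow M p f"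
    using K C by (subst ennreal_plus) (auto simp: ennreal_mult distrib_left distrib_right ac_simps)
  finally show ?thesis .
qed

text \<open>The level set is covered by a set where \<open>majorant\<close> is large, treated by
  Markov's inequality, and by the sets \<open>Q u\<close> of the targets with
  \<open>T f u > t / 2\<close>. The half compensates the factor 2 in
  \<open>avg_Q_le\<close>.\<close>

lemma weak_upper:
  assumes p: "1 \<le> p" and V: "V \<subseteq> U" and SS: "\<And>x S. x \<in> X \<Longrightarrow> S \<in> SS x \<Longrightarrow> admissible V x S"
    and t: "0 < t" and C: "0 \<le> C"
      "\<And>n. (t / 2) powr p * (\<Sum>u | u \<in> UU n \<inter> V \<and> t / 2 < T f u. w u) \<le> C * (\<Sum>b\<in>BB n. w b * \<bar>f b\<bar> powr p)"
  shows "ennreal (t powr p) * outer_measure_of M {x \<in> space M. (SUP S\<in>SS x. avg M f S) > ennreal t}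
    \<le> ennreal (2 powr p * (K + 10) + 2 powr p * (K + 2) * C) * Lp_pow M p f"
proof -
  let ?L = "Lp_pow M p f"
  define V' where "V' = {u \<in> V. t / 2 < T f u}"
  have V': "V' \<subseteq> U" using V by (auto simp: V'_def)
  define r where "r = (2 / t) powr p"
  let ?E = "{x \<in> space M. (SUP S\<in>SS x. avg M f S) > ennreal t}"
  let ?E1 = "{x \<in> X. 1 \<le> ennreal r * majorant f p x}" and ?E2 = "\<Union>u\<in>V'. Q u"
  have r: "t powr p * r = 2 powr p" "0 \<le> r" using t by (auto simp: r_def powr_mult[symmetric])
  have rt: "1 \<le> ennreal r * m" if "ennreal (t powr p) \<le> ennreal (2 powr p) * m" for m
  proof (cases m)
    case (real z)
    then have "t powr p \<le> 2 powr p * z" using that by (simp flip: ennreal_mult)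
    then have "t powr p * 1 \<le> t powr p * (r * z)" using r(1) by (metis mult.assoc mult.right_neutral)
    then have "1 \<le> r * z" using t by (simp only: mult_le_cancel_left_pos powr_gt_zero)
    then show ?thesis using real r by (simp flip: ennreal_mult add: ennreal_1[symmetric] del: ennreal_1)
  next
    case top
    then show ?thesis using t by (simp add: r_def ennreal_mult_top)
  qed
  have "?E \<subseteq> ?E1 \<union> ?E2"
  proof
    fix x assume "x \<in> ?E"
    then obtain S where x: "x \<in> X" and S: "S \<in> SS x" "ennreal t < avg M f S"
      by (auto simp: less_SUP_iff)
    from avg_admissible[OF p V x SS[OF x S(1)], of f] show "x \<in> ?E1 \<union> ?E2"
    proof
      assume le: "epow (avg M f S) p \<le> ennreal (2 powr p) * majorant f p x"
      have "ennreal (t powr p) = epow (ennreal t) p" using t by simp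
      also have "\<dots> \<le> epow (avg M f S) p" using S(2) p by (intro epow_mono) auto
      finally have "ennreal (t powr p) \<le> ennreal (2 powr p) * majorant f p x" using le by (rule order_trans)
      then show ?thesis using rt x by auto
    next
      assume "\<exists>u\<in>V. x \<in> Q u \<and> avg M f S \<le> 2 * ennreal (T f u)"
      then obtain u where u: "u \<in> V" "x \<in> Q u" "avg M f S \<le> ennreal 2 * ennreal (T f u)" by auto
      have "ennreal t < ennreal 2 * ennreal (T f u)" using S(2) u(3) by (rule less_le_trans)
      also have "\<dots> = ennreal (2 * T f u)" by (simp add: ennreal_mult')
      finally have "t < 2 * T f u" using t by (simp add: ennreal_less_iff)
      then show ?thesis using u by (auto simp: V'_def)
    qed
  qed
  moreover have E2: "?E2 \<subseteq> X" using V' subsets_X(4) by blast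
  ultimately have "outer_measure_of M ?E \<le> emeasure M (?E1 \<union> ?E2)"
    by (metis (no_types, lifting) outer_measure_of_mono outer_measure_of_eq sets_M Pow_iff Un_least mem_Collect_eq subsetI)
  also have "\<dots> \<le> emeasure M ?E1 + emeasure M ?E2" using E2 by (intro emeasure_subadditive) auto
  also have "emeasure M ?E1 \<le> ennreal r * (ennreal (K + 10) * ?L)"
  proof -
    have "emeasure M ?E1 \<le> ennreal r * (\<integral>\<^sup>+x\<in>X. majorant f p x \<partial>M)"
      by (rule nn_integral_Markov_inequality) auto
    also have "(\<integral>\<^sup>+x\<in>X. majorant f p x \<partial>M) \<le> (\<integral>\<^sup>+x. majorant f p x \<partial>M)"
      by (intro nn_integral_mono) (auto simp: indicator_def)
    also note nn_integral_majorant
    finally show ?thesis by (simp add: mult_left_mono)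
  qed
  also have "emeasure M ?E2 \<le> (\<integral>\<^sup>+u. 1 * emeasure M (Q u) \<partial>count_space V')"
  proof -
    have "emeasure M ?E2 = (\<integral>\<^sup>+x. indicator ?E2 x \<partial>M)" using E2 by simp
    also have "\<dots> \<le> (\<integral>\<^sup>+x. (\<integral>\<^sup>+u. 1 * indicator (Q u) x \<partial>count_space V') \<partial>M)"
    proof (intro nn_integral_mono)
      fix x
      show "indicator ?E2 x \<le> (\<integral>\<^sup>+u. 1 * indicator (Q u) x \<partial>count_space V')"
      proof (cases "x \<in> ?E2")
        case True
        then obtain u where "u \<in> V'" "x \<in> Q u" by auto
        then show ?thesis
          using nn_integral_ge_point[of u V' "\<lambda>u. 1 * indicator (Q u) x"] True by simp
      qed simp
    qed
    also have "\<dots> = (\<integral>\<^sup>+u. 1 * emeasure M (Q u) \<partial>count_space V')"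
      using V' subsets_X(4) by (intro nn_integral_targets_swap) blast+
    finally show ?thesis .
  qed
  also have "\<dots> \<le> (\<integral>\<^sup>+u. ennreal ((K + 2) * r) * ennreal (w u * (t / 2) powr p) \<partial>count_space V')"
  proof (intro nn_integral_mono)
    fix u assume "u \<in> space (count_space V')"
    then have u: "u \<in> U" using V' by auto
    have "r * (t / 2) powr p = 1" using t by (simp add: r_def powr_mult[symmetric])
    then have e: "(K + 2) * r * (w u * (t / 2) powr p) = (K + 2) * w u" by (simp add: ac_simps)
    have "ennreal ((K + 2) * r) * ennreal (w u * (t / 2) powr p) = ennreal ((K + 2) * r * (w u * (t / 2) powr p))"
      using K r(2) w_U_pos[OF u] by (intro ennreal_mult[symmetric]) auto
    then show "1 * emeasure M (Q u) \<le> ennreal ((K + 2) * r) * ennreal (w u * (t / 2) powr p)"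
      using emeasure_Q(2)[OF u] by (simp only: e mult_1)
  qed
  also have "\<dots> = ennreal ((K + 2) * r) * (\<integral>\<^sup>+u. ennreal (w u * (t / 2) powr p) \<partial>count_space V')"
    by (rule nn_integral_cmult) auto
  also have "(\<integral>\<^sup>+u. ennreal (w u * (t / 2) powr p) \<partial>count_space V') \<le> ennreal C * ?L"
    unfolding Lp_pow_def
  proof (intro targets_le)
    fix n
    have "UU n \<inter> V' = {u. u \<in> UU n \<inter> V \<and> t / 2 < T f u}" by (auto simp: V'_def)
    then show "(\<Sum>u\<in>UU n \<inter> V'. w u * (t / 2) powr p) \<le> C * (\<Sum>b\<in>BB n. w b * \<bar>f b\<bar> powr p)"
      using C(2)[of n] by (simp add: sum_distrib_right[symmetric] mult.commute)
  qed (use V' C in auto)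
  finally have "outer_measure_of M ?E \<le> ennreal r * (ennreal (K + 10) * ?L) + ennreal ((K + 2) * r) * (ennreal C * ?L)"
    by (simp add: mult_left_mono add_mono)
  then have "ennreal (t powr p) * outer_measure_of M ?E
      \<le> ennreal (t powr p) * (ennreal r * (ennreal (K + 10) * ?L) + ennreal ((K + 2) * r) * (ennreal C * ?L))"
    by (rule mult_left_mono) simp
  also have "\<dots> = (ennreal (t powr p * r * (K + 10)) + ennreal (t powr p * r * (K + 2) * C)) * ?L"
    using K C(1) r(2) by (simp add: ennreal_mult distrib_left distrib_right ac_simps)
  also have "\<dots> = ennreal (2 powr p * (K + 10) + 2 powr p * (K + 2) * C) * ?L"
    unfolding r(1) using K C by simp
  finally show ?thesis .
qed

section \<open>Types of maximal operators and uniform bounds on the components\<close>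

definition component :: "'a set \<Rightarrow> nat \<Rightarrow> ('a, 'a) bigraph" where
  "component V n = \<lparr>base = BB n, targets = UU n \<inter> V, link = A, bwt = w, twt = w\<rparr>"

lemma component_simps [simp]:
  "base (component V n) = BB n" "targets (component V n) = UU n \<inter> V" "link (component V n) = A"
  "bwt (component V n) = w" "twt (component V n) = w"
  by (auto simp: component_def)

lemma fan_avg_component:
  assumes "u \<in> UU n" "\<And>b. b \<in> BB n \<Longrightarrow> g b = \<bar>f b\<bar>"
  shows "fan_avg (component V n) g u = T f u"
proof -
  have "(\<Sum>b\<in>A u. w b * g b) = (\<Sum>b\<in>A u. w b * \<bar>f b\<bar>)"
    using A_sub[OF assms(1)] assms(2) by (intro sum.cong) auto
  then show ?thesis by (simp add: fan_avg_def T_def)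
qed

lemma fan_graph_component: "fan_graph K (component V n)"
  unfolding fan_graph_def component_simps
  using finite_BB finite_UU BB_nonempty w_pos(1,2) A_sub w_A by (intro conjI ballI) auto

lemma w_BB_nonneg: "b \<in> BB n \<Longrightarrow> 0 \<le> w b"
  using w_pos(1) by (auto simp: less_imp_le)

lemma Lp_pow_restrict:
  "Lp_pow M p (\<lambda>x. if x \<in> BB n then f x else 0) = ennreal (\<Sum>b\<in>BB n. w b * \<bar>f b\<bar> powr p)"
proof -
  have "Lp_pow M p (\<lambda>x. if x \<in> BB n then f x else 0) = (\<integral>\<^sup>+x\<in>BB n. ennreal (\<bar>f x\<bar> powr p) \<partial>M)"
    unfolding Lp_pow_def by (intro nn_integral_cong) (auto simp: indicator_def)
  then show ?thesis using finite_BB subsets_X(1) by (simp add: set_nn_integral_finite_real)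
qed

lemma Lp_pow_indicator: "E \<in> sets M \<Longrightarrow> Lp_pow M p (indicator E) = emeasure M E"
  unfolding Lp_pow_def
  by (subst nn_integral_indicator[symmetric], simp, intro nn_integral_cong) (auto simp: indicator_def)

text \<open>The set \<open>Q u\<close> contains \<open>A u\<close> and has mass at most
  \<open>(K + 2) * w u\<close>, so its average alone recovers \<open>T\<close> up to this
  factor.\<close>

lemma averages_ge_T:
  assumes "u \<in> U" "Q u \<in> SS"
  shows "ennreal (T f u / (K + 2)) \<le> (SUP S\<in>SS. avg M f S)"
proof -
  have u: "A u \<subseteq> X" "finite (A u)" "0 < w u" "0 \<le> T f u"
    using subsets_X(4)[OF assms(1)] finite_A assms(1) w_U_pos T_nonneg by (auto simp: Q_def)
  have "ennreal (T f u / (K + 2)) = ennreal (w u * T f u) / ennreal ((K + 2) * w u)"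
    using u K by (subst divide_ennreal) auto
  also have "\<dots> \<le> ennreal (w u * T f u) / emeasure M (Q u)"
    by (intro divide_mono_ennreal emeasure_Q assms)
  also have "ennreal (w u * T f u) = (\<integral>\<^sup>+y\<in>A u. ennreal \<bar>f y\<bar> \<partial>M)"
    using u by (subst set_nn_integral_finite_real) (auto simp: T_def)
  also have "\<dots> / emeasure M (Q u) \<le> avg M f (Q u)"
    unfolding avg_def by (intro divide_right_mono_ennreal nn_integral_mono) (auto simp: Q_def indicator_def)
  also have "\<dots> \<le> (SUP S\<in>SS. avg M f S)" using assms(2) by (rule SUP_upper)
  finally show ?thesis .
qed

text \<open>For necessity, a test function supported on the base of one component isolates that
  component, with a loss independent of it.\<close>

lemma strong_type_iff:
  assumes p: "1 \<le> p" and V: "V \<subseteq> U" and SS: "\<And>x S. x \<in> X \<Longrightarrow> S \<in> SS x \<Longrightarrow> admissible V x S"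
    and Q: "\<And>u. u \<in> V \<Longrightarrow> Q u \<in> SS u"
  shows "strong_type M (\<lambda>f x. SUP S\<in>SS x. avg M f S) (ereal p) \<longleftrightarrow> (\<exists>C. \<forall>n. fan_strong (component V n) p C)"
proof
  assume "\<exists>C. \<forall>n. fan_strong (component V n) p C"
  then obtain C where C: "\<And>n. fan_strong (component V n) p C" by auto
  have "(\<Sum>u\<in>UU n \<inter> V. w u * T f u powr p) \<le> max 0 C * (\<Sum>b\<in>BB n. w b * \<bar>f b\<bar> powr p)" for f n
  proof -
    have "(\<Sum>u\<in>UU n \<inter> V. w u * T f u powr p) \<le> C * (\<Sum>b\<in>BB n. w b * \<bar>f b\<bar> powr p)"
      using C[of n, unfolded fan_strong_def, rule_format, of "\<lambda>b. \<bar>f b\<bar>"] by (simp add: fan_avg_component)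
    also have "\<dots> \<le> max 0 C * (\<Sum>b\<in>BB n. w b * \<bar>f b\<bar> powr p)"
      by (intro mult_right_mono sum_nonneg mult_nonneg_nonneg) (auto intro: w_BB_nonneg)
    finally show ?thesis .
  qed
  then have "\<forall>f. (\<integral>\<^sup>+x. epow (SUP S\<in>SS x. avg M f S) p \<partial>M) \<le> ennreal (2 powr p * (K + 10) + 2 powr p * (K + 2) * max 0 C) * Lp_pow M p f"
    using strong_upper[OF p V SS, where C = "max 0 C"] by auto
  then show "strong_type M (\<lambda>f x. SUP S\<in>SS x. avg M f S) (ereal p)"
    unfolding strong_type_def by auto
next
  assume "strong_type M (\<lambda>f x. SUP S\<in>SS x. avg M f S) (ereal p)"
  then obtain C where C: "\<And>f. in_Lp M (ereal p) f \<Longrightarrow> (\<integral>\<^sup>+x. epow (SUP S\<in>SS x. avg M f S) p \<partial>M) \<le> ennreal C * Lp_pow M p f"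
    unfolding strong_type_def by auto
  \<comment> \<open>\<open>ennreal\<close> sends a negative constant to 0, hence the maximum with
    0.\<close>
  have "fan_strong (component V n) p ((K + 2) powr p * max 0 C)" for n
    unfolding fan_strong_def
  proof (intro allI impI)
    fix f :: "'a \<Rightarrow> real" assume f: "\<forall>b. 0 \<le> f b"
    let ?f = "\<lambda>x. if x \<in> BB n then f x else 0"
    let ?r = "\<Sum>b\<in>BB n. w b * f b powr p"
    have r: "0 \<le> ?r" by (intro sum_nonneg mult_nonneg_nonneg) (auto intro: w_BB_nonneg)
    have L: "Lp_pow M p ?f = ennreal ?r" using f by (simp add: Lp_pow_restrict)
    have T: "fan_avg (component V n) f u = T ?f u" if "u \<in> UU n" for u
      using that f by (intro fan_avg_component) auto
    have "ennreal (\<Sum>u\<in>UU n \<inter> V. w u * (T ?f u / (K + 2)) powr p) = (\<integral>\<^sup>+x\<in>UU n \<inter> V. ennreal ((T ?f x / (K + 2)) powr p) \<partial>M)"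
      using finite_UU subsets_X(2) by (subst set_nn_integral_finite_real) auto
    also have "\<dots> \<le> (\<integral>\<^sup>+x. epow (SUP S\<in>SS x. avg M ?f S) p \<partial>M)"
    proof (intro nn_integral_mono)
      fix x
      show "ennreal ((T ?f x / (K + 2)) powr p) * indicator (UU n \<inter> V) x \<le> epow (SUP S\<in>SS x. avg M ?f S) p"
      proof (cases "x \<in> V")
        case True
        then have x: "x \<in> U" using V by auto
        have "epow (ennreal (T ?f x / (K + 2))) p \<le> epow (SUP S\<in>SS x. avg M ?f S) p"
          using x p by (intro epow_mono averages_ge_T Q True) auto
        then show ?thesis using T_nonneg[OF x] K by (auto simp: indicator_def)
      qed simp
    qed
    also have "\<dots> \<le> ennreal C * Lp_pow M p ?f" by (intro C) (simp add: in_Lp_def L)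
    also have "\<dots> \<le> ennreal (max 0 C * ?r)"
      unfolding L using r by (subst ennreal_mult) (auto intro!: mult_right_mono ennreal_leI)
    finally have "(\<Sum>u\<in>UU n \<inter> V. w u * (T ?f u / (K + 2)) powr p) \<le> max 0 C * ?r"
      using r by (subst (asm) ennreal_le_iff) auto
    moreover have "(\<Sum>u\<in>UU n \<inter> V. w u * (T ?f u / (K + 2)) powr p) = (\<Sum>u\<in>UU n \<inter> V. w u * T ?f u powr p) / (K + 2) powr p"
      unfolding sum_divide_distrib using K V T_nonneg by (intro sum.cong) (auto simp: powr_divide)
    ultimately have "(\<Sum>u\<in>UU n \<inter> V. w u * T ?f u powr p) \<le> (K + 2) powr p * max 0 C * ?r"
      using K by (simp add: pos_divide_le_eq ac_simps)
    then show "(\<Sum>u\<in>targets (component V n). twt (component V n) u * fan_avg (component V n) f u powr p)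
        \<le> (K + 2) powr p * max 0 C * (\<Sum>b\<in>base (component V n). bwt (component V n) b * f b powr p)"
      by (simp add: T)
  qed
  then show "\<exists>C. \<forall>n. fan_strong (component V n) p C" by blast
qed

text \<open>Common core of the weak and the restricted case: \<open>r\<close> stands for the norm of
  the test function or for the mass of the test set.\<close>

lemma weak_lower:
  assumes V: "V \<subseteq> U" and Q: "\<And>u. u \<in> V \<Longrightarrow> Q u \<in> SS u" and t: "0 < t" and r: "0 \<le> r"
    and le: "ennreal ((t / (K + 2)) powr p) * outer_measure_of M {x \<in> space M. (SUP S\<in>SS x. avg M f S) > ennreal (t / (K + 2))}
      \<le> ennreal C * ennreal r"
  shows "t powr p * (\<Sum>u | u \<in> UU n \<inter> V \<and> t < T f u. w u) \<le> (K + 2) powr p * max 0 C * r"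
proof -
  let ?S = "{u. u \<in> UU n \<inter> V \<and> t < T f u}"
  let ?E = "{x \<in> space M. (SUP S\<in>SS x. avg M f S) > ennreal (t / (K + 2))}"
  have S: "finite ?S" "?S \<subseteq> X" using finite_UU[of n] subsets_X(2) by auto
  have nonneg: "0 \<le> sum w ?S" using w_pos(2) by (intro sum_nonneg) (auto simp: less_imp_le)
  have "?S \<subseteq> ?E"
  proof
    fix u assume u: "u \<in> ?S"
    then have "ennreal (t / (K + 2)) < ennreal (T f u / (K + 2))"
      using t K by (auto simp: ennreal_less_iff divide_strict_right_mono)
    also have "\<dots> \<le> (SUP S\<in>SS u. avg M f S)" using u V by (intro averages_ge_T Q) auto
    finally show "u \<in> ?E" using u S by auto
  qed
  then have "outer_measure_of M ?S \<le> outer_measure_of M ?E" by (rule outer_measure_of_mono)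
  moreover have "outer_measure_of M ?S = ennreal (sum w ?S)"
    using S by (simp add: emeasure_finite)
  ultimately have "ennreal ((t / (K + 2)) powr p) * ennreal (sum w ?S) \<le> ennreal ((t / (K + 2)) powr p) * outer_measure_of M ?E"
    by (intro mult_left_mono) auto
  also have "\<dots> \<le> ennreal C * ennreal r" by (rule le)
  also have "\<dots> \<le> ennreal (max 0 C * r)"
    using r by (subst ennreal_mult) (auto intro!: mult_right_mono ennreal_leI)
  finally have "(t / (K + 2)) powr p * sum w ?S \<le> max 0 C * r"
    using r nonneg by (simp flip: ennreal_mult)
  then show ?thesis using t K by (simp add: powr_divide pos_divide_le_eq ac_simps)
qed

lemma weak_type_iff:
  assumes p: "1 \<le> p" and V: "V \<subseteq> U" and SS: "\<And>x S. x \<in> X \<Longrightarrow> S \<in> SS x \<Longrightarrow> admissible V x S"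
    and Q: "\<And>u. u \<in> V \<Longrightarrow> Q u \<in> SS u"
  shows "weak_type M (\<lambda>f x. SUP S\<in>SS x. avg M f S) (ereal p) \<longleftrightarrow> (\<exists>C. \<forall>n. fan_weak (component V n) p C)"
proof
  assume "\<exists>C. \<forall>n. fan_weak (component V n) p C"
  then obtain C where C: "\<And>n. fan_weak (component V n) p C" by auto
  have "(t / 2) powr p * (\<Sum>u | u \<in> UU n \<inter> V \<and> t / 2 < T f u. w u) \<le> max 0 C * (\<Sum>b\<in>BB n. w b * \<bar>f b\<bar> powr p)"
    if t: "0 < t" for f n t
  proof -
    have "{u. u \<in> UU n \<inter> V \<and> t / 2 < fan_avg (component V n) (\<lambda>b. \<bar>f b\<bar>) u} = {u. u \<in> UU n \<inter> V \<and> t / 2 < T f u}"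
      using fan_avg_component[of _ n "\<lambda>b. \<bar>f b\<bar>" f V] by auto
    then have "(t / 2) powr p * (\<Sum>u | u \<in> UU n \<inter> V \<and> t / 2 < T f u. w u) \<le> C * (\<Sum>b\<in>BB n. w b * \<bar>f b\<bar> powr p)"
      using C[of n, unfolded fan_weak_def, rule_format, of "\<lambda>b. \<bar>f b\<bar>" "t / 2"] t by simp
    also have "\<dots> \<le> max 0 C * (\<Sum>b\<in>BB n. w b * \<bar>f b\<bar> powr p)"
      by (intro mult_right_mono sum_nonneg mult_nonneg_nonneg) (auto intro: w_BB_nonneg)
    finally show ?thesis .
  qed
  then have "ennreal (t powr p) * outer_measure_of M {x \<in> space M. (SUP S\<in>SS x. avg M f S) > ennreal t}
      \<le> ennreal (2 powr p * (K + 10) + 2 powr p * (K + 2) * max 0 C) * Lp_pow M p f" if "0 < t" for t f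
    using weak_upper[OF p V SS that, where C = "max 0 C"] that by auto
  then show "weak_type M (\<lambda>f x. SUP S\<in>SS x. avg M f S) (ereal p)"
    unfolding weak_type_def by auto
next
  assume "weak_type M (\<lambda>f x. SUP S\<in>SS x. avg M f S) (ereal p)"
  then obtain C where C: "\<And>f t. in_Lp M (ereal p) f \<Longrightarrow> 0 < t \<Longrightarrow>
      ennreal (t powr p) * outer_measure_of M {x \<in> space M. (SUP S\<in>SS x. avg M f S) > ennreal t} \<le> ennreal C * Lp_pow M p f"
    unfolding weak_type_def by auto
  have "fan_weak (component V n) p ((K + 2) powr p * max 0 C)" for n
    unfolding fan_weak_def
  proof (intro allI impI)
    fix f :: "'a \<Rightarrow> real" and t :: real assume f: "\<forall>b. 0 \<le> f b" and t: "0 < t"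
    let ?f = "\<lambda>x. if x \<in> BB n then f x else 0"
    let ?r = "\<Sum>b\<in>BB n. w b * f b powr p"
    have r: "0 \<le> ?r" by (intro sum_nonneg mult_nonneg_nonneg) (auto intro: w_BB_nonneg)
    have L: "Lp_pow M p ?f = ennreal ?r" using f by (simp add: Lp_pow_restrict)
    have "{u. u \<in> UU n \<inter> V \<and> t < fan_avg (component V n) f u} = {u. u \<in> UU n \<inter> V \<and> t < T ?f u}"
      using fan_avg_component[of _ n f ?f V] f by auto
    moreover have "t powr p * (\<Sum>u | u \<in> UU n \<inter> V \<and> t < T ?f u. w u) \<le> (K + 2) powr p * max 0 C * ?r"
    proof (rule weak_lower[OF V Q t r])
      show "ennreal ((t / (K + 2)) powr p) * outer_measure_of M {x \<in> space M. (SUP S\<in>SS x. avg M ?f S) > ennreal (t / (K + 2))} \<le> ennreal C * ennreal ?r"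
        unfolding L[symmetric] using t K by (intro C) (auto simp: in_Lp_def L)
    qed auto
    ultimately show "t powr p * (\<Sum>u | u \<in> targets (component V n) \<and> t < fan_avg (component V n) f u. twt (component V n) u)
       \<le> (K + 2) powr p * max 0 C * (\<Sum>b\<in>base (component V n). bwt (component V n) b * f b powr p)"
      by simp
  qed
  then show "\<exists>C. \<forall>n. fan_weak (component V n) p C" by blast
qed

lemma restricted_weak_type_iff:
  assumes p: "1 < p" and V: "V \<subseteq> U" and SS: "\<And>x S. x \<in> X \<Longrightarrow> S \<in> SS x \<Longrightarrow> admissible V x S"
    and Q: "\<And>u. u \<in> V \<Longrightarrow> Q u \<in> SS u"
  shows "restricted_weak_type M (\<lambda>f x. SUP S\<in>SS x. avg M f S) (ereal p) \<longleftrightarrow> (\<exists>C. \<forall>n. fan_restricted (component V n) p C)"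
proof
  have p1: "1 \<le> p" using p by simp
  assume "\<exists>C. \<forall>n. fan_restricted (component V n) p C"
  then obtain C where C: "\<And>n. fan_restricted (component V n) p C" by auto
  have "(t / 2) powr p * (\<Sum>u | u \<in> UU n \<inter> V \<and> t / 2 < T (indicator E) u. w u) \<le> max 0 C * (\<Sum>b\<in>BB n. w b * \<bar>indicator E b\<bar> powr p)"
    if t: "0 < t" for E n t
  proof -
    \<comment> \<open>The test set is arbitrary, but a component sees only its trace on the
      base.\<close>
    have "{u. u \<in> UU n \<inter> V \<and> t / 2 < fan_avg (component V n) (indicator (E \<inter> BB n)) u} = {u. u \<in> UU n \<inter> V \<and> t / 2 < T (indicator E) u}"
      using fan_avg_component[of _ n "indicator (E \<inter> BB n)" "indicator E" V] by (auto simp: indicator_def)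
    then have "(t / 2) powr p * (\<Sum>u | u \<in> UU n \<inter> V \<and> t / 2 < T (indicator E) u. w u) \<le> C * sum w (E \<inter> BB n)"
      using C[of n, unfolded fan_restricted_def, rule_format, of "E \<inter> BB n" "t / 2"] t by simp
    also have "\<dots> \<le> max 0 C * sum w (E \<inter> BB n)"
      by (intro mult_right_mono sum_nonneg) (auto intro: w_BB_nonneg)
    also have "sum w (E \<inter> BB n) = (\<Sum>b\<in>BB n. w b * \<bar>indicator E b\<bar> powr p)"
      using finite_BB by (intro sum.mono_neutral_cong_left) (auto simp: indicator_def)
    finally show ?thesis .
  qed
  then have "ennreal (t powr p) * outer_measure_of M {x \<in> space M. (SUP S\<in>SS x. avg M (indicator E) S) > ennreal t}
      \<le> ennreal (2 powr p * (K + 10) + 2 powr p * (K + 2) * max 0 C) * emeasure M E" if "0 < t" "E \<in> sets M" for t E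
    using weak_upper[OF p1 V SS that(1), where C = "max 0 C" and f = "indicator E"] that by (auto simp: Lp_pow_indicator)
  then show "restricted_weak_type M (\<lambda>f x. SUP S\<in>SS x. avg M f S) (ereal p)"
    unfolding restricted_weak_type_def using p by (auto simp: one_ereal_def)
next
  assume "restricted_weak_type M (\<lambda>f x. SUP S\<in>SS x. avg M f S) (ereal p)"
  then obtain C where C: "\<And>E t. E \<in> sets M \<Longrightarrow> emeasure M E < \<infinity> \<Longrightarrow> 0 < t \<Longrightarrow>
      ennreal (t powr p) * outer_measure_of M {x \<in> space M. (SUP S\<in>SS x. avg M (indicator E) S) > ennreal t} \<le> ennreal C * emeasure M E"
    unfolding restricted_weak_type_def using p by (auto simp: one_ereal_def)
  have "fan_restricted (component V n) p ((K + 2) powr p * max 0 C)" for n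
    unfolding fan_restricted_def
  proof (intro allI impI)
    fix E t assume E: "E \<subseteq> base (component V n)" and t: "0 < (t::real)"
    have E': "finite E" "E \<subseteq> X" using E finite_BB[of n] subsets_X(1)[of n] by (auto intro: finite_subset)
    have r: "0 \<le> sum w E" using E by (intro sum_nonneg) (auto intro: w_BB_nonneg)
    have L: "emeasure M E = ennreal (sum w E)" using E' by (rule emeasure_finite)
    have "{u. u \<in> UU n \<inter> V \<and> t < fan_avg (component V n) (indicator E) u} = {u. u \<in> UU n \<inter> V \<and> t < T (indicator E) u}"
      using fan_avg_component[of _ n "indicator E" "indicator E" V] by auto
    moreover have "t powr p * (\<Sum>u | u \<in> UU n \<inter> V \<and> t < T (indicator E) u. w u) \<le> (K + 2) powr p * max 0 C * sum w E"
    proof (rule weak_lower[OF V Q t r])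
      show "ennreal ((t / (K + 2)) powr p) * outer_measure_of M {x \<in> space M. (SUP S\<in>SS x. avg M (indicator E) S) > ennreal (t / (K + 2))} \<le> ennreal C * ennreal (sum w E)"
        unfolding L[symmetric] using t K E' by (intro C) (auto simp: L)
    qed auto
    ultimately show "t powr p * (\<Sum>u | u \<in> targets (component V n) \<and> t < fan_avg (component V n) (indicator E) u. twt (component V n) u)
       \<le> (K + 2) powr p * max 0 C * sum (bwt (component V n)) E"
      by simp
  qed
  then show "\<exists>C. \<forall>n. fan_restricted (component V n) p C" by blast
qed

text \<open>Every point has positive mass, so a bound almost everywhere holds everywhere and passes
  to averages with constant 1.\<close>

lemma bounded_Linf_averages:
  assumes "\<And>x S. x \<in> X \<Longrightarrow> S \<in> SS x \<Longrightarrow> S \<subseteq> X \<and> S \<noteq> {}"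
  shows "bounded_Linf M (\<lambda>f x. SUP S\<in>SS x. avg M f S)"
  unfolding bounded_Linf_def
proof (intro exI[of _ 1] allI impI)
  fix f :: "'a \<Rightarrow> real"
  let ?N = "Linf_norm M f"
  have "AE x in M. ennreal \<bar>f x\<bar> \<le> ?N" unfolding Linf_norm_def by (rule esssup_AE)
  then have le: "ennreal \<bar>f x\<bar> \<le> ?N" if "x \<in> X" for x
    using that w_X_pos unfolding M_def AE_point_measure by (auto simp: ennreal_less_zero_iff)
  have "(SUP S\<in>SS x. avg M f S) \<le> ?N" if x: "x \<in> X" for x
  proof (rule SUP_least)
    fix S assume "S \<in> SS x"
    then have S: "S \<subseteq> X" "S \<noteq> {}" using assms x by auto
    have "(\<integral>\<^sup>+y\<in>S. ennreal \<bar>f y\<bar> \<partial>M) \<le> (\<integral>\<^sup>+y\<in>S. ?N \<partial>M)"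
      using le by (intro nn_integral_mono mult_right_mono) auto
    also have "\<dots> = ?N * emeasure M S" using S by (simp add: nn_integral_cmult)
    finally show "avg M f S \<le> ?N"
      unfolding avg_def using emeasure_pos_finite[OF S] by (intro divide_le_posI_ennreal) (auto simp: mult.commute)
  qed
  then have "{x \<in> space M. (SUP S\<in>SS x. avg M f S) > ennreal 1 * ?N} = {}" by (auto simp: not_less)
  then show "outer_measure_of M {x \<in> space M. (SUP S\<in>SS x. avg M f S) > ennreal 1 * ?N} = 0"
    by (simp only: outer_measure_of_eq sets.empty_sets emeasure_empty)
qed

end

section \<open>Metric structure\<close>

locale hub_metric = hub_space +
  fixes flag :: "nat \<Rightarrow> bool"
begin

definition flagged :: "'a set" where
  "flagged = (\<Union>n\<in>{n. flag n}. UU n)"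

text \<open>Each edge is listed in one direction only. The last clause adds the edges that turn the
  ball about a flagged target itself into \<open>Q u\<close>.\<close>

definition edge :: "'a \<Rightarrow> 'a \<Rightarrow> bool" where
  "edge x y \<longleftrightarrow> x = h \<and> y \<in> B \<or> (\<exists>u\<in>U. x \<in> A u \<and> y = c u) \<or> (\<exists>u\<in>U. x = u \<and> y = c u) \<or>
     (\<exists>u\<in>flagged. x \<in> A u \<and> y = u)"

text \<open>Nonzero distances are 1 or 2, so the triangle inequality holds for any choice of
  edges.\<close>

definition \<rho> :: "'a \<Rightarrow> 'a \<Rightarrow> real" where
  "\<rho> x y = (if x = y then 0 else if edge x y \<or> edge y x then 1 else 2)"

definition neighbours :: "'a \<Rightarrow> 'a set" where
  "neighbours x = {y \<in> X. x = y \<or> edge x y \<or> edge y x}"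

sublocale Metric_space X \<rho>
  by unfold_locales (auto simp: \<rho>_def)

lemma flagged_sub: "flagged \<subseteq> U"
  by (auto simp: flagged_def U_def)

lemma A_sub_B: "u \<in> U \<Longrightarrow> b \<in> A u \<Longrightarrow> b \<in> B"
  using A_sub by (auto simp: U_def B_def)

lemma not_base: "h \<notin> B" "u \<in> U \<Longrightarrow> u \<notin> B" "u \<in> U \<Longrightarrow> c u \<notin> B"
  using h_notin disj(1,2) by (fastforce simp: U_def B_def)+

lemma not_target: "h \<notin> U" "u \<in> U \<Longrightarrow> c u \<notin> U" "u \<in> U \<Longrightarrow> c u \<noteq> h"
  using h_notin disj(3) by (fastforce simp: U_def)+

lemma c_eq_iff: "u \<in> U \<Longrightarrow> v \<in> U \<Longrightarrow> c u = c v \<longleftrightarrow> u = v"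
  using inj_c by (auto simp: U_def inj_on_def)

lemma mball_eq:
  assumes "x \<in> X" "0 < s"
  shows "mball x s = (if s \<le> 1 then {x} else if s \<le> 2 then neighbours x else X)"
  using assms by (auto simp: set_eq_iff in_mball \<rho>_def neighbours_def split: if_splits)

lemma h_neighbours: "h \<in> neighbours h" "b \<in> B \<Longrightarrow> h \<in> neighbours b"
  by (auto simp: neighbours_def edge_def X_def)

lemma edge_center:
  assumes u: "u \<in> U"
  shows "\<not> edge (c u) y" "edge y (c u) \<longleftrightarrow> y = u \<or> y \<in> A u"
proof -
  have "c u \<notin> A v" if "v \<in> U" for v using A_sub_B[OF that] not_base(3)[OF u] by auto
  then show "\<not> edge (c u) y"
    using not_target(2,3)[of u] u flagged_sub unfolding edge_def by auto
  show "edge y (c u) \<longleftrightarrow> y = u \<or> y \<in> A u"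
    using not_target(2)[OF u] not_base(3)[OF u] u flagged_sub c_eq_iff[OF u] unfolding edge_def by auto
qed

lemma edge_target:
  assumes u: "u \<in> U"
  shows "edge u y \<longleftrightarrow> y = c u" "edge y u \<longleftrightarrow> u \<in> flagged \<and> y \<in> A u"
proof -
  have "u \<notin> A v" if "v \<in> U" for v using A_sub_B[OF that] not_base(2)[OF u] by auto
  moreover have "u \<noteq> h" using u not_target(1) by auto
  ultimately show "edge u y \<longleftrightarrow> y = c u"
    using u flagged_sub unfolding edge_def by auto
  have "u \<noteq> c v" if "v \<in> U" for v using not_target(2)[OF that] u by auto
  then show "edge y u \<longleftrightarrow> u \<in> flagged \<and> y \<in> A u"
    using not_base(2)[OF u] unfolding edge_def by auto
qed

lemma neighbours_center: "u \<in> U \<Longrightarrow> neighbours (c u) = Q u"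
  using subsets_X(4)[of u] by (auto simp: neighbours_def Q_def edge_center)

text \<open>Here the flag takes effect: it decides whether the centred operator sees
  \<open>T\<close> at the target \<open>u\<close>.\<close>

lemma neighbours_target: "u \<in> U \<Longrightarrow> neighbours u = (if u \<in> flagged then Q u else P u)"
  using subsets_X(3,4)[of u] by (auto simp: neighbours_def Q_def P_def edge_target)

section \<open>Balls are admissible sets\<close>

lemma X_cases:
  assumes "x \<in> X"
  obtains "x = h" | "x \<in> B" | "x \<in> U" | u where "u \<in> U" "x = c u"
  using assms by (auto simp: X_def)

definition centered_balls :: "'a \<Rightarrow> 'a set set" where
  "centered_balls x = mball x ` {0<..}"

definition noncentered_balls :: "'a \<Rightarrow> 'a set set" where
  "noncentered_balls x = {S. \<exists>z\<in>X. \<exists>s>0. S = mball z s \<and> x \<in> S}"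

lemma maxc_eq: "maxc X \<rho> M = (\<lambda>f x. SUP S\<in>centered_balls x. avg M f S)"
  by (auto simp: fun_eq_iff maxc_def centered_balls_def image_image)

lemma maxnc_eq: "maxnc X \<rho> M = (\<lambda>f x. SUP S\<in>noncentered_balls x. avg M f S)"
  by (auto simp: fun_eq_iff maxnc_def noncentered_balls_def)

lemma neighbours_sub: "neighbours x \<subseteq> X"
  by (auto simp: neighbours_def)

text \<open>The parameter is \<open>flagged\<close>: the ball about an unflagged target is only
  \<open>P u\<close>, and the ball \<open>Q u\<close> about its centre is used at \<open>c u\<close>
  alone. Neighbourhoods of the hub and of base points contain the hub.\<close>

lemma admissible_centered:
  assumes "x \<in> X" "S \<in> centered_balls x"
  shows "admissible flagged x S"
proof -
  from assms have "S = {x} \<or> S = X \<or> S = neighbours x"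
    by (auto simp: centered_balls_def mball_eq)
  moreover have "admissible flagged x {x}" "admissible flagged x X"
    using subsets_X(5) by (auto simp: admissible_def)
  moreover have "admissible flagged x (neighbours x)"
    using assms(1)
  proof (cases rule: X_cases)
    case 3
    then show ?thesis by (auto simp: neighbours_target admissible_def P_def Q_def)
  next
    case (4 u)
    then show ?thesis by (auto simp: neighbours_center admissible_def)
  qed (use h_neighbours neighbours_sub in \<open>auto simp: admissible_def\<close>)
  ultimately show ?thesis by auto
qed

text \<open>Any point of \<open>Q u\<close> may use the ball about \<open>c u\<close>, so all
  targets count.\<close>

lemma admissible_noncentered:
  assumes "x \<in> X" "S \<in> noncentered_balls x"
  shows "admissible U x S"
proof -
  from assms(2) obtain z s where z: "z \<in> X" "0 < s" "S = mball z s" "x \<in> S"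
    unfolding noncentered_balls_def by blast
  then have "S = {z} \<or> S = X \<or> S = neighbours z" by (auto simp: mball_eq)
  moreover have "admissible U x {x}" "admissible U x X"
    using subsets_X(5) by (auto simp: admissible_def)
  moreover have "admissible U x (neighbours z)" if x: "x \<in> neighbours z"
    using z(1)
  proof (cases rule: X_cases)
    case 3
    then show ?thesis using x by (auto simp: neighbours_target admissible_def split: if_splits)
  next
    case (4 u)
    then show ?thesis using x by (auto simp: neighbours_center admissible_def)
  qed (use h_neighbours neighbours_sub in \<open>auto simp: admissible_def\<close>)
  ultimately show ?thesis using z(4) by auto
qed

lemma Q_centered: "u \<in> flagged \<Longrightarrow> Q u \<in> centered_balls u"
proof -
  assume u: "u \<in> flagged"
  then have "u \<in> U" "u \<in> X" using flagged_sub by (auto simp: X_def)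
  then have "Q u = mball u 2" using u by (simp add: mball_eq neighbours_target)
  then show ?thesis by (auto simp: centered_balls_def)
qed

lemma Q_noncentered: "u \<in> U \<Longrightarrow> Q u \<in> noncentered_balls u"
proof -
  assume u: "u \<in> U"
  then have "c u \<in> X" by (auto simp: X_def)
  then have "Q u = mball (c u) 2" using u by (simp add: mball_eq neighbours_center)
  moreover have "u \<in> Q u" by (simp add: Q_def)
  ultimately show ?thesis using \<open>c u \<in> X\<close> unfolding noncentered_balls_def
    by (intro CollectI bexI[of _ "c u"] exI[of _ "2::real"]) auto
qed

lemma admissible_sub: "V \<subseteq> U \<Longrightarrow> x \<in> X \<Longrightarrow> admissible V x S \<Longrightarrow> S \<subseteq> X \<and> S \<noteq> {}"
  using subsets_X(3,4) unfolding admissible_def by (elim disjE bexE) (auto simp: P_def Q_def)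

lemma mms: "mms X \<rho> M"
  unfolding mms_def
proof (intro conjI ballI allI impI)
  show "X \<noteq> {}" using subsets_X(5) by auto
  show "Metric_space X \<rho>" by unfold_locales
  show "space M = X" by simp
  \<comment> \<open>Balls of radius 1 are singletons, so the topology is discrete and every subset
    is Borel.\<close>
  have "{S. openin mtopology S} = Pow X"
  proof (intro set_eqI iffI)
    fix S assume "S \<in> Pow X"
    then have "mball x 1 \<subseteq> S" if "x \<in> S" for x using that mball_eq[of x 1] by auto
    then show "S \<in> {S. openin mtopology S}"
      using \<open>S \<in> Pow X\<close> unfolding openin_mtopology mem_Collect_eq by (auto intro!: exI[of _ "1::real"])
  qed (auto simp: openin_mtopology)
  then show "sets M = mborel_sets X \<rho>"
    unfolding mborel_sets_def by (metis sets_M sigma_algebra_Pow sigma_algebra.sigma_sets_eq)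
  fix x and s :: real assume "x \<in> X" "s > 0"
  then have "mball x s \<subseteq> X" "mball x s \<noteq> {}" by auto
  then show "0 < emeasure M (mball x s)" "emeasure M (mball x s) < \<infinity>"
    by (rule emeasure_pos_finite)+
qed

text \<open>The ball of radius 1 about a base point in \<open>BB n\<close> has mass at most
  \<open>(1 / 2) ^ n\<close>; two doublings reach the whole space, of mass at least 1.\<close>

lemma not_doubling: "\<not> doubling X \<rho> M"
proof
  assume "doubling X \<rho> M"
  then obtain C :: real where C: "\<And>x s. x \<in> X \<Longrightarrow> s > 0 \<Longrightarrow> emeasure M (mball x (2 * s)) \<le> ennreal C * emeasure M (mball x s)"
    unfolding doubling_def by auto
  define D where "D = max 0 C"
  have D: "0 \<le> D" "ennreal C = ennreal D" by (auto simp: D_def max_def ennreal_neg)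
  have "1 \<le> D * D * (1 / 2) ^ n" for n
  proof -
    obtain b where b: "b \<in> BB n" using BB_nonempty by auto
    then have x: "b \<in> X" using subsets_X(1) by auto
    have "w b \<le> sum w (BB n)" using b finite_BB w_BB_nonneg by (intro member_le_sum) auto
    moreover have "0 \<le> sum w (UU n)" using w_pos(2) by (intro sum_nonneg) (auto simp: less_imp_le)
    ultimately have wb: "w b \<le> (1 / 2) ^ n" using w_summable[of n] by linarith
    have "1 \<le> emeasure M X" by (rule emeasure_M_X)
    also have "X = mball b (2 * 2)" using x by (simp add: mball_eq)
    also have "emeasure M (mball b (2 * 2)) \<le> ennreal D * emeasure M (mball b 2)" using C[OF x, of 2] D by simp
    also have "\<dots> \<le> ennreal D * (ennreal D * emeasure M (mball b 1))"
      using C[OF x, of 1] D by (intro mult_left_mono) auto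
    also have "emeasure M (mball b 1) = ennreal (w b)"
      using x by (simp add: mball_eq emeasure_finite)
    also have "ennreal D * (ennreal D * ennreal (w b)) = ennreal (D * D * w b)"
      using D w_X_pos[OF x] by (simp flip: ennreal_mult add: mult.assoc)
    finally have "1 \<le> D * D * w b" by simp
    also have "\<dots> \<le> D * D * (1 / 2) ^ n" using wb D by (intro mult_left_mono) auto
    finally show ?thesis .
  qed
  moreover have "(\<lambda>n. D * D * (1 / 2) ^ n) \<longlonglongrightarrow> D * D * 0"
    by (intro tendsto_mult tendsto_const LIMSEQ_realpow_zero) auto
  ultimately have "1 \<le> D * D * 0"
    by (intro LIMSEQ_le_const) auto
  then show False by simp
qed

lemma bounded_Linf_maximal: "bounded_Linf M (maxc X \<rho> M)" "bounded_Linf M (maxnc X \<rho> M)"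
  unfolding maxc_eq maxnc_eq
  using admissible_sub[OF flagged_sub] admissible_sub[OF subset_refl] admissible_centered admissible_noncentered
  by (intro bounded_Linf_averages; blast)+

lemma centered_iff:
  "1 \<le> p \<Longrightarrow> strong_type M (maxc X \<rho> M) (ereal p) \<longleftrightarrow> (\<exists>C. \<forall>n. fan_strong (component flagged n) p C)"
  "1 \<le> p \<Longrightarrow> weak_type M (maxc X \<rho> M) (ereal p) \<longleftrightarrow> (\<exists>C. \<forall>n. fan_weak (component flagged n) p C)"
  "1 < p \<Longrightarrow> restricted_weak_type M (maxc X \<rho> M) (ereal p) \<longleftrightarrow> (\<exists>C. \<forall>n. fan_restricted (component flagged n) p C)"
  unfolding maxc_eq
  by (intro strong_type_iff weak_type_iff restricted_weak_type_iff flagged_sub admissible_centered Q_centered; assumption)+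

lemma noncentered_iff:
  "1 \<le> p \<Longrightarrow> strong_type M (maxnc X \<rho> M) (ereal p) \<longleftrightarrow> (\<exists>C. \<forall>n. fan_strong (component U n) p C)"
  "1 \<le> p \<Longrightarrow> weak_type M (maxnc X \<rho> M) (ereal p) \<longleftrightarrow> (\<exists>C. \<forall>n. fan_weak (component U n) p C)"
  "1 < p \<Longrightarrow> restricted_weak_type M (maxnc X \<rho> M) (ereal p) \<longleftrightarrow> (\<exists>C. \<forall>n. fan_restricted (component U n) p C)"
  unfolding maxnc_eq
  by (intro strong_type_iff weak_type_iff restricted_weak_type_iff subset_refl admissible_noncentered Q_noncentered; assumption)+

lemma component_flagged: "flag n \<Longrightarrow> component flagged n = component U n"
  by (auto simp: component_def flagged_def U_def)

lemma targets_unflagged: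
  assumes "\<not> flag n"
  shows "targets (component flagged n) = {}"
proof -
  have "UU n \<inter> UU m = {}" if "flag m" for m
    using disj_UU assms that unfolding disjoint_family_on_def by (cases "n = m") auto
  then show ?thesis by (auto simp: flagged_def)
qed

text \<open>Without targets the left sides are empty sums: the centred operator does not see such a
  component.\<close>

lemma unflagged_bounds:
  assumes "\<not> flag n"
  shows "fan_strong (component flagged n) p 0" "fan_weak (component flagged n) p 0" "fan_restricted (component flagged n) p 0"
  unfolding fan_strong_def fan_weak_def fan_restricted_def targets_unflagged[OF assms] by auto

end

section \<open>Gluing families\<close>

text \<open>A relabelling of the graph with both kinds of masses multiplied by the same
  \<open>s\<close>. The averages stay the same and both sides of each inequality pick up the factor
  \<open>s\<close>, so all constants are preserved.\<close>

definition rescaled :: "('b \<Rightarrow> 'c) \<Rightarrow> ('u \<Rightarrow> 'v) \<Rightarrow> real \<Rightarrow> ('b, 'u) bigraph \<Rightarrow> ('c, 'v) bigraph \<Rightarrow> bool" where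
  "rescaled e d s G H \<longleftrightarrow> inj e \<and> inj d \<and> 0 < s \<and> base H = e ` base G \<and> targets H = d ` targets G \<and>
     (\<forall>b\<in>base G. bwt H (e b) = s * bwt G b) \<and>
     (\<forall>u\<in>targets G. link G u \<subseteq> base G \<and> link H (d u) = e ` link G u \<and> twt H (d u) = s * twt G u)"

lemma rescaled_fan_avg:
  assumes "rescaled e d s G H" "u \<in> targets G" "\<And>b. b \<in> base G \<Longrightarrow> g (e b) = f b"
  shows "fan_avg H g (d u) = fan_avg G f u"
proof -
  have r: "inj e" "0 < s" "link G u \<subseteq> base G" "link H (d u) = e ` link G u" "twt H (d u) = s * twt G u"
    "\<And>b. b \<in> base G \<Longrightarrow> bwt H (e b) = s * bwt G b"
    using assms(1,2) by (auto simp: rescaled_def)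
  have "(\<Sum>b\<in>link H (d u). bwt H b * g b) = (\<Sum>b\<in>link G u. bwt H (e b) * g (e b))"
    unfolding r(4) using r(1) by (subst sum.reindex) (auto intro: inj_on_subset)
  also have "\<dots> = (\<Sum>b\<in>link G u. s * (bwt G b * f b))"
    using r(3,6) assms(3) by (intro sum.cong) (auto simp: subset_eq)
  also have "\<dots> = s * (\<Sum>b\<in>link G u. bwt G b * f b)"
    by (simp add: sum_distrib_left)
  finally show ?thesis using r(2,5) by (simp add: fan_avg_def)
qed

lemma rescaled_sum_base:
  assumes "rescaled e d s G H" "E \<subseteq> base G"
  shows "(\<Sum>b\<in>e ` E. bwt H b * g b) = s * (\<Sum>b\<in>E. bwt G b * g (e b))"
proof -
  have "(\<Sum>b\<in>e ` E. bwt H b * g b) = (\<Sum>b\<in>E. bwt H (e b) * g (e b))"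
    using assms by (subst sum.reindex) (auto simp: rescaled_def intro: inj_on_subset)
  also have "\<dots> = (\<Sum>b\<in>E. s * (bwt G b * g (e b)))"
    using assms by (intro sum.cong) (auto simp: rescaled_def subset_eq)
  finally show ?thesis by (simp add: sum_distrib_left)
qed

lemma rescaled_sum_targets:
  assumes "rescaled e d s G H" "S \<subseteq> targets G"
  shows "(\<Sum>u\<in>d ` S. twt H u * g u) = s * (\<Sum>u\<in>S. twt G u * g (d u))"
proof -
  have "(\<Sum>u\<in>d ` S. twt H u * g u) = (\<Sum>u\<in>S. twt H (d u) * g (d u))"
    using assms by (subst sum.reindex) (auto simp: rescaled_def intro: inj_on_subset)
  also have "\<dots> = (\<Sum>u\<in>S. s * (twt G u * g (d u)))"
    using assms by (intro sum.cong) (auto simp: rescaled_def subset_eq)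
  finally show ?thesis by (simp add: sum_distrib_left)
qed

lemma rescaled_level_set:
  assumes "rescaled e d s G H" "\<And>b. b \<in> base G \<Longrightarrow> g (e b) = f b"
  shows "(\<Sum>u | u \<in> targets H \<and> t < fan_avg H g u. twt H u) = s * (\<Sum>u | u \<in> targets G \<and> t < fan_avg G f u. twt G u)"
proof -
  have "{u. u \<in> targets H \<and> t < fan_avg H g u} = d ` {u. u \<in> targets G \<and> t < fan_avg G f u}"
    using assms rescaled_fan_avg[OF assms(1), of _ g f] by (auto simp: rescaled_def)
  then show ?thesis
    using rescaled_sum_targets[OF assms(1), of "{u. u \<in> targets G \<and> t < fan_avg G f u}" "\<lambda>_. 1"] by auto
qed

lemma rescaled_fan_strong:
  assumes r: "rescaled e d s G H"
  shows "fan_strong H p C \<longleftrightarrow> fan_strong G p C"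
proof -
  have s: "0 < s" and e: "inj e" and H: "base H = e ` base G" "targets H = d ` targets G"
    using r by (auto simp: rescaled_def)
  have main: "(\<Sum>u\<in>targets H. twt H u * fan_avg H g u powr p) \<le> C * (\<Sum>b\<in>base H. bwt H b * g b powr p)
      \<longleftrightarrow> (\<Sum>u\<in>targets G. twt G u * fan_avg G (g \<circ> e) u powr p) \<le> C * (\<Sum>b\<in>base G. bwt G b * (g \<circ> e) b powr p)" for g
  proof -
    have "(\<Sum>u\<in>targets H. twt H u * fan_avg H g u powr p) = s * (\<Sum>u\<in>targets G. twt G u * fan_avg G (g \<circ> e) u powr p)"
      unfolding H(2) rescaled_sum_targets[OF r subset_refl]
      using rescaled_fan_avg[OF r, of _ g "g \<circ> e"] by simp
    moreover have "C * (\<Sum>b\<in>base H. bwt H b * g b powr p) = s * (C * (\<Sum>b\<in>base G. bwt G b * (g \<circ> e) b powr p))"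
      unfolding H(1) rescaled_sum_base[OF r subset_refl] by simp
    ultimately show ?thesis using s by (simp only: mult_le_cancel_left_pos)
  qed
  \<comment> \<open>Every test function on the original graph comes from one on the copy, through an
    inverse of the injective relabelling.\<close>
  have inv: "(f \<circ> inv e) \<circ> e = f" for f :: "_ \<Rightarrow> real"
    using e by (simp add: fun_eq_iff)
  then show ?thesis
    unfolding fan_strong_def main
  proof (intro iffI allI impI)
    fix f :: "'a \<Rightarrow> real"
    assume *: "\<forall>g. (\<forall>b. 0 \<le> g b) \<longrightarrow> (\<Sum>u\<in>targets G. twt G u * fan_avg G (g \<circ> e) u powr p) \<le> C * (\<Sum>b\<in>base G. bwt G b * (g \<circ> e) b powr p)"
      and f: "\<forall>b. 0 \<le> f b"
    show "(\<Sum>u\<in>targets G. twt G u * fan_avg G f u powr p) \<le> C * (\<Sum>b\<in>base G. bwt G b * f b powr p)"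
      using *[rule_format, of "f \<circ> inv e"] f unfolding inv by simp
  next
    fix g :: "'b \<Rightarrow> real"
    assume *: "\<forall>f. (\<forall>b. 0 \<le> f b) \<longrightarrow> (\<Sum>u\<in>targets G. twt G u * fan_avg G f u powr p) \<le> C * (\<Sum>b\<in>base G. bwt G b * f b powr p)"
      and g: "\<forall>b. 0 \<le> g b"
    show "(\<Sum>u\<in>targets G. twt G u * fan_avg G (g \<circ> e) u powr p) \<le> C * (\<Sum>b\<in>base G. bwt G b * (g \<circ> e) b powr p)"
      using *[rule_format, of "g \<circ> e"] g by simp
  qed
qed

lemma rescaled_fan_weak:
  assumes r: "rescaled e d s G H"
  shows "fan_weak H p C \<longleftrightarrow> fan_weak G p C"
proof -
  have s: "0 < s" and e: "inj e" and H: "base H = e ` base G"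
    using r by (auto simp: rescaled_def)
  have main: "t powr p * (\<Sum>u | u \<in> targets H \<and> t < fan_avg H g u. twt H u) \<le> C * (\<Sum>b\<in>base H. bwt H b * g b powr p)
      \<longleftrightarrow> t powr p * (\<Sum>u | u \<in> targets G \<and> t < fan_avg G (g \<circ> e) u. twt G u) \<le> C * (\<Sum>b\<in>base G. bwt G b * (g \<circ> e) b powr p)" for g t
  proof -
    have "t powr p * (\<Sum>u | u \<in> targets H \<and> t < fan_avg H g u. twt H u) = s * (t powr p * (\<Sum>u | u \<in> targets G \<and> t < fan_avg G (g \<circ> e) u. twt G u))"
      by (subst rescaled_level_set[OF r, of g "g \<circ> e"]) auto
    moreover have "C * (\<Sum>b\<in>base H. bwt H b * g b powr p) = s * (C * (\<Sum>b\<in>base G. bwt G b * (g \<circ> e) b powr p))"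
      unfolding H(1) rescaled_sum_base[OF r subset_refl] by simp
    ultimately show ?thesis using s by (simp only: mult_le_cancel_left_pos)
  qed
  have inv: "(f \<circ> inv e) \<circ> e = f" for f :: "_ \<Rightarrow> real"
    using e by (simp add: fun_eq_iff)
  then show ?thesis
    unfolding fan_weak_def main
  proof (intro iffI allI impI)
    fix f :: "'a \<Rightarrow> real" and t :: real
    assume *: "\<forall>g t. (\<forall>b. 0 \<le> g b) \<longrightarrow> 0 < t \<longrightarrow> t powr p * (\<Sum>u | u \<in> targets G \<and> t < fan_avg G (g \<circ> e) u. twt G u) \<le> C * (\<Sum>b\<in>base G. bwt G b * (g \<circ> e) b powr p)"
      and f: "\<forall>b. 0 \<le> f b" and t: "0 < t"
    show "t powr p * (\<Sum>u | u \<in> targets G \<and> t < fan_avg G f u. twt G u) \<le> C * (\<Sum>b\<in>base G. bwt G b * f b powr p)"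
      using *[rule_format, of "f \<circ> inv e" t] f t unfolding inv by simp
  next
    fix g :: "'b \<Rightarrow> real" and t :: real
    assume *: "\<forall>f t. (\<forall>b. 0 \<le> f b) \<longrightarrow> 0 < t \<longrightarrow> t powr p * (\<Sum>u | u \<in> targets G \<and> t < fan_avg G f u. twt G u) \<le> C * (\<Sum>b\<in>base G. bwt G b * f b powr p)"
      and g: "\<forall>b. 0 \<le> g b" and t: "0 < t"
    show "t powr p * (\<Sum>u | u \<in> targets G \<and> t < fan_avg G (g \<circ> e) u. twt G u) \<le> C * (\<Sum>b\<in>base G. bwt G b * (g \<circ> e) b powr p)"
      using *[rule_format, of "g \<circ> e" t] g t by simp
  qed
qed

lemma rescaled_fan_restricted:
  assumes r: "rescaled e d s G H"
  shows "fan_restricted H p C \<longleftrightarrow> fan_restricted G p C"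
proof -
  have s: "0 < s" and e: "inj e" and H: "base H = e ` base G"
    using r by (auto simp: rescaled_def)
  have main: "t powr p * (\<Sum>u | u \<in> targets H \<and> t < fan_avg H (indicator (e ` E)) u. twt H u) \<le> C * sum (bwt H) (e ` E)
      \<longleftrightarrow> t powr p * (\<Sum>u | u \<in> targets G \<and> t < fan_avg G (indicator E) u. twt G u) \<le> C * sum (bwt G) E" if "E \<subseteq> base G" for E t
  proof -
    have "t powr p * (\<Sum>u | u \<in> targets H \<and> t < fan_avg H (indicator (e ` E)) u. twt H u) = s * (t powr p * (\<Sum>u | u \<in> targets G \<and> t < fan_avg G (indicator E) u. twt G u))"
      using e by (subst rescaled_level_set[OF r, of _ "indicator E"]) (auto simp: indicator_def inj_image_mem_iff)
    moreover have "C * sum (bwt H) (e ` E) = s * (C * sum (bwt G) E)"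
      using rescaled_sum_base[OF r that, of "\<lambda>_. 1"] by simp
    ultimately show ?thesis using s by (simp only: mult_le_cancel_left_pos)
  qed
  show ?thesis
    unfolding fan_restricted_def
  proof (intro iffI allI impI)
    fix E t
    assume *: "\<forall>E t. E \<subseteq> base H \<longrightarrow> 0 < t \<longrightarrow> t powr p * (\<Sum>u | u \<in> targets H \<and> t < fan_avg H (indicator E) u. twt H u) \<le> C * sum (bwt H) E"
      and E: "E \<subseteq> base G" and t: "0 < (t :: real)"
    show "t powr p * (\<Sum>u | u \<in> targets G \<and> t < fan_avg G (indicator E) u. twt G u) \<le> C * sum (bwt G) E"
      using *[rule_format, of "e ` E" t] E t unfolding main[OF E] H by blast
  next
    fix E t
    assume *: "\<forall>E t. E \<subseteq> base G \<longrightarrow> 0 < t \<longrightarrow> t powr p * (\<Sum>u | u \<in> targets G \<and> t < fan_avg G (indicator E) u. twt G u) \<le> C * sum (bwt G) E"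
      and E: "E \<subseteq> base H" and t: "0 < (t :: real)"
    from E obtain E' where E': "E' \<subseteq> base G" "E = e ` E'" unfolding H by (rule subset_imageE)
    show "t powr p * (\<Sum>u | u \<in> targets H \<and> t < fan_avg H (indicator E) u. twt H u) \<le> C * sum (bwt H) E"
      unfolding E'(2) main[OF E'(1)] using * E'(1) t by blast
  qed
qed

text \<open>\<open>point k n i\<close> encodes the hub (\<open>k = 0\<close>) and the base points, targets and centres (\<open>k = 1, 2, 3\<close>)
  with index \<open>i\<close> of the \<open>n\<close>-th component.\<close>

definition point :: "nat \<Rightarrow> nat \<Rightarrow> nat \<times> nat \<Rightarrow> real" where
  "point k n i = real (to_nat (k, n, i))"

definition unpoint :: "real \<Rightarrow> nat \<times> nat \<times> nat \<times> nat" where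
  "unpoint x = from_nat (nat \<lfloor>x\<rfloor>)"

lemma unpoint_point [simp]: "unpoint (point k n i) = (k, n, i)"
  by (simp add: unpoint_def point_def)

lemma point_eq_iff [simp]: "point k n i = point k' n' i' \<longleftrightarrow> k = k' \<and> n = n' \<and> i = i'"
  by (auto dest: arg_cong[where f = unpoint])

lemma inj_point: "inj (point k n)"
  by (auto simp: inj_on_def)

text \<open>The points are codes in the naturals viewed as reals; the usual distance of the reals
  does not enter the metric.\<close>

locale glued =
  fixes G :: "nat \<Rightarrow> (nat \<times> nat, nat \<times> nat) bigraph" and K :: real
  assumes fan: "fan_graph K (G n)" and K: "0 \<le> K"
begin

text \<open>Chosen so that base and targets of the n-th component have total mass at most
  \<open>(1 / 2) ^ n\<close>.\<close>

definition scale :: "nat \<Rightarrow> real" where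
  "scale n = (1 / 2) ^ n / (1 + sum (bwt (G n)) (base (G n)) + sum (twt (G n)) (targets (G n)))"

text \<open>The last factor, for a centre, is divided by the number of targets, so that the mass
  ratios within the n-th component sum to at most \<open>(1 / 2) ^ n\<close>.\<close>

definition wt :: "real \<Rightarrow> real" where
  "wt x = (case unpoint x of (k, n, i) \<Rightarrow>
     if k = 0 then 1 else if k = 1 then scale n * bwt (G n) i else if k = 2 then scale n * twt (G n) i
     else scale n * twt (G n) i * ((1 / 2) ^ n / (1 + real (card (targets (G n))))))"

definition bases :: "nat \<Rightarrow> real set" where "bases n = point 1 n ` base (G n)"
definition targs :: "nat \<Rightarrow> real set" where "targs n = point 2 n ` targets (G n)"
definition centre :: "real \<Rightarrow> real" where "centre x = (case unpoint x of (k, n, i) \<Rightarrow> point 3 n i)"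
definition links :: "real \<Rightarrow> real set" where "links x = (case unpoint x of (k, n, i) \<Rightarrow> point 1 n ` link (G n) i)"

lemma wt_point [simp]:
  "wt (point 0 n i) = 1" "wt (point (Suc 0) n i) = scale n * bwt (G n) i" "wt (point 1 n i) = scale n * bwt (G n) i"
  "wt (point 2 n i) = scale n * twt (G n) i"
  "wt (point 3 n i) = scale n * twt (G n) i * ((1 / 2) ^ n / (1 + real (card (targets (G n)))))"
  by (auto simp: wt_def)

lemma centre_point [simp]: "centre (point k n i) = point 3 n i"
  by (simp add: centre_def)

lemma links_point [simp]: "links (point k n i) = point 1 n ` link (G n) i"
  by (simp add: links_def)

lemma G_facts:
  "finite (base (G n))" "finite (targets (G n))" "base (G n) \<noteq> {}"
  "b \<in> base (G n) \<Longrightarrow> 0 < bwt (G n) b" "u \<in> targets (G n) \<Longrightarrow> 0 < twt (G n) u"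
  "u \<in> targets (G n) \<Longrightarrow> link (G n) u \<subseteq> base (G n)"
  "u \<in> targets (G n) \<Longrightarrow> sum (bwt (G n)) (link (G n) u) \<le> K * twt (G n) u"
  using fan[of n] by (auto simp: fan_graph_def)

lemma scale_pos: "0 < scale n"
  using sum_nonneg[of "base (G n)" "bwt (G n)"] sum_nonneg[of "targets (G n)" "twt (G n)"] G_facts(4,5)[of _ n]
  by (auto simp: scale_def less_imp_le intro!: divide_pos_pos add_pos_nonneg)

lemma sum_point: "(\<Sum>x\<in>point k n ` S. g x) = (\<Sum>i\<in>S. g (point k n i))"
  using inj_point by (subst sum.reindex) (auto intro: inj_on_subset)

sublocale hub_space wt "point 0 0 (0, 0)" bases targs centre links K
proof
  fix n m
  show "finite (bases n)" "finite (targs n)" "bases n \<noteq> {}"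
    using G_facts(1-3) by (auto simp: bases_def targs_def)
  show "disjoint_family bases" "disjoint_family targs"
    by (auto simp: disjoint_family_on_def bases_def targs_def)
  show "point 0 0 (0, 0) \<notin> bases n" "point 0 0 (0, 0) \<notin> targs n" "point 0 0 (0, 0) \<notin> centre ` targs n"
    by (auto simp: bases_def targs_def)
  show "bases m \<inter> targs n = {}" "bases m \<inter> centre ` targs n = {}" "targs m \<inter> centre ` targs n = {}"
    by (auto simp: bases_def targs_def)
  show "inj_on centre (\<Union>n. targs n)"
    by (auto simp: inj_on_def targs_def)
  show "wt (point 0 0 (0, 0)) = 1" by simp
  show "0 \<le> K" by (rule K)
  have dd: "0 < 1 + sum (bwt (G n)) (base (G n)) + sum (twt (G n)) (targets (G n))"
    using sum_nonneg[of "base (G n)" "bwt (G n)"] sum_nonneg[of "targets (G n)" "twt (G n)"] G_facts(4,5)[of _ n]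
    by (auto simp: less_imp_le intro!: add_pos_nonneg)
  have "sum wt (bases n) + sum wt (targs n) = scale n * (sum (bwt (G n)) (base (G n)) + sum (twt (G n)) (targets (G n)))"
    by (simp add: bases_def targs_def sum_point sum_distrib_left distrib_left)
  also have "\<dots> \<le> (1 / 2) ^ n"
    using dd unfolding scale_def by (simp add: pos_divide_le_eq)
  finally show "sum wt (bases n) + sum wt (targs n) \<le> (1 / 2) ^ n" .
  have "(\<Sum>u\<in>targs n. wt (centre u) / wt u) = (\<Sum>u\<in>targets (G n). (1 / 2) ^ n / (1 + real (card (targets (G n)))))"
    unfolding targs_def sum_point
  proof (intro sum.cong refl)
    fix i assume "i \<in> targets (G n)"
    then have "0 < scale n * twt (G n) i" using scale_pos[of n] G_facts(5) by simp
    then show "wt (centre (point 2 n i)) / wt (point 2 n i) = (1 / 2) ^ n / (1 + real (card (targets (G n))))"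
      by (auto simp: zero_less_mult_iff)
  qed
  also have "\<dots> \<le> (1 / 2) ^ n" by (simp add: pos_divide_le_eq)
  finally show "(\<Sum>u\<in>targs n. wt (centre u) / wt u) \<le> (1 / 2) ^ n" .
  fix b assume "b \<in> bases n"
  then show "0 < wt b" using scale_pos G_facts(4) by (auto simp: bases_def)
next
  fix u n assume "u \<in> targs n"
  then obtain i where i: "i \<in> targets (G n)" "u = point 2 n i" by (auto simp: targs_def)
  show "links u \<subseteq> bases n" using G_facts(6)[OF i(1)] by (simp add: i bases_def image_mono)
  have pos: "0 < scale n * twt (G n) i" using scale_pos G_facts(5)[OF i(1)] by simp
  show "0 < wt u" using pos i by simp
  have d: "0 < (1 / 2 :: real) ^ n / (1 + real (card (targets (G n))))" by (simp add: add_pos_nonneg)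
  have "(1 / 2 :: real) ^ n \<le> 1" by (intro power_le_one) auto
  then have d1: "(1 / 2 :: real) ^ n / (1 + real (card (targets (G n)))) \<le> 1"
    by (subst pos_divide_le_eq) auto
  show "0 < wt (centre u)" using pos d i by simp
  show "wt (centre u) \<le> wt u" using mult_left_mono[OF d1, of "scale n * twt (G n) i"] pos i by simp
  have "sum wt (links u) = scale n * sum (bwt (G n)) (link (G n) i)"
    by (simp add: i sum_point sum_distrib_left)
  also have "\<dots> \<le> scale n * (K * twt (G n) i)"
    using G_facts(7)[OF i(1)] scale_pos[of n] by (intro mult_left_mono) auto
  finally show "sum wt (links u) \<le> K * wt u" by (simp add: i ac_simps)
qed

lemma rescaled_component: "rescaled (point 1 n) (point 2 n) (scale n) (G n) (component U n)"
proof -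
  have "targs n \<inter> U = targs n" by (auto simp: U_def)
  then show ?thesis
    using scale_pos[of n] G_facts(6) inj_point by (auto simp: rescaled_def bases_def targs_def)
qed

end

section \<open>Interleaving the two families and conclusion\<close>

lemma ex_bound_interleave:
  fixes P :: "nat \<Rightarrow> real \<Rightarrow> bool"
  assumes mono: "\<And>n C C'. C \<le> C' \<Longrightarrow> P n C \<Longrightarrow> P n C'"
  shows "(\<exists>C. \<forall>n. P n C) \<longleftrightarrow> (\<exists>C. \<forall>m. P (2 * m) C) \<and> (\<exists>C. \<forall>m. P (2 * m + 1) C)"
proof
  assume "(\<exists>C. \<forall>m. P (2 * m) C) \<and> (\<exists>C. \<forall>m. P (2 * m + 1) C)"
  then obtain C D where CD: "\<And>m. P (2 * m) C" "\<And>m. P (2 * m + 1) D" by auto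
  have "P n (max C D)" for n
  proof (cases "even n")
    case True
    then obtain m where "n = 2 * m" by (rule evenE)
    then show ?thesis using mono[OF _ CD(1)[of m], of "max C D"] by simp
  next
    case False
    then obtain m where "n = 2 * m + 1" by (rule oddE)
    then show ?thesis using mono[OF _ CD(2)[of m], of "max C D"] by simp
  qed
  then show "\<exists>C. \<forall>n. P n C" by blast
qed blast

lemma exp_set_infinity: "exp_set P \<Longrightarrow> \<infinity> \<in> P"
  by (auto simp: exp_set_def)

lemma exp_set_one:
  assumes "exp_set P" "1 \<in> P"
  shows "P = {1..\<infinity>}"
proof -
  from assms obtain p0 :: real where p0: "1 \<le> p0" "P = {ereal p0..\<infinity>} \<or> P = {ereal p0<..\<infinity>}"
    by (auto simp: exp_set_def one_ereal_def)
  with assms(2) have "p0 = 1" "P = {ereal p0..\<infinity>}" by (auto simp: one_ereal_def)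
  then show ?thesis by (simp add: one_ereal_def)
qed

theorem theorem2p1p2:
  fixes Pcs Pcw Pcr Ps Pw Pr :: "ereal set"
  assumes "exp_set Pcs" "exp_set Pcw" "exp_set Pcr" "exp_set Ps" "exp_set Pw" "exp_set Pr"
    and "Ps \<subseteq> Pcs" "Pw \<subseteq> Pcw" "Pr \<subseteq> Pcr"
    and "Pcs \<subseteq> Pcw" "Pcw \<subseteq> Pcr" "Pcr \<subseteq> closure Pcs"
    and "Ps \<subseteq> Pw" "Pw \<subseteq> Pr" "Pr \<subseteq> closure Ps"
    and "Pcr = {1..\<infinity>} \<Longrightarrow> Pcw = {1..\<infinity>}"
    and "Pr = {1..\<infinity>} \<Longrightarrow> Pw = {1..\<infinity>}"
  shows "\<exists>(X::real set) \<rho> M. mms X \<rho> M \<and> \<not> doubling X \<rho> M \<and>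
    (\<forall>p\<in>{1..\<infinity>}.
       (strong_type M (maxc X \<rho> M) p \<longleftrightarrow> p \<in> Pcs) \<and>
       (weak_type M (maxc X \<rho> M) p \<longleftrightarrow> p \<in> Pcw) \<and>
       (restricted_weak_type M (maxc X \<rho> M) p \<longleftrightarrow> p \<in> Pcr) \<and>
       (strong_type M (maxnc X \<rho> M) p \<longleftrightarrow> p \<in> Ps) \<and>
       (weak_type M (maxnc X \<rho> M) p \<longleftrightarrow> p \<in> Pw) \<and>
       (restricted_weak_type M (maxnc X \<rho> M) p \<longleftrightarrow> p \<in> Pr))"
proof -
  obtain GA :: "nat \<Rightarrow> (nat \<times> nat, nat \<times> nat) bigraph" where GA: "fan_family GA Pcs Pcw Pcr"
    using fan_family_exists[of Pcs Pcw Pcr] assms by blast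
  obtain GB :: "nat \<Rightarrow> (nat \<times> nat, nat \<times> nat) bigraph" where GB: "fan_family GB Ps Pw Pr"
    using fan_family_exists[of Ps Pw Pr] assms by blast
  from GA GB obtain KA KB where KA: "\<And>n. fan_graph KA (GA n)" and KB: "\<And>n. fan_graph KB (GB n)"
    unfolding fan_family_def by blast
  \<comment> \<open>Even components carry the family for the centred operator and will be flagged;
    odd components carry the family for the noncentred one.\<close>
  define G where "G n = (if even n then GA (n div 2) else GB (n div 2))" for n
  define K where "K = max 0 (max KA KB)"
  have "fan_graph K (G n)" for n
    using fan_graph_mono[OF KA, of K] fan_graph_mono[OF KB, of K] by (auto simp: G_def K_def)
  moreover have "0 \<le> K" by (simp add: K_def)
  ultimately interpret glued G K by unfold_locales
  interpret hub_metric wt "point 0 0 (0, 0)" bases targs centre links K even ..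
  have G: "G (2 * m) = GA m" "G (2 * m + 1) = GB m" for m
    by (auto simp: G_def)
  have comp: "component flagged (2 * m) = component U (2 * m)" for m
    by (rule component_flagged) simp
  have odd: "\<not> even (2 * m + 1)" for m :: nat by simp
  have ex_bound:
    "(\<exists>C. \<forall>n. fan_strong (component V n) p C) \<longleftrightarrow> (\<exists>C. \<forall>m. fan_strong (component V (2 * m)) p C) \<and> (\<exists>C. \<forall>m. fan_strong (component V (2 * m + 1)) p C)"
    "(\<exists>C. \<forall>n. fan_weak (component V n) p C) \<longleftrightarrow> (\<exists>C. \<forall>m. fan_weak (component V (2 * m)) p C) \<and> (\<exists>C. \<forall>m. fan_weak (component V (2 * m + 1)) p C)"
    "(\<exists>C. \<forall>n. fan_restricted (component V n) p C) \<longleftrightarrow> (\<exists>C. \<forall>m. fan_restricted (component V (2 * m)) p C) \<and> (\<exists>C. \<forall>m. fan_restricted (component V (2 * m + 1)) p C)" for V p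
    by (rule ex_bound_interleave, erule (1) fan_strong_mono[OF fan_graph_component] fan_weak_mono[OF fan_graph_component] fan_restricted_mono[OF fan_graph_component])+
  note rescale = rescaled_fan_strong[OF rescaled_component] rescaled_fan_weak[OF rescaled_component]
    rescaled_fan_restricted[OF rescaled_component]
  have flagged:
    "(\<exists>C. \<forall>n. fan_strong (component flagged n) p C) \<longleftrightarrow> (\<exists>C. \<forall>m. fan_strong (GA m) p C)"
    "(\<exists>C. \<forall>n. fan_weak (component flagged n) p C) \<longleftrightarrow> (\<exists>C. \<forall>m. fan_weak (GA m) p C)"
    "(\<exists>C. \<forall>n. fan_restricted (component flagged n) p C) \<longleftrightarrow> (\<exists>C. \<forall>m. fan_restricted (GA m) p C)" for p
    using ex_bound[of flagged p, unfolded comp rescale G] unflagged_bounds[OF odd] by blast+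
  \<comment> \<open>The noncentred operator needs bounds for both families. The inclusions of the
    noncentred sets in the centred ones later discard the first condition.\<close>
  have all:
    "(\<exists>C. \<forall>n. fan_strong (component U n) p C) \<longleftrightarrow> (\<exists>C. \<forall>m. fan_strong (GA m) p C) \<and> (\<exists>C. \<forall>m. fan_strong (GB m) p C)"
    "(\<exists>C. \<forall>n. fan_weak (component U n) p C) \<longleftrightarrow> (\<exists>C. \<forall>m. fan_weak (GA m) p C) \<and> (\<exists>C. \<forall>m. fan_weak (GB m) p C)"
    "(\<exists>C. \<forall>n. fan_restricted (component U n) p C) \<longleftrightarrow> (\<exists>C. \<forall>m. fan_restricted (GA m) p C) \<and> (\<exists>C. \<forall>m. fan_restricted (GB m) p C)" for p
    using ex_bound[of U p] unfolding rescale G by blast+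
  \<comment> \<open>Condition (iii) is what the endpoint 1 needs, where restricted weak type is weak
    type by definition.\<close>
  have one: "1 \<in> Pcr \<longleftrightarrow> 1 \<in> Pcw" "1 \<in> Pr \<longleftrightarrow> 1 \<in> Pw"
  proof -
    have "1 \<in> Pcw" if "1 \<in> Pcr"
      unfolding assms(16)[OF exp_set_one[OF assms(3) that]] by simp
    then show "1 \<in> Pcr \<longleftrightarrow> 1 \<in> Pcw" using assms(11) by blast
    have "1 \<in> Pw" if "1 \<in> Pr"
      unfolding assms(17)[OF exp_set_one[OF assms(6) that]] by simp
    then show "1 \<in> Pr \<longleftrightarrow> 1 \<in> Pw" using assms(14) by blast
  qed
  have fin: "(strong_type M (maxc X \<rho> M) (ereal p) \<longleftrightarrow> ereal p \<in> Pcs) \<and>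
       (weak_type M (maxc X \<rho> M) (ereal p) \<longleftrightarrow> ereal p \<in> Pcw) \<and>
       (restricted_weak_type M (maxc X \<rho> M) (ereal p) \<longleftrightarrow> ereal p \<in> Pcr) \<and>
       (strong_type M (maxnc X \<rho> M) (ereal p) \<longleftrightarrow> ereal p \<in> Ps) \<and>
       (weak_type M (maxnc X \<rho> M) (ereal p) \<longleftrightarrow> ereal p \<in> Pw) \<and>
       (restricted_weak_type M (maxnc X \<rho> M) (ereal p) \<longleftrightarrow> ereal p \<in> Pr)" if p: "1 \<le> p" for p
  proof -
    have A: "(\<exists>C. \<forall>m. fan_strong (GA m) p C) \<longleftrightarrow> ereal p \<in> Pcs" "(\<exists>C. \<forall>m. fan_weak (GA m) p C) \<longleftrightarrow> ereal p \<in> Pcw"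
      "(\<exists>C. \<forall>m. fan_restricted (GA m) p C) \<longleftrightarrow> ereal p \<in> Pcr"
      using GA p unfolding fan_family_def by blast+
    have B: "(\<exists>C. \<forall>m. fan_strong (GB m) p C) \<longleftrightarrow> ereal p \<in> Ps" "(\<exists>C. \<forall>m. fan_weak (GB m) p C) \<longleftrightarrow> ereal p \<in> Pw"
      "(\<exists>C. \<forall>m. fan_restricted (GB m) p C) \<longleftrightarrow> ereal p \<in> Pr"
      using GB p unfolding fan_family_def by blast+
    have sw: "strong_type M (maxc X \<rho> M) (ereal p) \<longleftrightarrow> ereal p \<in> Pcs" "weak_type M (maxc X \<rho> M) (ereal p) \<longleftrightarrow> ereal p \<in> Pcw"
      "strong_type M (maxnc X \<rho> M) (ereal p) \<longleftrightarrow> ereal p \<in> Ps" "weak_type M (maxnc X \<rho> M) (ereal p) \<longleftrightarrow> ereal p \<in> Pw"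
      unfolding centered_iff(1,2)[OF p] noncentered_iff(1,2)[OF p] flagged all A B
      using assms(7,8) by blast+
    show ?thesis
    proof (cases "p = 1")
      case True
      then have "restricted_weak_type M T (ereal p) = weak_type M T (ereal p)" for T :: "(real \<Rightarrow> real) \<Rightarrow> real \<Rightarrow> ennreal"
        by (simp add: restricted_weak_type_def one_ereal_def)
      then show ?thesis using sw one True by (simp add: one_ereal_def)
    next
      case False
      then have "1 < p" using p by simp
      then have "restricted_weak_type M (maxc X \<rho> M) (ereal p) \<longleftrightarrow> ereal p \<in> Pcr"
        "restricted_weak_type M (maxnc X \<rho> M) (ereal p) \<longleftrightarrow> ereal p \<in> Pr"
        unfolding centered_iff(3)[OF \<open>1 < p\<close>] noncentered_iff(3)[OF \<open>1 < p\<close>] flagged all A B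
        using assms(9) by blast+
      then show ?thesis using sw by blast
    qed
  qed
  show ?thesis
  proof (intro exI conjI ballI)
    show "mms X \<rho> M" by (rule mms)
    show "\<not> doubling X \<rho> M" by (rule not_doubling)
    fix p :: ereal assume p: "p \<in> {1..\<infinity>}"
    \<comment> \<open>At infinity all three notions mean boundedness, which always holds, in
      accordance with (i).\<close>
    have inf: "\<infinity> \<in> Pcs" "\<infinity> \<in> Pcw" "\<infinity> \<in> Pcr" "\<infinity> \<in> Ps" "\<infinity> \<in> Pw" "\<infinity> \<in> Pr"
      using exp_set_infinity assms(1-6) by blast+
    have "strong_type M T \<infinity> = bounded_Linf M T" "weak_type M T \<infinity> = bounded_Linf M T"
      "restricted_weak_type M T \<infinity> = bounded_Linf M T" for T :: "(real \<Rightarrow> real) \<Rightarrow> real \<Rightarrow> ennreal"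
      by (auto simp: strong_type_def weak_type_def restricted_weak_type_def)
    note infinite = this
    show "strong_type M (maxc X \<rho> M) p \<longleftrightarrow> p \<in> Pcs" "weak_type M (maxc X \<rho> M) p \<longleftrightarrow> p \<in> Pcw"
      "restricted_weak_type M (maxc X \<rho> M) p \<longleftrightarrow> p \<in> Pcr" "strong_type M (maxnc X \<rho> M) p \<longleftrightarrow> p \<in> Ps"
      "weak_type M (maxnc X \<rho> M) p \<longleftrightarrow> p \<in> Pw" "restricted_weak_type M (maxnc X \<rho> M) p \<longleftrightarrow> p \<in> Pr"
      using p fin infinite inf bounded_Linf_maximal by (cases p; simp add: one_ereal_def)+
  qed
qed

end
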